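(* Let $\mathfrak g$ be a basic Lie superalgebra and $k\in\mathbb C$, $k\ne-h^\vee$. (1) Assume that $\mathfrak g_{\bar 0}$ is a semisimple Lie algebra. Then $KL_k^{fin}=KL_k^{ss}$. (2) Assume that there is a conformal embedding $V_{k_1}(\mathfrak g_{\bar 0})\hookrightarrow V_k(\mathfrak g)$ and that every module $W$ in $KL_k$ is semisimple as a $V_{k_1}(\mathfrak g_{\bar 0})$-module. Then $KL_k^{fin}=KL_k$.
   Context: Everything is over $\mathbb C$. A basic Lie superalgebra $\mathfrak g=\mathfrak g_{\bar 0}\oplus\mathfrak g_{\bar 1}$ is a simple finite-dimensional Lie superalgebra with $\mathfrak g_{\bar 0}$ reductive admitting a nondegenerate even invariant supersymmetric bilinear form, normalized by $(\theta|\theta)=2$ for a fixed even root $\theta$ maximal among even positive roots (with $-\theta$ minimal). $h^\vee$ is half the eigenvalue on $\mathfrak g$ of the Casimir operator. $\mathfrak h$ is a Cartan subalgebra of $\mathfrak g_{\bar0}$, $\widehat{\mathfrak g}=\mathbb C[t,t^{-1}]\otimes\mathfrak g\oplus\mathbb CK\oplus\mathbb Cd$, $\widehat{\mathfrak h}=\mathfrak h\oplus\mathbb CK\oplus\mathbb Cd$. $V_k(\mathfrak g)$ is the simple affine vertex algebra of level $k$, $L_{\mathfrak g}$ its Sugawara vector; $d$ acts on weak modules as $-L_{\mathfrak g}(0)$. $KL_k$ is the category of weak $V_k(\mathfrak g)$-modules which are locally finite as $\mathfrak g$-modules and decompose into generalized eigenspaces for $L_{\mathfrak g}(0)$ with eigenvalues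 bounded below. $KL_k^{fin}$ (resp. $KL_k^{ss}$) is the full subcategory of modules in $KL_k$ on which $\widehat{\mathfrak h}$ (resp. $L_{\mathfrak g}(0)$) acts semisimply. $V_{k_1}(\mathfrak g_{\bar 0})$ denotes the simple affine vertex algebra of the reductive Lie algebra $\mathfrak g_{\bar 0}$ (tensor product of simple affine vertex algebras of its simple ideals and a Heisenberg vertex algebra for its center), $k_1$ being the (multi-)level given by restriction of $k(\cdot|\cdot)$ to $\mathfrak g_{\bar 0}$. An embedding is conformal if the Sugawara conformal vectors coincide. *)

theory Defs
  imports Complex_Main "HOL-Library.Z2" "HOL-Library.Groups_Big_Fun"
begin

section \<open>Complex vector spaces and superspaces\<close>

class complex_vector = ab_group_add +
  fixes scaleC :: "complex \<Rightarrow> 'a \<Rightarrow> 'a" (infixr "*\<^sub>C" 75)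
  assumes scaleC_add_right: "c *\<^sub>C (x + y) = c *\<^sub>C x + c *\<^sub>C y"
    and scaleC_add_left: "(c + d) *\<^sub>C x = c *\<^sub>C x + d *\<^sub>C x"
    and scaleC_scaleC: "c *\<^sub>C (d *\<^sub>C x) = (c * d) *\<^sub>C x"
    and scaleC_one: "1 *\<^sub>C x = x"

global_interpretation cvs: vector_space "scaleC :: complex \<Rightarrow> 'a \<Rightarrow> 'a::complex_vector"
  by unfold_locales (simp_all add: scaleC_add_right scaleC_add_left scaleC_scaleC scaleC_one)

abbreviation clinear :: "('a::complex_vector \<Rightarrow> 'b::complex_vector) \<Rightarrow> bool" where
  "clinear \<equiv> Vector_Spaces.linear scaleC scaleC"

abbreviation cfunctional :: "('a::complex_vector \<Rightarrow> complex) \<Rightarrow> bool" where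
  "cfunctional \<equiv> Vector_Spaces.linear scaleC (*)"

text \<open>A superspace structure on a vector space is a function sending a parity in Z/2
  (the type \<^typ>\<open>bit\<close>) to the subspace of vectors of that parity.\<close>

definition superspace :: "(bit \<Rightarrow> 'a::complex_vector set) \<Rightarrow> bool" where
  "superspace par \<longleftrightarrow> (\<forall>p. cvs.subspace (par p)) \<and> par 0 \<inter> par 1 = {0} \<and>
     (\<forall>v. \<exists>a\<in>par 0. \<exists>b\<in>par 1. v = a + b)"

definition graded_subspace :: "(bit \<Rightarrow> 'a::complex_vector set) \<Rightarrow> 'a set \<Rightarrow> bool" where
  "graded_subspace par I \<longleftrightarrow> cvs.subspace I \<and>
     (\<forall>v\<in>I. \<exists>a\<in>I \<inter> par 0. \<exists>b\<in>I \<inter> par 1. v = a + b)"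

definition koszul :: "bit \<Rightarrow> bit \<Rightarrow> complex" where
  "koszul p q = (if p = 1 \<and> q = 1 then -1 else 1)"

section \<open>Lie superalgebras\<close>

record 'g super_lie =
  gpar :: "bit \<Rightarrow> 'g set"
  brk :: "'g \<Rightarrow> 'g \<Rightarrow> 'g"
  form :: "'g \<Rightarrow> 'g \<Rightarrow> complex"

definition lie_superalgebra :: "'g::complex_vector super_lie \<Rightarrow> bool" where
  "lie_superalgebra g \<longleftrightarrow> superspace (gpar g) \<and>
     (\<forall>x. clinear (brk g x)) \<and> (\<forall>y. clinear (\<lambda>x. brk g x y)) \<and>
     (\<forall>p q. \<forall>x\<in>gpar g p. \<forall>y\<in>gpar g q. brk g x y \<in> gpar g (p + q)) \<and>
     (\<forall>p q. \<forall>x\<in>gpar g p. \<forall>y\<in>gpar g q. brk g x y = - (koszul p q *\<^sub>C brk g y x)) \<and>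
     (\<forall>p q. \<forall>x\<in>gpar g p. \<forall>y\<in>gpar g q. \<forall>z.
        brk g x (brk g y z) = brk g (brk g x y) z + koszul p q *\<^sub>C brk g y (brk g x z))"

definition simple_lie_superalgebra :: "'g::complex_vector super_lie \<Rightarrow> bool" where
  "simple_lie_superalgebra g \<longleftrightarrow> lie_superalgebra g \<and> (\<exists>x y. brk g x y \<noteq> 0) \<and>
     (\<forall>I. graded_subspace (gpar g) I \<and> (\<forall>x. \<forall>y\<in>I. brk g x y \<in> I) \<longrightarrow> I = {0} \<or> I = UNIV)"

text \<open>Notions for the Lie subalgebras of the even part; \<open>A\<close> is the ambient Lie algebra.\<close>

definition lie_ideal :: "'g::complex_vector super_lie \<Rightarrow> 'g set \<Rightarrow> 'g set \<Rightarrow> bool" where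
  "lie_ideal g A I \<longleftrightarrow> cvs.subspace I \<and> I \<subseteq> A \<and> (\<forall>x\<in>A. \<forall>y\<in>I. brk g x y \<in> I)"

definition lie_center :: "'g::complex_vector super_lie \<Rightarrow> 'g set \<Rightarrow> 'g set" where
  "lie_center g A = {x\<in>A. \<forall>y\<in>A. brk g x y = 0}"

primrec derived_series :: "'g::complex_vector super_lie \<Rightarrow> 'g set \<Rightarrow> nat \<Rightarrow> 'g set" where
  "derived_series g A 0 = A"
| "derived_series g A (Suc n) =
     cvs.span {brk g x y |x y. x \<in> derived_series g A n \<and> y \<in> derived_series g A n}"

primrec lower_central_series :: "'g::complex_vector super_lie \<Rightarrow> 'g set \<Rightarrow> nat \<Rightarrow> 'g set" where
  "lower_central_series g A 0 = A"
| "lower_central_series g A (Suc n) =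
     cvs.span {brk g x y |x y. x \<in> A \<and> y \<in> lower_central_series g A n}"

definition solvable_lie :: "'g::complex_vector super_lie \<Rightarrow> 'g set \<Rightarrow> bool" where
  "solvable_lie g A \<longleftrightarrow> (\<exists>n. derived_series g A n = {0})"

definition nilpotent_lie :: "'g::complex_vector super_lie \<Rightarrow> 'g set \<Rightarrow> bool" where
  "nilpotent_lie g A \<longleftrightarrow> (\<exists>n. lower_central_series g A n = {0})"

definition reductive_lie :: "'g::complex_vector super_lie \<Rightarrow> 'g set \<Rightarrow> bool" where
  "reductive_lie g A \<longleftrightarrow> (\<forall>I. lie_ideal g A I \<and> solvable_lie g I \<longrightarrow> I \<subseteq> lie_center g A)"

definition semisimple_lie :: "'g::complex_vector super_lie \<Rightarrow> 'g set \<Rightarrow> bool" where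
  "semisimple_lie g A \<longleftrightarrow> (\<forall>I. lie_ideal g A I \<and> solvable_lie g I \<longrightarrow> I = {0})"

definition simple_ideals :: "'g::complex_vector super_lie \<Rightarrow> 'g set \<Rightarrow> 'g set set" where
  "simple_ideals g A = {S. lie_ideal g A S \<and> (\<exists>x\<in>S. \<exists>y\<in>S. brk g x y \<noteq> 0) \<and>
     (\<forall>I. lie_ideal g S I \<longrightarrow> I = {0} \<or> I = S)}"

definition cartan_subalgebra :: "'g::complex_vector super_lie \<Rightarrow> 'g set \<Rightarrow> 'g set \<Rightarrow> bool" where
  "cartan_subalgebra g A h \<longleftrightarrow> cvs.subspace h \<and> h \<subseteq> A \<and>
     (\<forall>x\<in>h. \<forall>y\<in>h. brk g x y \<in> h) \<and> nilpotent_lie g h \<and>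
     {x\<in>A. \<forall>y\<in>h. brk g x y \<in> h} = h"

definition invariant_form :: "'g::complex_vector super_lie \<Rightarrow> bool" where
  "invariant_form g \<longleftrightarrow>
     (\<forall>x. cfunctional (form g x)) \<and> (\<forall>y. cfunctional (\<lambda>x. form g x y)) \<and>
     (\<forall>x\<in>gpar g 0. \<forall>y\<in>gpar g 1. form g x y = 0 \<and> form g y x = 0) \<and>
     (\<forall>p q. \<forall>x\<in>gpar g p. \<forall>y\<in>gpar g q. form g x y = koszul p q * form g y x) \<and>
     (\<forall>x y z. form g (brk g x y) z = form g x (brk g y z)) \<and>
     (\<forall>x. (\<forall>y. form g x y = 0) \<longrightarrow> x = 0)"

definition basic_lie_superalgebra :: "'g::complex_vector super_lie \<Rightarrow> bool" where
  "basic_lie_superalgebra g \<longleftrightarrow> (\<exists>E::'g set. finite E \<and> cvs.span E = UNIV) \<and>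
     simple_lie_superalgebra g \<and> reductive_lie g (gpar g 0) \<and> invariant_form g"

section \<open>Roots and the normalization of the form\<close>

text \<open>A functional on the subspace \<open>h\<close> is encoded as the function that extends it by 0
  outside \<open>h\<close>, so that equality of functionals is equality of functions.\<close>

definition dual_space :: "'g::complex_vector set \<Rightarrow> ('g \<Rightarrow> complex) set" where
  "dual_space h = {\<alpha>. (\<forall>x\<in>h. \<forall>y\<in>h. \<alpha> (x + y) = \<alpha> x + \<alpha> y) \<and>
     (\<forall>c. \<forall>x\<in>h. \<alpha> (c *\<^sub>C x) = c * \<alpha> x) \<and> (\<forall>x. x \<notin> h \<longrightarrow> \<alpha> x = 0)}"

definition root_space :: "'g::complex_vector super_lie \<Rightarrow> 'g set \<Rightarrow> ('g \<Rightarrow> complex) \<Rightarrow> 'g set" where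
  "root_space g h \<alpha> = {x. \<forall>H\<in>h. brk g H x = \<alpha> H *\<^sub>C x}"

definition roots :: "'g::complex_vector super_lie \<Rightarrow> 'g set \<Rightarrow> ('g \<Rightarrow> complex) set" where
  "roots g h = {\<alpha>\<in>dual_space h. \<alpha> \<noteq> (\<lambda>_. 0) \<and> root_space g h \<alpha> \<noteq> {0}}"

definition even_roots :: "'g::complex_vector super_lie \<Rightarrow> 'g set \<Rightarrow> ('g \<Rightarrow> complex) set" where
  "even_roots g h = {\<alpha>\<in>roots g h. root_space g h \<alpha> \<inter> gpar g 0 \<noteq> {0}}"

text \<open>Systems of positive roots, given by an additive function that vanishes at no root.\<close>

definition positive_system :: "'g::complex_vector super_lie \<Rightarrow> 'g set \<Rightarrow> ('g \<Rightarrow> complex) set \<Rightarrow> bool" where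
  "positive_system g h P \<longleftrightarrow> (\<exists>F :: ('g \<Rightarrow> complex) \<Rightarrow> real.
     (\<forall>\<alpha>\<in>dual_space h. \<forall>\<beta>\<in>dual_space h. F (\<lambda>H. \<alpha> H + \<beta> H) = F \<alpha> + F \<beta>) \<and>
     (\<forall>\<alpha>\<in>roots g h. F \<alpha> \<noteq> 0) \<and> P = {\<alpha>\<in>roots g h. F \<alpha> > 0})"

inductive_set nonneg_combinations :: "('g \<Rightarrow> complex) set \<Rightarrow> ('g \<Rightarrow> complex) set"
  for P :: "('g \<Rightarrow> complex) set" where
  "(\<lambda>_. 0) \<in> nonneg_combinations P"
| "\<alpha> \<in> P \<Longrightarrow> \<gamma> \<in> nonneg_combinations P \<Longrightarrow> (\<lambda>H. \<alpha> H + \<gamma> H) \<in> nonneg_combinations P"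

text \<open>Minimal roots in the sense of Kac, Roan and Wakimoto: an even root is minimal if some
  nonzero real function on the roots, additive whenever a sum of roots is a root, attains its
  minimum there and nowhere else.\<close>

definition minimal_root :: "'g::complex_vector super_lie \<Rightarrow> 'g set \<Rightarrow> ('g \<Rightarrow> complex) \<Rightarrow> bool" where
  "minimal_root g h \<mu> \<longleftrightarrow> \<mu> \<in> even_roots g h \<and> (\<exists>\<phi> :: ('g \<Rightarrow> complex) \<Rightarrow> real.
     (\<forall>\<alpha>\<in>roots g h. \<forall>\<beta>\<in>roots g h. (\<lambda>H. \<alpha> H + \<beta> H) \<in> roots g h \<longrightarrow>
        \<phi> (\<lambda>H. \<alpha> H + \<beta> H) = \<phi> \<alpha> + \<phi> \<beta>) \<and>
     (\<exists>\<alpha>\<in>roots g h. \<phi> \<alpha> \<noteq> 0) \<and>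
     (\<forall>\<eta>\<in>roots g h. \<eta> \<noteq> \<mu> \<longrightarrow> \<phi> \<mu> < \<phi> \<eta>))"

definition highest_even_root :: "'g::complex_vector super_lie \<Rightarrow> 'g set \<Rightarrow> ('g \<Rightarrow> complex) \<Rightarrow> bool" where
  "highest_even_root g h \<theta> \<longleftrightarrow> (\<exists>P. positive_system g h P \<and> \<theta> \<in> even_roots g h \<inter> P \<and>
     (\<forall>\<beta>\<in>even_roots g h \<inter> P. (\<lambda>H. \<beta> H - \<theta> H) \<in> nonneg_combinations P \<longrightarrow> \<beta> = \<theta>) \<and>
     minimal_root g h (\<lambda>H. - \<theta> H))"

text \<open>The form on the dual of \<open>h\<close> is transported from \<open>h\<close> through
  the identification \<open>t \<mapsto> (t|\<cdot>)\<close>.\<close>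

definition dual_vector :: "'g::complex_vector super_lie \<Rightarrow> 'g set \<Rightarrow> ('g \<Rightarrow> complex) \<Rightarrow> 'g" where
  "dual_vector g h \<alpha> = (THE t. t \<in> h \<and> (\<forall>H\<in>h. form g t H = \<alpha> H))"

definition dual_form ::
  "'g::complex_vector super_lie \<Rightarrow> 'g set \<Rightarrow> ('g \<Rightarrow> complex) \<Rightarrow> ('g \<Rightarrow> complex) \<Rightarrow> complex" where
  "dual_form g h \<alpha> \<beta> = form g (dual_vector g h \<alpha>) (dual_vector g h \<beta>)"

section \<open>Casimir element and dual Coxeter number\<close>

definition dual_bases ::
  "'g::complex_vector super_lie \<Rightarrow> 'g set \<Rightarrow> nat \<Rightarrow> (nat \<Rightarrow> 'g) \<Rightarrow> (nat \<Rightarrow> 'g) \<Rightarrow> bool" where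
  "dual_bases g S n a b \<longleftrightarrow> (\<forall>i<n. a i \<in> S \<and> b i \<in> S) \<and> cvs.span (a ` {..<n}) = S \<and>
     (\<forall>i<n. \<forall>j<n. form g (b i) (a j) = (if i = j then 1 else 0))"

text \<open>The value at a bilinear map \<open>F\<close> of the Casimir tensor, i.e. the sum of the tensors of
  \<open>a\<^sub>i\<close> and \<open>b\<^sub>i\<close> over dual bases of \<open>S\<close>, on which the form must be nondegenerate. It does not
  depend on the bases. With \<open>(b\<^sub>i|a\<^sub>j) = \<delta>\<^sub>i\<^sub>j\<close> this is the order of factors that is
  invariant in the super case.\<close>

definition casimir ::
  "'g::complex_vector super_lie \<Rightarrow> 'g set \<Rightarrow> ('g \<Rightarrow> 'g \<Rightarrow> 'a::complex_vector) \<Rightarrow> 'a" where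
  "casimir g S F = (SOME w. \<exists>n a b. dual_bases g S n a b \<and> w = (\<Sum>i<n. F (a i) (b i)))"

text \<open>Half the eigenvalue of the Casimir operator of \<open>S\<close> on \<open>S\<close> itself.\<close>

definition dual_coxeter :: "'g::complex_vector super_lie \<Rightarrow> 'g set \<Rightarrow> complex" where
  "dual_coxeter g S = (THE c. \<forall>v\<in>S. casimir g S (\<lambda>x y. brk g x (brk g y v)) = (2 * c) *\<^sub>C v)"

section \<open>Vertex superalgebras and their weak modules\<close>

text \<open>\<open>vprod V a n b\<close> is the product \<open>a\<^sub>(\<^sub>n\<^sub>) b\<close>, where the field of \<open>a\<close> is the sum of
  \<open>a\<^sub>(\<^sub>n\<^sub>) z\<^sup>-\<^sup>n\<^sup>-\<^sup>1\<close>.\<close>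

record 'v vertex_alg =
  vpar :: "bit \<Rightarrow> 'v set"
  vacuum :: 'v
  vprod :: "'v \<Rightarrow> int \<Rightarrow> 'v \<Rightarrow> 'v"

record ('v, 'w) vmodule =
  mpar :: "bit \<Rightarrow> 'w set"
  mact :: "'v \<Rightarrow> int \<Rightarrow> 'w \<Rightarrow> 'w"

text \<open>The Borcherds identity, i.e. the Jacobi identity in components. By truncation
  all sums have finite support.\<close>

definition borcherds ::
  "'v::complex_vector vertex_alg \<Rightarrow> ('v \<Rightarrow> int \<Rightarrow> 'w \<Rightarrow> 'w::complex_vector) \<Rightarrow> bool" where
  "borcherds V act \<longleftrightarrow> (\<forall>p q. \<forall>a\<in>vpar V p. \<forall>b\<in>vpar V q. \<forall>c m n l.
     Sum_any (\<lambda>j::nat. (of_int m gchoose j) *\<^sub>C act (vprod V a (n + int j) b) (m + l - int j) c) =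
     Sum_any (\<lambda>j::nat. ((-1) ^ j * (of_int n gchoose j)) *\<^sub>C
       (act a (m + n - int j) (act b (l + int j) c)
        - (koszul p q * (-1) powi n) *\<^sub>C act b (n + l - int j) (act a (m + int j) c))))"

definition weak_module ::
  "'v::complex_vector vertex_alg \<Rightarrow> ('v, 'w::complex_vector) vmodule \<Rightarrow> bool" where
  "weak_module V M \<longleftrightarrow> superspace (mpar M) \<and>
     (\<forall>a n. clinear (mact M a n)) \<and> (\<forall>n w. clinear (\<lambda>a. mact M a n w)) \<and>
     (\<forall>p q. \<forall>a\<in>vpar V p. \<forall>w\<in>mpar M q. \<forall>n. mact M a n w \<in> mpar M (p + q)) \<and>
     (\<forall>a w. \<exists>N. \<forall>n\<ge>N. mact M a n w = 0) \<and>
     (\<forall>n w. mact M (vacuum V) n w = (if n = -1 then w else 0)) \<and>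
     borcherds V (mact M)"

text \<open>The axioms other than creation say that \<open>V\<close> is a weak module over itself; the
  translation operator is \<open>a \<mapsto> a\<^sub>(\<^sub>-\<^sub>2\<^sub>)\<close> applied to the vacuum.\<close>

definition vertex_superalgebra :: "'v::complex_vector vertex_alg \<Rightarrow> bool" where
  "vertex_superalgebra V \<longleftrightarrow> vacuum V \<in> vpar V 0 \<and>
     (\<forall>a. vprod V a (-1) (vacuum V) = a \<and> (\<forall>n\<ge>0. vprod V a n (vacuum V) = 0)) \<and>
     weak_module V \<lparr>mpar = vpar V, mact = vprod V\<rparr>"

definition simple_vertex_superalgebra :: "'v::complex_vector vertex_alg \<Rightarrow> bool" where
  "simple_vertex_superalgebra V \<longleftrightarrow> vertex_superalgebra V \<and> vacuum V \<noteq> 0 \<and>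
     (\<forall>I. graded_subspace (vpar V) I \<and>
        (\<forall>a n. \<forall>x\<in>I. vprod V a n x \<in> I \<and> vprod V x n a \<in> I) \<longrightarrow> I = {0} \<or> I = UNIV)"

definition vertex_subalgebra :: "'v::complex_vector vertex_alg \<Rightarrow> 'v set \<Rightarrow> bool" where
  "vertex_subalgebra V W \<longleftrightarrow> cvs.subspace W \<and> vacuum V \<in> W \<and>
     (\<forall>n. \<forall>a\<in>W. \<forall>b\<in>W. vprod V a n b \<in> W)"

definition vertex_embedding ::
  "'u::complex_vector vertex_alg \<Rightarrow> 'v::complex_vector vertex_alg \<Rightarrow> ('u \<Rightarrow> 'v) \<Rightarrow> bool" where
  "vertex_embedding U V f \<longleftrightarrow> clinear f \<and> inj f \<and> (\<forall>p. f ` vpar U p \<subseteq> vpar V p) \<and>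
     f (vacuum U) = vacuum V \<and> (\<forall>a n b. f (vprod U a n b) = vprod V (f a) n (f b))"

section \<open>Affine vertex algebras and Sugawara vectors\<close>

text \<open>\<open>affine_vertex_algebra g S k V \<iota>\<close>: the fields of \<open>\<iota> x\<close> for \<open>x\<close> in the subalgebra \<open>S\<close>
  satisfy the affine relations with cocycle \<open>k (\<cdot>|\<cdot>)\<close> and generate \<open>V\<close>, i.e. \<open>V\<close> with
  \<open>\<iota>\<close> is a quotient of the universal affine vertex algebra.\<close>

definition affine_vertex_algebra :: "'g::complex_vector super_lie \<Rightarrow> 'g set \<Rightarrow> complex \<Rightarrow>
    'v::complex_vector vertex_alg \<Rightarrow> ('g \<Rightarrow> 'v) \<Rightarrow> bool" where
  "affine_vertex_algebra g S k V \<iota> \<longleftrightarrow> vertex_superalgebra V \<and>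
     (\<forall>x\<in>S. \<forall>y\<in>S. \<iota> (x + y) = \<iota> x + \<iota> y) \<and> (\<forall>c. \<forall>x\<in>S. \<iota> (c *\<^sub>C x) = c *\<^sub>C \<iota> x) \<and>
     (\<forall>p. \<forall>x\<in>S \<inter> gpar g p. \<iota> x \<in> vpar V p) \<and>
     (\<forall>x\<in>S. \<forall>y\<in>S. vprod V (\<iota> x) 0 (\<iota> y) = \<iota> (brk g x y) \<and>
        vprod V (\<iota> x) 1 (\<iota> y) = (k * form g x y) *\<^sub>C vacuum V \<and>
        (\<forall>n\<ge>2. vprod V (\<iota> x) n (\<iota> y) = 0)) \<and>
     (\<forall>W. vertex_subalgebra V W \<and> \<iota> ` S \<subseteq> W \<longrightarrow> W = UNIV)"

text \<open>The simple quotient of the universal affine vertex algebra, determined up to isomorphism.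
  For the even part of \<open>g\<close> and \<open>k \<noteq> 0\<close> it is the tensor product of the simple affine vertex
  algebras of the simple ideals and the Heisenberg vertex algebra of the centre.\<close>

definition simple_affine_vertex_algebra :: "'g::complex_vector super_lie \<Rightarrow> 'g set \<Rightarrow> complex \<Rightarrow>
    'v::complex_vector vertex_alg \<Rightarrow> ('g \<Rightarrow> 'v) \<Rightarrow> bool" where
  "simple_affine_vertex_algebra g S k V \<iota> \<longleftrightarrow>
     affine_vertex_algebra g S k V \<iota> \<and> simple_vertex_superalgebra V"

definition quadratic_vector :: "'g::complex_vector super_lie \<Rightarrow> 'g set \<Rightarrow>
    'v::complex_vector vertex_alg \<Rightarrow> ('g \<Rightarrow> 'v) \<Rightarrow> 'v" where
  "quadratic_vector g S V \<iota> = casimir g S (\<lambda>x y. vprod V (\<iota> x) (-1) (\<iota> y))"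

definition sugawara :: "'g::complex_vector super_lie \<Rightarrow> complex \<Rightarrow>
    'v::complex_vector vertex_alg \<Rightarrow> ('g \<Rightarrow> 'v) \<Rightarrow> 'v" where
  "sugawara g k V \<iota> = (1 / (2 * (k + dual_coxeter g UNIV))) *\<^sub>C quadratic_vector g UNIV V \<iota>"

text \<open>For the even part, the sum of the Sugawara vectors of the simple ideals and of the centre.
  Each summand uses the restriction of the form of \<open>g\<close> with level \<open>k\<close> and the number
  \<open>dual_coxeter\<close> relative to that restriction; rescaling the form to the normalized one of the
  ideal, and the level and dual Coxeter number accordingly, gives the same vector.\<close>

definition even_sugawara :: "'g::complex_vector super_lie \<Rightarrow> complex \<Rightarrow>
    'u::complex_vector vertex_alg \<Rightarrow> ('g \<Rightarrow> 'u) \<Rightarrow> 'u" where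
  "even_sugawara g k U \<iota> =
     (\<Sum>S\<in>simple_ideals g (gpar g 0).
        (1 / (2 * (k + dual_coxeter g S))) *\<^sub>C quadratic_vector g S U \<iota>) +
     (1 / (2 * k)) *\<^sub>C quadratic_vector g (lie_center g (gpar g 0)) U \<iota>"

definition even_noncritical :: "'g::complex_vector super_lie \<Rightarrow> complex \<Rightarrow> bool" where
  "even_noncritical g k \<longleftrightarrow> (\<forall>S\<in>simple_ideals g (gpar g 0). k \<noteq> - dual_coxeter g S) \<and>
     (lie_center g (gpar g 0) \<noteq> {0} \<longrightarrow> k \<noteq> 0)"

text \<open>\<open>U\<close> with \<open>\<iota>\<^sub>0\<close> is the simple affine vertex algebra of the even part of \<open>g\<close>, and \<open>f\<close> is its
  embedding in \<open>V\<close> extending the inclusion of the even part in \<open>g\<close>. The Sugawara vector of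
  \<open>U\<close> exists only at noncritical levels.\<close>

definition conformal_even_embedding :: "'g::complex_vector super_lie \<Rightarrow> complex \<Rightarrow>
    'u::complex_vector vertex_alg \<Rightarrow> ('g \<Rightarrow> 'u) \<Rightarrow>
    'v::complex_vector vertex_alg \<Rightarrow> ('g \<Rightarrow> 'v) \<Rightarrow> ('u \<Rightarrow> 'v) \<Rightarrow> bool" where
  "conformal_even_embedding g k U \<iota>\<^sub>0 V \<iota> f \<longleftrightarrow>
     simple_affine_vertex_algebra g (gpar g 0) k U \<iota>\<^sub>0 \<and> vertex_embedding U V f \<and>
     (\<forall>x\<in>gpar g 0. f (\<iota>\<^sub>0 x) = \<iota> x) \<and>
     even_noncritical g k \<and> f (even_sugawara g k U \<iota>\<^sub>0) = sugawara g k V \<iota>"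

section \<open>Semisimple modules\<close>

definition submodule :: "('v \<Rightarrow> int \<Rightarrow> 'w \<Rightarrow> 'w::complex_vector) \<Rightarrow> 'w set \<Rightarrow> bool" where
  "submodule act N \<longleftrightarrow> cvs.subspace N \<and> (\<forall>a n. \<forall>w\<in>N. act a n w \<in> N)"

definition simple_submodule :: "('v \<Rightarrow> int \<Rightarrow> 'w \<Rightarrow> 'w::complex_vector) \<Rightarrow> 'w set \<Rightarrow> bool" where
  "simple_submodule act N \<longleftrightarrow> submodule act N \<and> N \<noteq> {0} \<and>
     (\<forall>N'\<subseteq>N. submodule act N' \<longrightarrow> N' = {0} \<or> N' = N)"

definition semisimple_module :: "('v \<Rightarrow> int \<Rightarrow> 'w \<Rightarrow> 'w::complex_vector) \<Rightarrow> bool" where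
  "semisimple_module act \<longleftrightarrow> (\<exists>\<S>. (\<forall>N\<in>\<S>. simple_submodule act N) \<and>
     cvs.span (\<Union>\<S>) = UNIV \<and> (\<forall>N\<in>\<S>. N \<inter> cvs.span (\<Union>(\<S> - {N})) = {0}))"

text \<open>\<open>M\<close> viewed as a \<open>U\<close>-module through \<open>f : U \<rightarrow> V\<close>.\<close>

definition semisimple_over :: "('u \<Rightarrow> 'v) \<Rightarrow> ('v, 'w::complex_vector) vmodule \<Rightarrow> bool" where
  "semisimple_over f M \<longleftrightarrow> semisimple_module (\<lambda>u. mact M (f u))"

section \<open>The categories of modules\<close>

text \<open>Since the field of the Sugawara vector is the sum of \<open>L(n) z\<^sup>-\<^sup>n\<^sup>-\<^sup>2\<close>, the operator
  \<open>L(0)\<close> is its mode of index 1.\<close>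

definition L0 :: "'g::complex_vector super_lie \<Rightarrow> complex \<Rightarrow> 'v::complex_vector vertex_alg \<Rightarrow>
    ('g \<Rightarrow> 'v) \<Rightarrow> ('v, 'w::complex_vector) vmodule \<Rightarrow> 'w \<Rightarrow> 'w" where
  "L0 g k V \<iota> M = mact M (sugawara g k V \<iota>) 1"

text \<open>The action on \<open>M\<close> of the element \<open>H + a K + b d\<close> of the affine Lie superalgebra:
  \<open>K\<close> acts by \<open>k\<close> and \<open>d\<close> by \<open>-L(0)\<close>.\<close>

definition affine_cartan_act :: "'g::complex_vector super_lie \<Rightarrow> complex \<Rightarrow>
    'v::complex_vector vertex_alg \<Rightarrow> ('g \<Rightarrow> 'v) \<Rightarrow> ('v, 'w::complex_vector) vmodule \<Rightarrow>
    'g \<times> complex \<times> complex \<Rightarrow> 'w \<Rightarrow> 'w" where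
  "affine_cartan_act g k V \<iota> M = (\<lambda>(H, a, b) w.
     mact M (\<iota> H) 0 w + (a * k) *\<^sub>C w + b *\<^sub>C (- L0 g k V \<iota> M w))"

definition locally_finite :: "('g \<Rightarrow> 'v) \<Rightarrow> ('v, 'w::complex_vector) vmodule \<Rightarrow> bool" where
  "locally_finite \<iota> M \<longleftrightarrow> (\<forall>w. \<exists>E. finite E \<and> w \<in> cvs.span E \<and>
     (\<forall>x. \<forall>u\<in>cvs.span E. mact M (\<iota> x) 0 u \<in> cvs.span E))"

definition generalized_eigenspace :: "('w \<Rightarrow> 'w::complex_vector) \<Rightarrow> complex \<Rightarrow> 'w set" where
  "generalized_eigenspace T \<mu> = {w. \<exists>N. ((\<lambda>u. T u - \<mu> *\<^sub>C u) ^^ N) w = 0}"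

text \<open>A family of operators acts semisimply if the space is spanned by common eigenvectors,
  i.e. is the direct sum of the weight spaces.\<close>

definition acts_semisimply :: "('w \<Rightarrow> 'w::complex_vector) set \<Rightarrow> bool" where
  "acts_semisimply \<T> \<longleftrightarrow> cvs.span {w. \<forall>T\<in>\<T>. \<exists>c. T w = c *\<^sub>C w} = UNIV"

definition KL :: "'g::complex_vector super_lie \<Rightarrow> complex \<Rightarrow> 'v::complex_vector vertex_alg \<Rightarrow>
    ('g \<Rightarrow> 'v) \<Rightarrow> ('v, 'w::complex_vector) vmodule set" where
  "KL g k V \<iota> = {M. weak_module V M \<and> locally_finite \<iota> M \<and>
     cvs.span (\<Union>\<mu>. generalized_eigenspace (L0 g k V \<iota> M) \<mu>) = UNIV \<and>
     (\<exists>r. \<forall>\<mu>. generalized_eigenspace (L0 g k V \<iota> M) \<mu> \<noteq> {0} \<longrightarrow> r \<le> Re \<mu>)}"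

definition KL_fin :: "'g::complex_vector super_lie \<Rightarrow> 'g set \<Rightarrow> complex \<Rightarrow>
    'v::complex_vector vertex_alg \<Rightarrow> ('g \<Rightarrow> 'v) \<Rightarrow> ('v, 'w::complex_vector) vmodule set" where
  "KL_fin g h k V \<iota> = {M\<in>KL g k V \<iota>.
     acts_semisimply (affine_cartan_act g k V \<iota> M ` (h \<times> UNIV \<times> UNIV))}"

definition KL_ss :: "'g::complex_vector super_lie \<Rightarrow> complex \<Rightarrow> 'v::complex_vector vertex_alg \<Rightarrow>
    ('g \<Rightarrow> 'v) \<Rightarrow> ('v, 'w::complex_vector) vmodule set" where
  "KL_ss g k V \<iota> = {M\<in>KL g k V \<iota>. acts_semisimply {L0 g k V \<iota> M}}"

end

theory Submission
  imports Defs "HOL-Computational_Algebra.Fundamental_Theorem_Algebra"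
begin

text \<open>
  Write \<open>L\<close> for the operator \<open>L0\<close> on a module \<open>M\<close> and \<open>x\<^sub>n\<close> for the modes of the current of \<open>x\<close>. As
  \<open>KL_fin\<close> asks for common eigenvectors of \<open>h\<close> and \<open>L\<close>, what has to be shown is that such
  eigenvectors span \<open>M\<close>: in the first part when \<open>L\<close> is diagonalisable and the even part of \<open>g\<close> is
  semisimple, in the second when \<open>M\<close> is a semisimple module over the vertex algebra \<open>U\<close> of the even
  part.

  Both parts rest on two properties of the Cartan subalgebra \<open>h\<close>, which is only given as a nilpotent
  self-normalising subalgebra of the even part: it is abelian and acts semisimply on the even part
  (\<open>h_abelian\<close>, \<open>h_acts_semisimply\<close>), and it is spanned by coroots if the even part is semisimple
  (\<open>coroots_span\<close>). They follow from the trace form of the adjoint representation of the even part.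
  The radical of this form is the centre (\<open>kil_rad_center\<close>), by the rationality of weight strings
  (\<open>weight_string\<close>) and the Engel--Jacobson theorem (\<open>engel_jacobson\<close>). Comparing \<open>ad H\<close> with its
  semisimple part under the trace shows that the difference is central, and the invariant form of
  \<open>g\<close> shows that the centre meets the derived algebra in \<open>0\<close> (\<open>center_inter_derived\<close>).

  In the first part a coroot lies in a copy of sl2 that acts on finite-dimensional subspaces filling
  \<open>M\<close>, so it acts diagonalisably (\<open>sl2_rep.diagonalizable\<close>). The coroots commute with each other as
  \<open>h\<close> is abelian, and with \<open>L\<close> as the Sugawara vector is invariant under the even part; finitely
  many commuting diagonalisable operators have a spanning set of common eigenvectors.

  In the second part the Sugawara vector of \<open>g\<close> lies in \<open>U\<close>, so \<open>L\<close> preserves every \<open>U\<close>-submodule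
  \<open>N\<close>. The Sugawara construction gives \<open>[L, x\<^sub>n] = - n x\<^sub>n\<close> for even \<open>x\<close> (\<open>L_current\<close>), and the even
  root vectors shift \<open>h\<close>-weights, so the span of the common eigenvectors in \<open>N\<close> is stable under all
  even currents, which generate \<open>U\<close>. This span is nonzero by local finiteness and the generalised
  eigenspace decomposition of \<open>L\<close>; if \<open>N\<close> is simple it is therefore \<open>N\<close>, and the simple submodules
  span \<open>M\<close>.
\<close>

section \<open>Finite-dimensional subspaces and linear operators\<close>

interpretation cvp: vector_space_pair
  "scaleC :: complex \<Rightarrow> 'a \<Rightarrow> 'a::complex_vector" "scaleC :: complex \<Rightarrow> 'b \<Rightarrow> 'b::complex_vector"
  by unfold_locales

lemma clinearI:
  assumes "\<And>x y. T (x + y) = T x + T y" and "\<And>c x. T (c *\<^sub>C x) = c *\<^sub>C T x"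
  shows "clinear T"
  using assms by (auto simp: Vector_Spaces.linear_iff cvs.vector_space_axioms)

lemmas clinear_simps = cvp.linear_add cvp.linear_diff cvp.linear_scale cvp.linear_0 cvp.linear_neg
  cvp.linear_sum

lemma clinear_funpow: "clinear T \<Longrightarrow> clinear (T ^^ n)" for T :: "'a \<Rightarrow> 'a::complex_vector"
proof (induction n)
  case 0
  show ?case by (rule clinearI) simp_all
next
  case (Suc n)
  then show ?case by (intro clinearI) (simp_all add: clinear_simps)
qed

lemma clinear_shift: "clinear T \<Longrightarrow> clinear (\<lambda>x. T x - c *\<^sub>C x)"
  by (intro clinearI) (simp_all add: clinear_simps cvs.scale_right_distrib cvs.scale_right_diff_distrib
      cvs.scale_left_commute)

lemma clinear_image_subspace: "clinear T \<Longrightarrow> cvs.subspace W \<Longrightarrow> cvs.subspace (T ` W)"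
  by (rule cvp.linear_subspace_image)

lemma clinear_kernel_subspace:
  assumes "clinear T" "cvs.subspace W" shows "cvs.subspace {x\<in>W. T x = 0}"
  using assms by (auto simp: cvs.subspace_def clinear_simps)

lemma clinear_span_into:
  assumes "clinear T" "\<And>x. x \<in> X \<Longrightarrow> T x \<in> W" "cvs.subspace W" "v \<in> cvs.span X"
  shows "T v \<in> W"
  using assms(4,2)
  by (induction rule: cvs.span_induct_alt)
     (simp_all add: clinear_simps[OF assms(1)] assms(3) cvs.subspace_0 cvs.subspace_add cvs.subspace_scale)

definition fdim :: "'a::complex_vector set \<Rightarrow> bool" where
  "fdim W \<longleftrightarrow> (\<exists>E. finite E \<and> W \<subseteq> cvs.span E)"

lemma fdim_subset: "fdim W \<Longrightarrow> U \<subseteq> W \<Longrightarrow> fdim U"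
  unfolding fdim_def by blast

lemma fdim_independent_finite:
  assumes "fdim W" "B \<subseteq> W" "cvs.independent B" shows "finite B"
  using assms cvs.independent_span_bound unfolding fdim_def by (metis order_trans)

lemma fdim_basis:
  assumes "fdim W" "cvs.subspace W"
  obtains B where "finite B" "cvs.independent B" "cvs.span B = W" "card B = cvs.dim W"
proof -
  obtain B where B: "B \<subseteq> W" "cvs.independent B" "W \<subseteq> cvs.span B" "card B = cvs.dim W"
    using cvs.basis_exists by metis
  have "cvs.span B = W" using B assms(2) by (simp add: cvs.span_subspace)
  then show ?thesis using that B fdim_independent_finite[OF assms(1)] by blast
qed

lemma independent_card_le_dim:
  assumes "fdim W" "B \<subseteq> W" "cvs.independent B" "cvs.subspace W" shows "card B \<le> cvs.dim W"
proof -
  obtain C where C: "finite C" "cvs.independent C" "cvs.span C = W" "card C = cvs.dim W"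
    by (rule fdim_basis[OF assms(1,4)])
  then show ?thesis using cvs.independent_span_bound[of C B] assms by auto
qed

lemma dim_strict_mono:
  assumes "fdim W" "cvs.subspace U" "cvs.subspace W" "U \<subset> W" shows "cvs.dim U < cvs.dim W"
proof -
  obtain B where B: "finite B" "cvs.independent B" "cvs.span B = U" "card B = cvs.dim U"
    using fdim_basis[OF fdim_subset[OF assms(1)] assms(2)] assms(4) by (metis psubset_imp_subset)
  obtain x where x: "x \<in> W" "x \<notin> U" using assms(4) by blast
  have ind: "cvs.independent (insert x B)" using B x by (simp add: cvs.independent_insertI)
  have "insert x B \<subseteq> W" using B(3) x assms(4) cvs.span_superset[of B] by blast
  then have "card (insert x B) \<le> cvs.dim W" using independent_card_le_dim[OF assms(1) _ ind assms(3)] by simp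
  moreover have "x \<notin> B" using x B(3) cvs.span_superset by blast
  ultimately show ?thesis using B by simp
qed

lemma dim_mono_fdim:
  assumes "fdim W" "cvs.subspace U" "cvs.subspace W" "U \<subseteq> W" shows "cvs.dim U \<le> cvs.dim W"
  using dim_strict_mono[OF assms(1-3)] assms(4) by (cases "U = W") (simp, metis less_imp_le psubsetI)

lemma injective_imp_surjective_on:
  assumes T: "clinear T" and W: "fdim W" "cvs.subspace W" and sub: "T ` W \<subseteq> W"
    and inj: "\<And>x. x \<in> W \<Longrightarrow> T x = 0 \<Longrightarrow> x = 0"
  shows "T ` W = W"
proof (rule ccontr)
  assume ne: "T ` W \<noteq> W"
  obtain B where B: "finite B" "cvs.independent B" "cvs.span B = W" "card B = cvs.dim W"
    by (rule fdim_basis[OF W])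
  have injW: "inj_on T (cvs.span B)"
    using inj by (intro inj_onI) (metis B(3) W(2) clinear_simps(2)[OF T] cvs.subspace_diff eq_iff_diff_eq_0)
  have ind: "cvs.independent (T ` B)" by (rule cvp.linear_independent_injective_image[OF T B(2) injW])
  have "inj_on T B" using injW cvs.span_superset inj_on_subset by blast
  then have "cvs.dim W = card (T ` B)" using B(4) card_image by metis
  also have "\<dots> \<le> cvs.dim (T ` W)"
    using ind B(3) cvs.span_superset[of B]
    by (intro independent_card_le_dim clinear_image_subspace T W fdim_subset[OF W(1)] sub) auto
  also have "\<dots> < cvs.dim W"
    using ne sub by (intro dim_strict_mono clinear_image_subspace T W) auto
  finally show False by simp
qed

lemma surjective_imp_injective_on:
  assumes T: "clinear T" and W: "fdim W" "cvs.subspace W" and surj: "T ` W = W"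
    and x: "x \<in> W" "T x = 0"
  shows "x = 0"
proof (rule ccontr)
  assume "x \<noteq> 0"
  then have "cvs.independent {x}" by simp
  then obtain B where B: "{x} \<subseteq> B" "B \<subseteq> W" "cvs.independent B" "W \<subseteq> cvs.span B"
    using cvs.maximal_independent_subset_extend[of "{x}" W] x by auto
  have fin: "finite B" by (rule fdim_independent_finite[OF W(1) B(2,3)])
  have spB: "cvs.span B = W" using B W by (simp add: cvs.span_subspace)
  have "W = cvs.span (T ` B)" using surj spB cvp.linear_span_image[OF T, of B] by simp
  also have "T ` B = insert 0 (T ` (B - {x}))" using B(1) x by auto
  finally have "W = cvs.span (T ` (B - {x}))" by simp
  then have "cvs.dim W \<le> card (T ` (B - {x}))" using fin by (intro cvs.dim_le_card) auto
  also have "\<dots> \<le> card (B - {x})" using fin by (intro card_image_le) auto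
  also have "\<dots> < card B" using fin B(1) by (intro psubset_card_mono) auto
  also have "card B = cvs.dim W" using B cvs.basis_card_eq_dim by blast
  finally show False by simp
qed

lemma funpow_image_stable: "T ` W \<subseteq> W \<Longrightarrow> (T ^^ n) ` W \<subseteq> W"
  by (induction n) auto

lemma funpow_stable: "(\<And>x. x \<in> W \<Longrightarrow> T x \<in> W) \<Longrightarrow> x \<in> W \<Longrightarrow> (T ^^ n) x \<in> W"
  by (induction n) auto

lemma funpow_image_Suc: "(T ^^ Suc n) ` W = T ` ((T ^^ n) ` W)"
  by (auto simp: image_image)

lemma funpow_add_apply: "(T ^^ (m + n)) x = (T ^^ m) ((T ^^ n) x)"
  by (simp add: funpow_add)

text \<open>The images of the powers of \<open>S\<close> decrease, so they become constant by dimension; on the stable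
  image \<open>S\<close> is surjective, hence injective.\<close>

lemma fitting:
  assumes S: "clinear S" and W: "fdim W" "cvs.subspace W" and sub: "S ` W \<subseteq> W"
  obtains n where "S ` ((S ^^ n) ` W) = (S ^^ n) ` W"
    "\<And>v. v \<in> (S ^^ n) ` W \<Longrightarrow> S v = 0 \<Longrightarrow> v = 0"
    "\<And>w. w \<in> W \<Longrightarrow> \<exists>u\<in>W. \<exists>v\<in>(S ^^ n) ` W. w = u + v \<and> (S ^^ n) u = 0"
proof -
  define R where "R n = (S ^^ n) ` W" for n
  have Rsub: "cvs.subspace (R n)" for n
    unfolding R_def by (intro clinear_image_subspace clinear_funpow S W)
  have RW: "R n \<subseteq> W" for n unfolding R_def by (rule funpow_image_stable[OF sub])
  have RS: "R (Suc n) = S ` R n" for n unfolding R_def by (rule funpow_image_Suc)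
  have dec: "R (Suc n) \<subseteq> R n" for n
    unfolding R_def funpow_Suc_right using sub by auto
  have "\<exists>n. R (Suc n) = R n"
  proof (rule ccontr)
    assume "\<nexists>n. R (Suc n) = R n"
    then have "R (Suc n) \<subset> R n" for n using dec by blast
    then have lt: "cvs.dim (R (Suc n)) < cvs.dim (R n)" for n
      by (intro dim_strict_mono Rsub fdim_subset[OF W(1) RW])
    have "cvs.dim (R n) + n \<le> cvs.dim (R 0)" for n
    proof (induction n)
      case (Suc n)
      then show ?case using lt[of n] by simp
    qed simp
    from this[of "Suc (cvs.dim (R 0))"] show False by simp
  qed
  then obtain n where n: "R (Suc n) = R n" by blast
  have surj: "S ` R n = R n" using n RS by simp
  have surjm: "(S ^^ m) ` R n = R n" for m
  proof (induction m)
    case (Suc m)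
    show ?case unfolding funpow_image_Suc Suc by (rule surj)
  qed simp
  show ?thesis
  proof (rule that[of n])
    show "S ` ((S ^^ n) ` W) = (S ^^ n) ` W" using surj by (simp add: R_def)
    show "v = 0" if "v \<in> (S ^^ n) ` W" "S v = 0" for v
      using surjective_imp_injective_on[OF S fdim_subset[OF W(1) RW] Rsub surj] that by (simp add: R_def)
    show "\<exists>u\<in>W. \<exists>v\<in>(S ^^ n) ` W. w = u + v \<and> (S ^^ n) u = 0" if "w \<in> W" for w
    proof -
      have "(S ^^ n) w \<in> R n" using that by (auto simp: R_def)
      then obtain r where r: "r \<in> R n" "(S ^^ n) w = (S ^^ n) r" using surjm[of n] by auto
      have "(S ^^ n) (w - r) = 0" using r by (simp add: clinear_simps[OF clinear_funpow[OF S]])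
      moreover have "w - r \<in> W" using that r RW W(2) cvs.subspace_diff by blast
      moreover have "w = (w - r) + r" by simp
      ultimately show ?thesis using r unfolding R_def by blast
    qed
  qed
qed

text \<open>Horner evaluation of a polynomial at the operator \<open>T\<close>, applied to the vector \<open>v\<close>.\<close>

definition poly_apply :: "('a \<Rightarrow> 'a) \<Rightarrow> 'a \<Rightarrow> complex poly \<Rightarrow> 'a::complex_vector" where
  "poly_apply T v p = fold_coeffs (\<lambda>a w. a *\<^sub>C v + T w) p 0"

lemma poly_apply_0 [simp]: "poly_apply T v 0 = 0"
  by (simp add: poly_apply_def)

lemma poly_apply_pCons: "clinear T \<Longrightarrow> poly_apply T v (pCons a p) = a *\<^sub>C v + T (poly_apply T v p)"
  by (cases "p = 0 \<and> a = 0") (auto simp: poly_apply_def clinear_simps)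

lemma poly_apply_add: "clinear T \<Longrightarrow> poly_apply T v (p + q) = poly_apply T v p + poly_apply T v q"
  by (induction p q rule: poly_induct2)
     (simp_all add: poly_apply_pCons clinear_simps cvs.scale_left_distrib)

lemma poly_apply_smult: "clinear T \<Longrightarrow> poly_apply T v (smult c p) = c *\<^sub>C poly_apply T v p"
  by (induction p) (simp_all add: poly_apply_pCons clinear_simps cvs.scale_right_distrib)

lemma poly_apply_linear_factor:
  assumes "clinear T"
  shows "poly_apply T v ([:- c, 1:] * q) = T (poly_apply T v q) - c *\<^sub>C poly_apply T v q"
proof -
  have eq: "[:- c, 1:] * q = smult (- c) q + pCons 0 q" by simp
  show ?thesis unfolding eq poly_apply_add[OF assms] poly_apply_smult[OF assms]
    by (simp add: poly_apply_pCons assms)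
qed

lemma poly_apply_mem:
  assumes "clinear T" "cvs.subspace W" "\<And>x. x \<in> W \<Longrightarrow> T x \<in> W" "v \<in> W"
  shows "poly_apply T v p \<in> W"
  by (induction p) (simp_all add: poly_apply_pCons assms cvs.subspace_0 cvs.subspace_add cvs.subspace_scale)

lemma poly_apply_span:
  assumes "clinear T" "x \<in> cvs.span ((\<lambda>i. (T ^^ i) v) ` {..<m})"
  shows "\<exists>p. degree p < Suc m \<and> coeff p m = 0 \<and> x = poly_apply T v p"
proof -
  have pw: "poly_apply T v (monom 1 i) = (T ^^ i) v" for i
    by (induction i) (simp_all add: poly_apply_pCons assms(1) monom_Suc clinear_simps[OF assms(1)] monom_0)
  show ?thesis using assms(2)
  proof (induction rule: cvs.span_induct_alt)
    case base
    show ?case by (rule exI[of _ 0]) simp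
  next
    case (step c x y)
    then obtain i p where ip: "i < m" "x = (T ^^ i) v" "degree p < Suc m" "coeff p m = 0" "y = poly_apply T v p"
      by auto
    let ?q = "smult c (monom 1 i) + p"
    have "degree ?q < Suc m" using ip degree_monom_le[of "1::complex" i]
      by (meson degree_add_less degree_smult_le le_less_trans less_SucI)
    moreover have "coeff ?q m = 0" using ip by simp
    moreover have "c *\<^sub>C x + y = poly_apply T v ?q"
      using ip by (simp add: poly_apply_add poly_apply_smult assms(1) pw)
    ultimately show ?case by blast
  qed
qed

lemma annihilating_poly:
  assumes T: "clinear T" and W: "fdim W" "cvs.subspace W" "\<And>x. x \<in> W \<Longrightarrow> T x \<in> W" and v: "v \<in> W"
  obtains p where "p \<noteq> 0" "poly_apply T v p = 0"
proof -
  have "\<exists>m. (T ^^ m) v \<in> cvs.span ((\<lambda>i. (T ^^ i) v) ` {..<m})"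
  proof (rule ccontr)
    assume no: "\<nexists>m. (T ^^ m) v \<in> cvs.span ((\<lambda>i. (T ^^ i) v) ` {..<m})"
    have "cvs.independent ((\<lambda>i. (T ^^ i) v) ` {..<m}) \<and> card ((\<lambda>i. (T ^^ i) v) ` {..<m}) = m" for m
    proof (induction m)
      case (Suc m)
      have nspan: "(T ^^ m) v \<notin> cvs.span ((\<lambda>i. (T ^^ i) v) ` {..<m})" using no by simp
      then have "(T ^^ m) v \<notin> (\<lambda>i. (T ^^ i) v) ` {..<m}" by (metis cvs.span_base)
      then show ?case using Suc cvs.independent_insertI[OF nspan] by (simp add: lessThan_Suc)
    qed (simp add: cvs.independent_empty)
    moreover have "(\<lambda>i. (T ^^ i) v) ` {..<m} \<subseteq> W" for m
    proof (rule image_subsetI)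
      show "(T ^^ i) v \<in> W" for i by (rule funpow_stable[OF W(3) v])
    qed
    ultimately have "m \<le> cvs.dim W" for m
      using independent_card_le_dim[OF W(1) _ _ W(2), of "(\<lambda>i. (T ^^ i) v) ` {..<m}"] by simp
    from this[of "Suc (cvs.dim W)"] show False by simp
  qed
  then obtain m where m: "(T ^^ m) v \<in> cvs.span ((\<lambda>i. (T ^^ i) v) ` {..<m})" by blast
  obtain q where q: "coeff q m = 0" "(T ^^ m) v = poly_apply T v q" using poly_apply_span[OF T m] by blast
  have pw: "poly_apply T v (monom 1 i) = (T ^^ i) v" for i
    by (induction i) (simp_all add: poly_apply_pCons T monom_Suc clinear_simps[OF T] monom_0)
  let ?p = "monom 1 m + smult (-1) q"
  have "poly_apply T v ?p = 0" using q pw[of m] by (simp only: poly_apply_add[OF T] poly_apply_smult[OF T]) simp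
  moreover have "coeff ?p m \<noteq> 0" using q by simp
  then have "?p \<noteq> 0" by (metis coeff_0)
  ultimately show ?thesis using that by blast
qed

text \<open>A nonzero polynomial of least degree that kills \<open>v\<close> has a root; dividing by the corresponding
  linear factor gives the eigenvector.\<close>

lemma eigenvector_exists:
  assumes T: "clinear T" and W: "fdim W" "cvs.subspace W" "\<And>x. x \<in> W \<Longrightarrow> T x \<in> W" and ne: "W \<noteq> {0}"
  obtains c v where "v \<in> W" "v \<noteq> 0" "T v = c *\<^sub>C v"
proof -
  obtain w where w: "w \<in> W" "w \<noteq> 0" using ne W(2) cvs.subspace_0 by blast
  define P where "P p \<longleftrightarrow> p \<noteq> 0 \<and> poly_apply T w p = 0" for p
  have "\<exists>p. P p" using annihilating_poly[OF T W w(1)] unfolding P_def by metis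
  then obtain p where p: "P p" "\<And>q. P q \<Longrightarrow> degree p \<le> degree q"
    using ex_has_least_nat[of P _ degree] by metis
  have "degree p \<noteq> 0"
  proof
    assume "degree p = 0"
    then obtain a where "p = [:a:]" by (rule degree_eq_zeroE)
    then show False using p(1) w by (simp add: P_def poly_apply_pCons T clinear_simps(4)[OF T])
  qed
  then have "\<not> constant (poly p)" by (simp add: constant_degree)
  then obtain c where "poly p c = 0" using fundamental_theorem_of_algebra by blast
  then obtain q where q: "p = [:- c, 1:] * q" using poly_eq_0_iff_dvd by (metis dvdE)
  have q0: "q \<noteq> 0" using q p(1) by (auto simp: P_def)
  have "degree p = degree [:- c, 1:] + degree q" unfolding q by (rule degree_mult_eq) (use q0 in auto)
  then have "degree q < degree p" by simp
  then have "poly_apply T w q \<noteq> 0" using p(2)[of q] q0 by (auto simp: P_def)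
  moreover have "T (poly_apply T w q) = c *\<^sub>C poly_apply T w q"
    using p(1) poly_apply_linear_factor[OF T] by (simp add: P_def q)
  moreover have "poly_apply T w q \<in> W" by (rule poly_apply_mem[OF T W(2,3) w(1)])
  ultimately show ?thesis using that by blast
qed

section \<open>Simultaneous eigenvectors\<close>

lemma span_eigenvectors_decompose:
  assumes T: "clinear T" and x: "x \<in> cvs.span {v. \<exists>c. T v = c *\<^sub>C v}"
  obtains C v where "finite C" "\<And>c. T (v c) = c *\<^sub>C v c" "x = (\<Sum>c\<in>C. v c)"
proof -
  have "\<exists>C v. finite C \<and> (\<forall>c. T (v c) = c *\<^sub>C v c) \<and> (\<forall>c. c \<notin> C \<longrightarrow> v c = 0) \<and> x = (\<Sum>c\<in>C. v c)"
    using x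
  proof (induction rule: cvs.span_induct_alt)
    case base
    show ?case by (rule exI[of _ "{}"], rule exI[of _ "\<lambda>_. 0"]) (simp add: clinear_simps[OF T])
  next
    case (step a u y)
    then obtain c0 C v where u: "T u = c0 *\<^sub>C u" and C: "finite C" "\<And>c. T (v c) = c *\<^sub>C v c"
      "\<And>c. c \<notin> C \<Longrightarrow> v c = 0" "y = (\<Sum>c\<in>C. v c)" by blast
    let ?v = "\<lambda>c. v c + (if c = c0 then a *\<^sub>C u else 0)"
    have "(\<Sum>c\<in>insert c0 C. ?v c) = (\<Sum>c\<in>insert c0 C. v c) + a *\<^sub>C u"
      using C(1) by (simp add: sum.distrib sum.delta)
    also have "(\<Sum>c\<in>insert c0 C. v c) = y"
      unfolding C(4) by (rule sum.mono_neutral_right) (use C in auto)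
    finally have "a *\<^sub>C u + y = (\<Sum>c\<in>insert c0 C. ?v c)" by (simp add: add.commute)
    moreover have "\<forall>c. T (?v c) = c *\<^sub>C ?v c"
      by (simp add: clinear_simps[OF T] C u cvs.scale_right_distrib mult.commute)
    ultimately show ?case using C(1,3)
      by (intro exI[of _ "insert c0 C"] exI[of _ ?v]) auto
  qed
  then show ?thesis using that by blast
qed

text \<open>Applying \<open>T - a\<close> removes the component for the eigenvalue \<open>a\<close> and rescales the others, which
  gives an induction on the number of components.\<close>

lemma eigen_components_in_stable:
  assumes T: "clinear T" and W: "cvs.subspace W" "\<And>x. x \<in> W \<Longrightarrow> T x \<in> W"
    and "finite C" and "\<And>c. c \<in> C \<Longrightarrow> T (v c) = c *\<^sub>C v c" and "(\<Sum>c\<in>C. v c) \<in> W"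
  shows "\<forall>c\<in>C. v c \<in> W"
  using assms(4-)
proof (induction C arbitrary: v rule: finite_induct)
  case (insert a C)
  let ?s = "\<Sum>c\<in>insert a C. v c"
  have "T ?s - a *\<^sub>C ?s = (\<Sum>c\<in>insert a C. T (v c) - a *\<^sub>C v c)"
    by (simp only: clinear_simps(6)[OF T] cvs.scale_sum_right sum_subtractf)
  also have "\<dots> = (\<Sum>c\<in>insert a C. (c - a) *\<^sub>C v c)"
    by (rule sum.cong) (simp_all add: insert.prems(1) cvs.scale_left_diff_distrib)
  also have "\<dots> = (\<Sum>c\<in>C. (c - a) *\<^sub>C v c)" using insert.hyps by simp
  finally have eq: "(\<Sum>c\<in>C. (c - a) *\<^sub>C v c) = T ?s - a *\<^sub>C ?s" by simp
  have "(\<Sum>c\<in>C. (c - a) *\<^sub>C v c) \<in> W"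
    unfolding eq using insert.prems(2) W by (meson cvs.subspace_diff cvs.subspace_scale)
  then have "\<forall>c\<in>C. (c - a) *\<^sub>C v c \<in> W"
    by (rule insert.IH[rotated]) (simp add: clinear_simps[OF T] insert.prems(1) mult.commute)
  then have "\<forall>c\<in>C. inverse (c - a) *\<^sub>C ((c - a) *\<^sub>C v c) \<in> W"
    using W(1) cvs.subspace_scale by blast
  moreover have "inverse (c - a) *\<^sub>C ((c - a) *\<^sub>C v c) = v c" if "c \<in> C" for c
  proof -
    have "c - a \<noteq> 0" using that insert.hyps by auto
    then show ?thesis by (simp add: scaleC_one)
  qed
  ultimately have C: "\<forall>c\<in>C. v c \<in> W" by simp
  then have "?s - (\<Sum>c\<in>C. v c) \<in> W"
    by (intro cvs.subspace_diff[OF W(1) insert.prems(2)] cvs.subspace_sum[OF W(1)]) auto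
  then show ?case using C insert.hyps by simp
qed simp

lemma diagonalizable_on_stable:
  assumes T: "clinear T" and W: "cvs.subspace W" "\<And>x. x \<in> W \<Longrightarrow> T x \<in> W"
    and w: "w \<in> W" "w \<in> cvs.span {v. \<exists>c. T v = c *\<^sub>C v}"
  shows "w \<in> cvs.span {v \<in> W. \<exists>c. T v = c *\<^sub>C v}"
proof -
  obtain C v where C: "finite C" "\<And>c. T (v c) = c *\<^sub>C v c" "w = (\<Sum>c\<in>C. v c)"
    by (rule span_eigenvectors_decompose[OF T w(2)]) blast
  have "\<forall>c\<in>C. v c \<in> W" by (rule eigen_components_in_stable[OF T W C(1)]) (use C w in auto)
  then show ?thesis unfolding C(3) using C(2) by (intro cvs.span_sum cvs.span_base) blast
qed

lemma commuting_diagonalizable: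
  assumes "finite \<T>" and "\<And>T. T \<in> \<T> \<Longrightarrow> clinear T"
    and "\<And>S T v. S \<in> \<T> \<Longrightarrow> T \<in> \<T> \<Longrightarrow> S (T v) = T (S v)"
    and "\<And>T. T \<in> \<T> \<Longrightarrow> cvs.span {v. \<exists>c. T v = c *\<^sub>C v} = UNIV"
  shows "cvs.span {v. \<forall>T\<in>\<T>. \<exists>c. T v = c *\<^sub>C v} = (UNIV :: 'w::complex_vector set)"
  using assms
proof (induction \<T> rule: finite_induct)
  case (insert T \<T>)
  let ?E = "{v. \<forall>S\<in>\<T>. \<exists>c. S v = c *\<^sub>C v}" and ?F = "{v. \<forall>S\<in>insert T \<T>. \<exists>c. S v = c *\<^sub>C v}"
  have T: "clinear T" using insert.prems(1) by blast
  have "cvs.span ?E = UNIV" by (rule insert.IH) (use insert.prems in auto)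
  moreover have "?E \<subseteq> cvs.span ?F"
  proof
    fix v assume "v \<in> ?E"
    then obtain \<chi> where \<chi>: "\<And>S. S \<in> \<T> \<Longrightarrow> S v = \<chi> S *\<^sub>C v" by simp metis
    define W where "W = {w. \<forall>S\<in>\<T>. S w = \<chi> S *\<^sub>C w}"
    have lin: "clinear S" if "S \<in> \<T>" for S using insert.prems(1) that by blast
    have "cvs.subspace W" unfolding W_def
      by (auto simp: cvs.subspace_def clinear_simps[OF lin] cvs.scale_right_distrib mult.commute)
    moreover have "T w \<in> W" if "w \<in> W" for w
      unfolding W_def
    proof (intro CollectI ballI)
      fix S assume S: "S \<in> \<T>"
      have "S (T w) = T (S w)" by (rule insert.prems(2)) (use S in auto)
      also have "\<dots> = \<chi> S *\<^sub>C T w" using that S clinear_simps(3)[OF T, of "\<chi> S" w] by (simp add: W_def)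
      finally show "S (T w) = \<chi> S *\<^sub>C T w" .
    qed
    moreover have "v \<in> W" using \<chi> by (simp add: W_def)
    ultimately have "v \<in> cvs.span {w \<in> W. \<exists>c. T w = c *\<^sub>C w}"
      using insert.prems(3)[of T] by (intro diagonalizable_on_stable T) auto
    also have "\<dots> \<subseteq> cvs.span ?F" by (rule cvs.span_mono) (auto simp: W_def)
    finally show "v \<in> cvs.span ?F" .
  qed
  ultimately show ?case
    by (metis (no_types, lifting) cvs.span_mono cvs.span_span subset_antisym top_greatest)
qed simp

text \<open>Eigenspaces of one of the operators are stable under the others, so \<open>W\<close> can be shrunk until
  all operators act on it by scalars.\<close>

lemma common_eigenvector:
  assumes W: "fdim W" "cvs.subspace W" "W \<noteq> {0}"
    and lin: "\<And>T. T \<in> \<T> \<Longrightarrow> clinear T" and stab: "\<And>T x. T \<in> \<T> \<Longrightarrow> x \<in> W \<Longrightarrow> T x \<in> W"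
    and comm: "\<And>S T x. S \<in> \<T> \<Longrightarrow> T \<in> \<T> \<Longrightarrow> x \<in> W \<Longrightarrow> S (T x) = T (S x)"
  obtains v where "v \<in> W" "v \<noteq> 0" "\<forall>T\<in>\<T>. \<exists>c. T v = c *\<^sub>C v"
proof -
  have "\<exists>v\<in>W. v \<noteq> 0 \<and> (\<forall>T\<in>\<T>. \<exists>c. T v = c *\<^sub>C v)"
    using W stab comm
  proof (induction "cvs.dim W" arbitrary: W rule: less_induct)
    case less
    show ?case
    proof (cases "\<forall>T\<in>\<T>. \<exists>c. \<forall>x\<in>W. T x = c *\<^sub>C x")
      case True
      obtain v where "v \<in> W" "v \<noteq> 0" using less.prems cvs.subspace_0 by blast
      then show ?thesis using True by blast
    next
      case False
      then obtain T where T: "T \<in> \<T>" "\<nexists>c. \<forall>x\<in>W. T x = c *\<^sub>C x" by blast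
      obtain c v where v: "v \<in> W" "v \<noteq> 0" "T v = c *\<^sub>C v"
        using eigenvector_exists[OF lin[OF T(1)] less.prems(1,2) _ less.prems(3)] less.prems(4) T(1) by metis
      define W' where "W' = {x\<in>W. T x - c *\<^sub>C x = 0}"
      have sub: "cvs.subspace W'"
        unfolding W'_def by (rule clinear_kernel_subspace[OF clinear_shift[OF lin[OF T(1)]] less.prems(2)])
      have "W' \<noteq> W" using T(2) by (auto simp: W'_def)
      then have psub: "W' \<subset> W" by (auto simp: W'_def)
      have "\<exists>v\<in>W'. v \<noteq> 0 \<and> (\<forall>T\<in>\<T>. \<exists>c. T v = c *\<^sub>C v)"
      proof (rule less.hyps)
        show "cvs.dim W' < cvs.dim W" by (rule dim_strict_mono[OF less.prems(1) sub less.prems(2) psub])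
        show "fdim W'" using fdim_subset[OF less.prems(1)] psub by blast
        show "W' \<noteq> {0}" using v by (auto simp: W'_def)
        show "S x \<in> W'" if "S \<in> \<T>" "x \<in> W'" for S x
        proof -
          have "T (S x) = S (T x)" using less.prems(5) T(1) that by (auto simp: W'_def)
          also have "T x = c *\<^sub>C x" using that by (simp add: W'_def)
          finally show ?thesis using that less.prems(4) by (simp add: W'_def clinear_simps[OF lin])
        qed
        show "S (R x) = R (S x)" if "S \<in> \<T>" "R \<in> \<T>" "x \<in> W'" for S R x
          using less.prems(5) that by (auto simp: W'_def)
      qed (rule sub)
      then show ?thesis by (auto simp: W'_def)
    qed
  qed
  then show ?thesis using that by blast
qed

section \<open>The trace of an operator on a subspace\<close>

text \<open>The choice of basis is immaterial by \<open>trace_on_basis\<close>. The subspace is a parameter because the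
  same operator is restricted to several stable subspaces.\<close>

definition trace_on :: "'a::complex_vector set \<Rightarrow> ('a \<Rightarrow> 'a) \<Rightarrow> complex" where
  "trace_on W A = (let B = SOME B. finite B \<and> cvs.independent B \<and> cvs.span B = W
     in \<Sum>b\<in>B. cvs.representation B (A b) b)"

lemma representation_image:
  assumes A: "clinear A" and B: "finite B" "cvs.independent B"
    and C: "cvs.independent C" "cvs.span C = cvs.span B"
    and stab: "\<And>x. x \<in> cvs.span B \<Longrightarrow> A x \<in> cvs.span B" and x: "x \<in> cvs.span B"
  shows "cvs.representation C (A x) c = (\<Sum>b\<in>B. cvs.representation B x b * cvs.representation C (A b) c)"
proof -
  have mem: "A b \<in> cvs.span C" if "b \<in> B" for b using stab cvs.span_base[OF that] C by simp
  have "A x = A (\<Sum>b\<in>B. cvs.representation B x b *\<^sub>C b)"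
    using cvs.sum_representation_eq[OF B(2) x B(1)] by simp
  also have "\<dots> = (\<Sum>b\<in>B. cvs.representation B x b *\<^sub>C A b)"
    by (simp add: clinear_simps[OF A])
  finally have eq: "A x = (\<Sum>b\<in>B. cvs.representation B x b *\<^sub>C A b)" .
  show ?thesis unfolding eq
    by (subst cvs.representation_sum[OF C(1)])
       (auto simp: cvs.representation_scale[OF C(1) mem] mem cvs.span_scale)
qed

text \<open>Expanding the vectors of each basis in the other one turns both diagonal sums into the same
  double sum.\<close>

lemma trace_on_basis:
  assumes A: "clinear A" and B: "finite B" "cvs.independent B" "cvs.span B = W"
    and stab: "\<And>x. x \<in> W \<Longrightarrow> A x \<in> W"
  shows "trace_on W A = (\<Sum>b\<in>B. cvs.representation B (A b) b)"
proof -
  define C where "C = (SOME B. finite B \<and> cvs.independent B \<and> cvs.span B = W)"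
  have C: "finite C" "cvs.independent C" "cvs.span C = W"
    using someI[of "\<lambda>B. finite B \<and> cvs.independent B \<and> cvs.span B = W" B] B unfolding C_def by auto
  have id: "clinear (\<lambda>x::'a. x)" by (rule clinearI) simp_all
  have memB: "b \<in> W" if "b \<in> B" for b using that B(3) cvs.span_base by blast
  have memC: "b \<in> W" if "b \<in> C" for b using that C(3) cvs.span_base by blast
  have 1: "cvs.representation C (A c) c =
      (\<Sum>b\<in>B. cvs.representation B c b * cvs.representation C (A b) c)" if "c \<in> C" for c
    using representation_image[OF A B(1,2) C(2)] B(3) C(3) stab memC[OF that] by simp
  have 2: "cvs.representation B (A b) b =
      (\<Sum>c\<in>C. cvs.representation C (A b) c * cvs.representation B c b)" if "b \<in> B" for b
    using representation_image[OF id C(1,2) B(2), of "A b" b] B(3) C(3) stab[OF memB[OF that]] by simp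
  have "trace_on W A = (\<Sum>c\<in>C. cvs.representation C (A c) c)"
    by (simp add: trace_on_def C_def Let_def)
  also have "\<dots> = (\<Sum>c\<in>C. \<Sum>b\<in>B. cvs.representation B c b * cvs.representation C (A b) c)"
    by (rule sum.cong) (simp_all add: 1)
  also have "\<dots> = (\<Sum>b\<in>B. \<Sum>c\<in>C. cvs.representation C (A b) c * cvs.representation B c b)"
    by (subst sum.swap) (simp add: mult.commute)
  also have "\<dots> = (\<Sum>b\<in>B. cvs.representation B (A b) b)"
    by (rule sum.cong) (simp_all add: 2)
  finally show ?thesis .
qed

lemma trace_on_cong:
  assumes "\<And>x. x \<in> W \<Longrightarrow> A x = A' x" "fdim W" "cvs.subspace W"
  shows "trace_on W A = trace_on W A'"
proof -
  define C where "C = (SOME B. finite B \<and> cvs.independent B \<and> cvs.span B = W)"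
  obtain B where "finite B \<and> cvs.independent B \<and> cvs.span B = W" using fdim_basis[OF assms(2,3)] by metis
  then have "cvs.span C = W" unfolding C_def by (rule someI2) simp
  then have "A b = A' b" if "b \<in> C" for b using assms(1) that cvs.span_base by blast
  then show ?thesis unfolding trace_on_def Let_def C_def[symmetric] by simp
qed

locale fd_space =
  fixes W :: "'a::complex_vector set"
  assumes fdimW: "fdim W" and subW: "cvs.subspace W"
begin

definition op_on :: "('a \<Rightarrow> 'a) \<Rightarrow> bool" where
  "op_on A \<longleftrightarrow> clinear A \<and> (\<forall>x\<in>W. A x \<in> W)"

lemma op_onI: "clinear A \<Longrightarrow> (\<And>x. x \<in> W \<Longrightarrow> A x \<in> W) \<Longrightarrow> op_on A"
  by (simp add: op_on_def)

lemma op_on_comp: "op_on A \<Longrightarrow> op_on B \<Longrightarrow> op_on (\<lambda>x. A (B x))"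
  by (auto simp: op_on_def clinear_simps intro!: clinearI)

lemma op_on_add: "op_on A \<Longrightarrow> op_on B \<Longrightarrow> op_on (\<lambda>x. A x + B x)"
  using subW by (auto simp: op_on_def clinear_simps cvs.subspace_add cvs.scale_right_distrib intro!: clinearI)

lemma op_on_scale: "op_on A \<Longrightarrow> op_on (\<lambda>x. c *\<^sub>C A x)"
  using subW by (auto simp: op_on_def clinear_simps cvs.subspace_scale cvs.scale_right_distrib mult.commute intro!: clinearI)

lemma op_on_ident: "op_on (\<lambda>x. x)"
  by (auto simp: op_on_def intro!: clinearI)

lemma trace_eq:
  assumes "op_on A" "finite B" "cvs.independent B" "cvs.span B = W"
  shows "trace_on W A = (\<Sum>b\<in>B. cvs.representation B (A b) b)"
  using trace_on_basis[of A B W] assms by (auto simp: op_on_def)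

lemma trace_add:
  assumes "op_on A" "op_on A'" shows "trace_on W (\<lambda>x. A x + A' x) = trace_on W A + trace_on W A'"
proof -
  obtain B where B: "finite B" "cvs.independent B" "cvs.span B = W" "card B = cvs.dim W"
    by (rule fdim_basis[OF fdimW subW])
  have mem: "A b \<in> cvs.span B" "A' b \<in> cvs.span B" if "b \<in> B" for b
    using assms that B(3) cvs.span_base by (auto simp: op_on_def)
  show ?thesis
    by (simp add: trace_eq[OF _ B(1-3)] assms op_on_add mem cvs.representation_add[OF B(2)] sum.distrib)
qed

lemma trace_scale:
  assumes "op_on A" shows "trace_on W (\<lambda>x. c *\<^sub>C A x) = c * trace_on W A"
proof -
  obtain B where B: "finite B" "cvs.independent B" "cvs.span B = W" "card B = cvs.dim W"
    by (rule fdim_basis[OF fdimW subW])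
  have mem: "A b \<in> cvs.span B" if "b \<in> B" for b
    using assms that B(3) cvs.span_base by (auto simp: op_on_def)
  show ?thesis
    by (simp add: trace_eq[OF _ B(1-3)] assms op_on_scale mem cvs.representation_scale[OF B(2)] sum_distrib_left)
qed

lemma trace_diff:
  assumes "op_on A" "op_on A'" shows "trace_on W (\<lambda>x. A x - A' x) = trace_on W A - trace_on W A'"
  using trace_add[OF assms(1) op_on_scale[OF assms(2), of "-1"]] trace_scale[OF assms(2), of "-1"]
  by (simp add: scaleC_one)

lemma trace_commute:
  assumes "op_on A" "op_on A'" shows "trace_on W (\<lambda>x. A (A' x)) = trace_on W (\<lambda>x. A' (A x))"
proof -
  obtain B where B: "finite B" "cvs.independent B" "cvs.span B = W" "card B = cvs.dim W"
    by (rule fdim_basis[OF fdimW subW])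
  have lin: "clinear A" "clinear A'" and st: "\<And>x. x \<in> W \<Longrightarrow> A x \<in> W" "\<And>x. x \<in> W \<Longrightarrow> A' x \<in> W"
    using assms by (auto simp: op_on_def)
  have mem: "b \<in> W" if "b \<in> B" for b using that B(3) cvs.span_base by blast
  have rep: "cvs.representation B (A x) c =
      (\<Sum>b\<in>B. cvs.representation B x b * cvs.representation B (A b) c)" if "x \<in> W" for x c
    using representation_image[OF lin(1) B(1,2,2) refl] B(3) st(1) that by simp
  have rep': "cvs.representation B (A' x) c =
      (\<Sum>b\<in>B. cvs.representation B x b * cvs.representation B (A' b) c)" if "x \<in> W" for x c
    using representation_image[OF lin(2) B(1,2,2) refl] B(3) st(2) that by simp
  have *: "trace_on W (\<lambda>x. A (A' x)) =
      (\<Sum>b\<in>B. \<Sum>c\<in>B. cvs.representation B (A' b) c * cvs.representation B (A c) b)"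
    unfolding trace_eq[OF op_on_comp[OF assms] B(1-3)]
    by (rule sum.cong) (simp_all add: rep st mem)
  have "trace_on W (\<lambda>x. A' (A x)) =
      (\<Sum>b\<in>B. \<Sum>c\<in>B. cvs.representation B (A b) c * cvs.representation B (A' c) b)"
    unfolding trace_eq[OF op_on_comp[OF assms(2,1)] B(1-3)]
    by (rule sum.cong) (simp_all add: rep' st mem)
  also have "\<dots> = (\<Sum>c\<in>B. \<Sum>b\<in>B. cvs.representation B (A b) c * cvs.representation B (A' c) b)"
    by (rule sum.swap)
  finally show ?thesis unfolding * by (simp add: mult.commute)
qed

lemma trace_scalar:
  assumes "\<And>x. x \<in> W \<Longrightarrow> A x = c *\<^sub>C x" shows "trace_on W A = c * of_nat (cvs.dim W)"
proof -
  obtain B where B: "finite B" "cvs.independent B" "cvs.span B = W" "card B = cvs.dim W"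
    by (rule fdim_basis[OF fdimW subW])
  have "trace_on W A = trace_on W (\<lambda>x. c *\<^sub>C x)" by (rule trace_on_cong[OF _ fdimW subW]) (rule assms)
  also have "\<dots> = c * trace_on W (\<lambda>x. x)" by (rule trace_scale[OF op_on_ident])
  also have "trace_on W (\<lambda>x. x) = (\<Sum>b\<in>B. cvs.representation B b b)" by (rule trace_eq[OF op_on_ident B(1-3)])
  also have "\<dots> = of_nat (cvs.dim W)" by (simp add: cvs.representation_basis[OF B(2)] B(4))
  finally show ?thesis .
qed

text \<open>Vectors of a basis of \<open>W\<close> outside \<open>U\<close> do not contribute to the trace of an operator whose
  image lies in \<open>U\<close>.\<close>

lemma trace_image_subset:
  assumes A: "op_on A" and U: "cvs.subspace U" "U \<subseteq> W" "A ` W \<subseteq> U"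
  shows "trace_on W A = trace_on U A"
proof -
  obtain B where B: "finite B" "cvs.independent B" "cvs.span B = U"
    using fdim_basis[OF fdim_subset[OF fdimW U(2)] U(1)] by metis
  have "B \<subseteq> W" using B(3) U(2) cvs.span_superset by blast
  then obtain C where C: "B \<subseteq> C" "C \<subseteq> W" "cvs.independent C" "W \<subseteq> cvs.span C"
    using cvs.maximal_independent_subset_extend[OF _ B(2)] by metis
  have fin: "finite C" by (rule fdim_independent_finite[OF fdimW C(2,3)])
  have spC: "cvs.span C = W" using C subW by (simp add: cvs.span_subspace)
  have mem: "A c \<in> cvs.span B" if "c \<in> C" for c using that C(2) U(3) B(3) by blast
  have rep: "cvs.representation C (A c) = cvs.representation B (A c)" if "c \<in> C" for c
    by (rule cvs.representation_extend[OF C(3) mem[OF that] C(1)])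
  have "trace_on W A = (\<Sum>c\<in>C. cvs.representation B (A c) c)"
    using trace_eq[OF A fin C(3) spC] rep by simp
  also have "\<dots> = (\<Sum>c\<in>B. cvs.representation B (A c) c)"
    by (rule sum.mono_neutral_right[OF fin C(1)]) (auto dest: cvs.representation_ne_zero)
  also have "\<dots> = trace_on U A"
  proof (rule trace_on_basis[symmetric])
    show "A x \<in> U" if "x \<in> U" for x using that U by blast
  qed (use A B in \<open>auto simp: op_on_def\<close>)
  finally show ?thesis .
qed

end

text \<open>The trace does not change on passing to the image, and the iterated images shrink to \<open>0\<close>.\<close>

lemma trace_on_nilpotent:
  assumes W: "fdim W" "cvs.subspace W" and A: "clinear A" "\<And>x. x \<in> W \<Longrightarrow> A x \<in> W"
    and nil: "\<And>x. x \<in> W \<Longrightarrow> (A ^^ n) x = 0"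
  shows "trace_on W A = 0"
  using W A(2) nil
proof (induction n arbitrary: W)
  case 0
  interpret fd_space W using 0 by unfold_locales
  have "trace_on W A = 0 * of_nat (cvs.dim W)" by (rule trace_scalar) (use 0 in auto)
  then show ?case by simp
next
  case (Suc n)
  interpret fd_space W using Suc.prems by unfold_locales
  have AW: "A ` W \<subseteq> W" using Suc.prems by auto
  have "trace_on W A = trace_on (A ` W) A"
    using A(1) Suc.prems(3) AW by (intro trace_image_subset op_onI clinear_image_subspace subW) auto
  also have "\<dots> = 0"
  proof (rule Suc.IH)
    show "fdim (A ` W)" by (rule fdim_subset[OF fdimW AW])
    show "cvs.subspace (A ` W)" by (rule clinear_image_subspace[OF A(1) subW])
    show "A x \<in> A ` W" if "x \<in> A ` W" for x using that AW by blast
    show "(A ^^ n) x = 0" if "x \<in> A ` W" for x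
      using that Suc.prems(4) by (auto simp: funpow_swap1)
  qed
  finally show ?case .
qed

section \<open>Direct sums of subspaces\<close>

text \<open>Meant for finite \<open>I\<close>, where it says that the sum of the subspaces is direct; sums over
  infinite sets are \<open>0\<close> by convention.\<close>

definition independent_spaces :: "'i set \<Rightarrow> ('i \<Rightarrow> 'a::complex_vector set) \<Rightarrow> bool" where
  "independent_spaces I W \<longleftrightarrow> (\<forall>v. (\<forall>i\<in>I. v i \<in> W i) \<and> sum v I = 0 \<longrightarrow> (\<forall>i\<in>I. v i = 0))"

lemma span_Union_decompose:
  assumes "finite I" "\<And>i. i \<in> I \<Longrightarrow> cvs.subspace (W i)" "x \<in> cvs.span (\<Union>i\<in>I. W i)"
  obtains v where "\<And>i. i \<in> I \<Longrightarrow> v i \<in> W i" "x = sum v I"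
proof -
  have "\<exists>v. (\<forall>i\<in>I. v i \<in> W i) \<and> x = sum v I" using assms(3)
  proof (induction rule: cvs.span_induct_alt)
    case base
    show ?case by (rule exI[of _ "\<lambda>_. 0"]) (simp add: assms cvs.subspace_0)
  next
    case (step c x y)
    then obtain v j where v: "\<forall>i\<in>I. v i \<in> W i" "y = sum v I" and j: "j \<in> I" "x \<in> W j" by auto
    let ?v = "\<lambda>i. v i + (if i = j then c *\<^sub>C x else 0)"
    have "sum ?v I = c *\<^sub>C x + y" using j assms(1) v by (simp add: sum.distrib sum.delta)
    moreover have "\<forall>i\<in>I. ?v i \<in> W i"
      using v j assms(2) by (auto simp: cvs.subspace_add cvs.subspace_scale)
    ultimately show ?case by (intro exI[of _ ?v]) simp
  qed
  then show ?thesis using that by blast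
qed

lemma independent_spaces_insert:
  assumes "finite I" "i \<notin> I" "independent_spaces (insert i I) W" "\<And>j. j \<in> insert i I \<Longrightarrow> cvs.subspace (W j)"
  shows "independent_spaces I W" "W i \<inter> cvs.span (\<Union>j\<in>I. W j) = {0}"
proof -
  show "independent_spaces I W" unfolding independent_spaces_def
  proof (intro allI impI)
    fix v assume v: "(\<forall>j\<in>I. v j \<in> W j) \<and> sum v I = 0"
    let ?v = "v(i := 0)"
    have "sum ?v I = sum v I" using assms(2) by (intro sum.cong) auto
    then have "sum ?v (insert i I) = 0" using v assms(1,2) by simp
    moreover have "\<forall>j\<in>insert i I. ?v j \<in> W j" using v assms(4)[THEN cvs.subspace_0] by auto
    ultimately have "\<forall>j\<in>insert i I. ?v j = 0" using assms(3) unfolding independent_spaces_def by blast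
    then show "\<forall>j\<in>I. v j = 0" using assms(2) by (auto split: if_splits)
  qed
  show "W i \<inter> cvs.span (\<Union>j\<in>I. W j) = {0}"
  proof -
    have "x = 0" if x: "x \<in> W i" "x \<in> cvs.span (\<Union>j\<in>I. W j)" for x
    proof -
      obtain v where v: "\<And>j. j \<in> I \<Longrightarrow> v j \<in> W j" "x = sum v I"
        by (rule span_Union_decompose[OF assms(1) _ x(2)]) (use assms(4) in auto)
      let ?v = "v(i := - x)"
      have "sum ?v I = sum v I" using assms(2) by (intro sum.cong) auto
      then have "sum ?v (insert i I) = 0" using v assms(1,2) by simp
      moreover have "\<forall>j\<in>insert i I. ?v j \<in> W j" using v x assms(4)[THEN cvs.subspace_neg] by auto
      ultimately have "?v i = 0" using assms(3) unfolding independent_spaces_def by blast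
      then show ?thesis by simp
    qed
    moreover have "0 \<in> W i" using assms(4) cvs.subspace_0 by blast
    ultimately show ?thesis using cvs.span_zero by blast
  qed
qed

lemma independent_Un:
  assumes "finite C" "cvs.independent B" "cvs.independent C" "cvs.span B \<inter> cvs.span C = {0}"
  shows "cvs.independent (B \<union> C) \<and> B \<inter> C = {}"
  using assms
proof (induction C rule: finite_induct)
  case (insert c C)
  have cC: "cvs.independent C" "c \<notin> cvs.span C"
    using insert.prems(2) insert.hyps unfolding cvs.independent_insert by simp_all
  have "cvs.span C \<subseteq> cvs.span (insert c C)" by (rule cvs.span_mono) blast
  then have "cvs.span B \<inter> cvs.span C = {0}" using insert.prems(3) cvs.span_zero by blast
  then have IH: "cvs.independent (B \<union> C)" "B \<inter> C = {}" using insert.IH insert.prems cC by auto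
  have "c \<notin> cvs.span (B \<union> C)"
  proof
    assume "c \<in> cvs.span (B \<union> C)"
    then obtain b d where bd: "c = b + d" "b \<in> cvs.span B" "d \<in> cvs.span C" by (auto simp: cvs.span_Un)
    have "b = c - d" using bd by simp
    moreover have "c \<in> cvs.span (insert c C)" "d \<in> cvs.span (insert c C)"
      using bd \<open>cvs.span C \<subseteq> cvs.span (insert c C)\<close> cvs.span_base by blast+
    ultimately have "b \<in> cvs.span (insert c C)" using cvs.span_diff by blast
    then have "b = 0" using bd insert.prems(3) by blast
    then show False using bd cC by simp
  qed
  then show ?case using IH cvs.independent_insertI cvs.span_base[of c "B \<union> C"] by auto
qed simp

lemma trace_on_Un:
  assumes A: "clinear A" and U: "fdim U" "cvs.subspace U" "\<And>x. x \<in> U \<Longrightarrow> A x \<in> U"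
    and V: "fdim V" "cvs.subspace V" "\<And>x. x \<in> V \<Longrightarrow> A x \<in> V" and disj: "U \<inter> V = {0}"
  shows "trace_on (cvs.span (U \<union> V)) A = trace_on U A + trace_on V A"
proof -
  obtain B where B: "finite B" "cvs.independent B" "cvs.span B = U" using fdim_basis[OF U(1,2)] by metis
  obtain C where C: "finite C" "cvs.independent C" "cvs.span C = V" using fdim_basis[OF V(1,2)] by metis
  have BC: "cvs.independent (B \<union> C)" "B \<inter> C = {}" using independent_Un[OF C(1) B(2) C(2)] B C disj by auto
  have sp: "cvs.span (B \<union> C) = cvs.span (U \<union> V)"
    unfolding cvs.span_Un B(3) C(3) by (simp add: U V cvs.span_eq_iff[THEN iffD2])
  have memB: "A b \<in> cvs.span B" if "b \<in> B" for b using B(3) U(3) cvs.span_base[OF that] by simp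
  have memC: "A b \<in> cvs.span C" if "b \<in> C" for b using C(3) V(3) cvs.span_base[OF that] by simp
  have stab: "A x \<in> cvs.span (U \<union> V)" if "x \<in> cvs.span (U \<union> V)" for x
    by (rule clinear_span_into[OF A _ _ that]) (use U(3) V(3) in \<open>auto intro: cvs.span_base\<close>)
  have "trace_on (cvs.span (U \<union> V)) A = (\<Sum>b\<in>B \<union> C. cvs.representation (B \<union> C) (A b) b)"
    using B(1) C(1) BC(1) sp by (intro trace_on_basis A stab) auto
  also have "\<dots> = (\<Sum>b\<in>B. cvs.representation (B \<union> C) (A b) b) + (\<Sum>b\<in>C. cvs.representation (B \<union> C) (A b) b)"
    by (rule sum.union_disjoint[OF B(1) C(1) BC(2)])
  also have "(\<Sum>b\<in>B. cvs.representation (B \<union> C) (A b) b) = trace_on U A"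
    using trace_on_basis[OF A B U(3)] cvs.representation_extend[OF BC(1) memB] by simp
  also have "(\<Sum>b\<in>C. cvs.representation (B \<union> C) (A b) b) = trace_on V A"
    using trace_on_basis[OF A C V(3)] cvs.representation_extend[OF BC(1) memC] by simp
  finally show ?thesis .
qed

lemma fdim_span_Union:
  assumes "finite I" "\<And>i. i \<in> I \<Longrightarrow> fdim (W i)" shows "fdim (cvs.span (\<Union>i\<in>I. W i))"
proof -
  obtain E where E: "\<And>i. i \<in> I \<Longrightarrow> finite (E i) \<and> W i \<subseteq> cvs.span (E i)"
    using assms(2) unfolding fdim_def by metis
  have "W i \<subseteq> cvs.span (\<Union>i\<in>I. E i)" if "i \<in> I" for i
    using E[OF that] cvs.span_mono[of "E i" "\<Union>i\<in>I. E i"] that by blast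
  then have "cvs.span (\<Union>i\<in>I. W i) \<subseteq> cvs.span (\<Union>i\<in>I. E i)" by (intro cvs.span_minimal) auto
  then show ?thesis unfolding fdim_def using E assms(1) by (intro exI[of _ "\<Union>i\<in>I. E i"]) auto
qed

lemma trace_on_direct_sum:
  assumes "finite I" and A: "clinear A" and "\<And>i. i \<in> I \<Longrightarrow> fdim (W i)" "\<And>i. i \<in> I \<Longrightarrow> cvs.subspace (W i)"
    "\<And>i x. i \<in> I \<Longrightarrow> x \<in> W i \<Longrightarrow> A x \<in> W i" and "independent_spaces I W"
  shows "trace_on (cvs.span (\<Union>i\<in>I. W i)) A = (\<Sum>i\<in>I. trace_on (W i) A)"
  using assms(1,3-)
proof (induction I rule: finite_induct)
  case empty
  show ?case by (simp, rule trace_on_nilpotent[where n = 0])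
    (simp_all add: clinear_simps[OF A] A fdim_def exI[of _ "{}"])
next
  case (insert i I)
  let ?S = "cvs.span (\<Union>j\<in>I. W j)"
  have ind: "independent_spaces I W" "W i \<inter> ?S = {0}"
    using independent_spaces_insert[OF insert.hyps insert.prems(4)] insert.prems(2) by blast+
  have stab: "A x \<in> ?S" if "x \<in> ?S" for x
    by (rule clinear_span_into[OF A _ _ that]) (use insert.prems(3) cvs.span_base in blast, simp)
  have "cvs.span (\<Union>j\<in>insert i I. W j) = cvs.span (W i \<union> ?S)"
    by (simp add: cvs.span_Un cvs.span_span)
  also have "trace_on \<dots> A = trace_on (W i) A + trace_on ?S A"
    using insert.prems ind stab by (intro trace_on_Un A fdim_span_Union insert.hyps) auto
  also have "trace_on ?S A = (\<Sum>j\<in>I. trace_on (W j) A)"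
    using insert.prems ind by (intro insert.IH) auto
  finally show ?case using insert.hyps by simp
qed

lemma independent_spaces_card_le:
  assumes A: "finite A" and ind: "independent_spaces A W" and sub: "\<And>i. i \<in> A \<Longrightarrow> cvs.subspace (W i)"
    and v: "\<And>i. i \<in> A \<Longrightarrow> v i \<in> W i \<and> v i \<noteq> 0 \<and> v i \<in> X" and X: "fdim X" "cvs.subspace X"
  shows "card A \<le> cvs.dim X"
proof -
  have zero: "c i = 0" if "(\<Sum>i\<in>A. c i *\<^sub>C v i) = 0" "i \<in> A" for c i
  proof -
    have "\<forall>i\<in>A. c i *\<^sub>C v i = 0"
      using ind[unfolded independent_spaces_def, rule_format, of "\<lambda>i. c i *\<^sub>C v i"] that(1) v
        cvs.subspace_scale[OF sub] by blast
    then show ?thesis using v that(2) by simp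
  qed
  have inj: "inj_on v A"
  proof (rule inj_onI, rule ccontr)
    fix i j assume ij: "i \<in> A" "j \<in> A" "v i = v j" "i \<noteq> j"
    let ?c = "\<lambda>k. if k = i then 1 else if k = j then -1 else (0::complex)"
    have "(\<Sum>k\<in>A. ?c k *\<^sub>C v k) = (\<Sum>k\<in>{i,j}. ?c k *\<^sub>C v k)"
      by (rule sum.mono_neutral_right[OF A]) (use ij in auto)
    also have "\<dots> = 0" using ij by (simp add: scaleC_one)
    finally have "?c i = 0" using ij(1) by (rule zero)
    then show False by simp
  qed
  have "cvs.independent (v ` A)"
  proof (rule cvs.independent_if_scalars_zero)
    fix f x assume "(\<Sum>x\<in>v ` A. f x *\<^sub>C x) = 0" "x \<in> v ` A"
    then show "f x = 0" using zero[of "\<lambda>i. f (v i)"] inj by (auto simp: sum.reindex)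
  qed (simp add: A)
  then have "card (v ` A) \<le> cvs.dim X" using v by (intro independent_card_le_dim X) auto
  then show ?thesis using card_image[OF inj] by simp
qed

section \<open>Nilpotent sets of operators in a Lie algebra\<close>

locale fd_lie =
  fixes g :: "'g::complex_vector super_lie" and L :: "'g set"
  assumes fdL: "fdim L" and subL: "cvs.subspace L"
    and lin_right: "\<And>x. clinear (brk g x)" and lin_left: "\<And>y. clinear (\<lambda>x. brk g x y)"
    and closed: "\<And>x y. x \<in> L \<Longrightarrow> y \<in> L \<Longrightarrow> brk g x y \<in> L"
    and antisym: "\<And>x y. x \<in> L \<Longrightarrow> y \<in> L \<Longrightarrow> brk g x y = - brk g y x"
    and jacobi: "\<And>x y z. x \<in> L \<Longrightarrow> y \<in> L \<Longrightarrow> z \<in> L \<Longrightarrow>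
      brk g x (brk g y z) = brk g (brk g x y) z + brk g y (brk g x z)"
begin

abbreviation br :: "'g \<Rightarrow> 'g \<Rightarrow> 'g" where "br \<equiv> brk g"

lemmas br_right = clinear_simps[OF lin_right]
lemmas br_left = clinear_simps[OF lin_left]

lemma br_self: "x \<in> L \<Longrightarrow> br x x = 0"
proof -
  assume "x \<in> L"
  then have "br x x + br x x = 0" using antisym[of x x] by (simp add: eq_neg_iff_add_eq_0)
  then have "(2::complex) *\<^sub>C br x x = 0" using scaleC_add_left[of 1 1 "br x x"] by (simp add: scaleC_one)
  then show "br x x = 0" by simp
qed

definition act_span :: "'g set \<Rightarrow> 'g set \<Rightarrow> 'g set" where
  "act_span X V = cvs.span {br x v |x v. x \<in> X \<and> v \<in> V}"

lemma act_span_subspace: "cvs.subspace (act_span X V)"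
  by (simp add: act_span_def)

lemma act_spanI: "x \<in> X \<Longrightarrow> v \<in> V \<Longrightarrow> br x v \<in> act_span X V"
  unfolding act_span_def by (rule cvs.span_base) blast

lemma act_span_subset:
  assumes "cvs.subspace W" "\<And>x v. x \<in> X \<Longrightarrow> v \<in> V \<Longrightarrow> br x v \<in> W" shows "act_span X V \<subseteq> W"
  unfolding act_span_def by (rule cvs.span_minimal) (use assms in auto)

lemma act_span_mono_span:
  assumes "X \<subseteq> cvs.span Y" "V \<subseteq> V'" shows "act_span X V \<subseteq> act_span Y V'"
proof (rule act_span_subset[OF act_span_subspace])
  fix x v assume "x \<in> X" "v \<in> V"
  then have x: "x \<in> cvs.span Y" and v: "v \<in> V'" using assms by auto
  show "br x v \<in> act_span Y V'"
    by (rule clinear_span_into[OF lin_left _ act_span_subspace x]) (rule act_spanI[OF _ v])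
qed

lemma act_span_pow_mono:
  assumes "X \<subseteq> cvs.span Y" "V \<subseteq> V'" shows "(act_span X ^^ m) V \<subseteq> (act_span Y ^^ m) V'"
  by (induction m) (simp_all add: assms act_span_mono_span)

lemma act_span_pow_subspace: "cvs.subspace ((act_span X ^^ m) L)"
  by (cases m) (simp_all add: subL act_span_subspace)

lemma act_span_pow_decreasing: "X \<subseteq> L \<Longrightarrow> (act_span X ^^ Suc m) L \<subseteq> (act_span X ^^ m) L"
proof (induction m)
  case 0
  then show ?case using closed by (auto intro!: act_span_subset[OF subL])
next
  case (Suc m)
  then show ?case using act_span_mono_span[OF cvs.span_superset[of X] Suc.IH[OF Suc.prems]] by simp
qed

lemma act_span_pow_subset: "X \<subseteq> L \<Longrightarrow> (act_span X ^^ m) L \<subseteq> L"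
  using act_span_pow_decreasing by (induction m) (simp, blast)

text \<open>The powers of \<open>T\<close> filter \<open>L\<close>; as \<open>y\<close> normalises \<open>T\<close> it preserves the filtration, and \<open>n\<close> steps
  with elements of \<open>T\<close> and \<open>y\<close> advance it by one.\<close>

lemma extend_nilpotent_set:
  assumes T: "T \<subseteq> L" "(act_span T ^^ m) L \<subseteq> {0}" and y: "y \<in> L" "\<And>t. t \<in> T \<Longrightarrow> br y t \<in> T"
    and nil: "\<And>v. v \<in> L \<Longrightarrow> (br y ^^ n) v = 0"
  shows "(act_span (insert y T) ^^ (n * m)) L \<subseteq> {0}"
proof -
  define V where "V i = (act_span T ^^ i) L" for i
  have Vsub: "cvs.subspace (V i)" for i unfolding V_def by (rule act_span_pow_subspace)
  have VL: "V i \<subseteq> L" for i unfolding V_def by (rule act_span_pow_subset[OF T(1)])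
  have Vdec: "V (Suc i) \<subseteq> V i" for i unfolding V_def by (rule act_span_pow_decreasing[OF T(1)])
  have tV: "br t v \<in> V (Suc i)" if "t \<in> T" "v \<in> V i" for t v i
    using act_spanI[OF that] by (simp add: V_def)
  have yV: "br y v \<in> V i" if "v \<in> V i" for v i
    using that
  proof (induction i arbitrary: v)
    case 0
    then show ?case using closed y(1) by (simp add: V_def)
  next
    case (Suc i)
    have v: "v \<in> cvs.span {br t u |t u. t \<in> T \<and> u \<in> V i}"
      using Suc.prems by (simp add: V_def act_span_def)
    show ?case
    proof (rule clinear_span_into[OF lin_right _ Vsub v])
      fix x assume "x \<in> {br t u |t u. t \<in> T \<and> u \<in> V i}"
      then obtain t u where tu: "x = br t u" "t \<in> T" "u \<in> V i" by blast
      have "br y x = br (br y t) u + br t (br y u)"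
        unfolding tu(1) using tu T(1) VL y(1) by (intro jacobi) auto
      then show "br y x \<in> V (Suc i)" using tu y(2) Suc.IH tV Vsub cvs.subspace_add by metis
    qed
  qed
  have ypow: "(br y ^^ j) v \<in> V i" if "v \<in> V i" for v i j
    using that by (induction j) (simp_all add: yV)
  \<comment> \<open>Modulo the next step of the filtration only the powers of \<open>y\<close> survive.\<close>
  have step: "(act_span (insert y T) ^^ j) (V i) \<subseteq> cvs.span ((br y ^^ j) ` V i \<union> V (Suc i))" for i j
  proof (induction j)
    case 0
    show ?case by (auto intro: cvs.span_base)
  next
    case (Suc j)
    let ?U = "cvs.span ((br y ^^ j) ` V i \<union> V (Suc i))"
    let ?U' = "cvs.span ((br y ^^ Suc j) ` V i \<union> V (Suc i))"
    have UV: "?U \<subseteq> V i" by (rule cvs.span_minimal[OF _ Vsub]) (use ypow Vdec in auto)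
    have "act_span (insert y T) ?U \<subseteq> ?U'"
    proof (rule act_span_subset)
      fix x v assume xv: "x \<in> insert y T" "v \<in> ?U"
      show "br x v \<in> ?U'"
      proof (cases "x \<in> T")
        case True
        then show ?thesis using tV UV xv(2) by (blast intro: cvs.span_base)
      next
        case False
        then have "x = y" using xv by simp
        show ?thesis unfolding \<open>x = y\<close>
          by (rule clinear_span_into[OF lin_right _ _ xv(2)]) (use yV in \<open>auto intro!: cvs.span_base\<close>)
      qed
    qed simp
    then show ?case using act_span_mono_span[OF cvs.span_superset Suc.IH] by simp blast
  qed
  have ynil: "(br y ^^ n) ` V i \<subseteq> {0}" for i using nil VL by auto
  have "cvs.span ((br y ^^ n) ` V i \<union> V (Suc i)) \<subseteq> V (Suc i)"
    if "(br y ^^ n) ` V i \<subseteq> {0}" for i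
  proof (intro cvs.span_minimal[OF _ Vsub] Un_least order_refl)
    show "(br y ^^ n) ` V i \<subseteq> V (Suc i)"
      by (rule order_trans[OF that]) (simp add: cvs.subspace_0[OF Vsub])
  qed
  then have n: "(act_span (insert y T) ^^ n) (V i) \<subseteq> V (Suc i)" for i using order_trans[OF step[of n i]] ynil by simp
  have "(act_span (insert y T) ^^ (n * i)) L \<subseteq> V i" for i
  proof (induction i)
    case (Suc i)
    have "(act_span (insert y T) ^^ (n * Suc i)) L
        = (act_span (insert y T) ^^ n) ((act_span (insert y T) ^^ (n * i)) L)"
      by (simp add: funpow_add)
    also have "\<dots> \<subseteq> (act_span (insert y T) ^^ n) (V i)"
      by (rule act_span_pow_mono[OF cvs.span_superset Suc.IH])
    finally show ?case using n by blast
  qed (simp add: V_def)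
  then show ?thesis using T(2) by (auto simp: V_def)
qed

text \<open>The Engel--Jacobson theorem for sets closed under the bracket. Among the bracket-closed
  subsets that act nilpotently choose one, \<open>T\<close>, whose span has maximal dimension. If it does not
  span \<open>X\<close>, then, as \<open>T\<close> acts nilpotently on \<open>L\<close> itself, applying brackets with \<open>T\<close> to an element of
  \<open>X\<close> as long as the result stays outside the span of \<open>T\<close> produces an element that normalises \<open>T\<close>;
  adjoining it to \<open>T\<close> contradicts maximality.\<close>

lemma engel_jacobson:
  assumes X: "X \<subseteq> L" "\<And>x y. x \<in> X \<Longrightarrow> y \<in> X \<Longrightarrow> br x y \<in> X"
    and nil: "\<And>x. x \<in> X \<Longrightarrow> \<exists>n. \<forall>v\<in>L. (br x ^^ n) v = 0"
  shows "\<exists>m. (act_span X ^^ m) L \<subseteq> {0}"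
proof -
  define P where "P T \<longleftrightarrow> T \<subseteq> X \<and> (\<forall>x\<in>T. \<forall>y\<in>T. br x y \<in> T) \<and> (\<exists>m. (act_span T ^^ m) L \<subseteq> {0})" for T
  have "(act_span {} ^^ 1) L \<subseteq> {0}" by (simp add: act_span_def)
  then have P0: "P {}" unfolding P_def by blast
  have bound: "cvs.dim (cvs.span T) < Suc (cvs.dim L)" if "P T" for T
  proof -
    have "cvs.span T \<subseteq> L" using that X(1) by (intro cvs.span_minimal subL) (auto simp: P_def)
    then show ?thesis using dim_mono_fdim[OF fdL _ subL, of "cvs.span T"] by simp
  qed
  obtain T where T: "P T" "\<And>T'. P T' \<Longrightarrow> cvs.dim (cvs.span T') \<le> cvs.dim (cvs.span T)"
    using ex_has_greatest_nat[of P "{}" "\<lambda>T. cvs.dim (cvs.span T)" "Suc (cvs.dim L)"] P0 bound by blast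
  obtain m where m: "(act_span T ^^ m) L \<subseteq> {0}" using T(1) by (auto simp: P_def)
  define T1 where "T1 = X \<inter> cvs.span T"
  have TL: "cvs.span T \<subseteq> L" using T(1) X(1) by (intro cvs.span_minimal subL) (auto simp: P_def)
  have brT: "br x y \<in> cvs.span T" if "x \<in> cvs.span T" "y \<in> cvs.span T" for x y
  proof (rule clinear_span_into[OF lin_left _ _ that(1)])
    fix t assume t: "t \<in> T"
    show "br t y \<in> cvs.span T"
      by (rule clinear_span_into[OF lin_right _ _ that(2)]) (use t T(1) in \<open>auto simp: P_def intro: cvs.span_base\<close>)
  qed simp
  have T1_closed: "br x y \<in> T1" if "x \<in> T1" "y \<in> T1" for x y
    using that brT X(2) by (auto simp: T1_def)
  have m1: "(act_span T1 ^^ m) L \<subseteq> {0}"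
    using act_span_pow_mono[of T1 T L L m] m by (auto simp: T1_def)
  show ?thesis
  proof (cases "X \<subseteq> cvs.span T")
    case True
    then have "T1 = X" by (auto simp: T1_def)
    then show ?thesis using m1 by blast
  next
    case False
    then obtain x0 where x0: "x0 \<in> X" "x0 \<notin> cvs.span T" by blast
    have zero: "0 \<in> T1" using X(2)[OF x0(1) x0(1)] br_self[of x0] x0(1) X(1) cvs.span_zero
      by (auto simp: T1_def)
    have "\<exists>y\<in>X. y \<notin> cvs.span T \<and> (\<forall>t\<in>T1. br t y \<in> cvs.span T)"
    proof (rule ccontr)
      assume no: "\<not> ?thesis"
      have "\<exists>y\<in>X. y \<notin> cvs.span T \<and> y \<in> (act_span T1 ^^ j) L" for j
      proof (induction j)
        case 0
        show ?case using x0 X(1) by auto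
      next
        case (Suc j)
        then obtain y where y: "y \<in> X" "y \<notin> cvs.span T" "y \<in> (act_span T1 ^^ j) L" by blast
        then obtain t where t: "t \<in> T1" "br t y \<notin> cvs.span T" using no by blast
        then show ?case using X(2)[of t y] y act_spanI[OF t(1) y(3)] by (auto simp: T1_def)
      qed
      then obtain y where "y \<notin> cvs.span T" "y \<in> (act_span T1 ^^ m) L" by blast
      then show False using m1 cvs.span_zero by blast
    qed
    then obtain y where y: "y \<in> X" "y \<notin> cvs.span T" "\<And>t. t \<in> T1 \<Longrightarrow> br t y \<in> cvs.span T" by blast
    have ty: "br t y \<in> T1" if "t \<in> T1" for t
      using y that X(2) by (auto simp: T1_def)
    have yt: "br y t \<in> T1" if "t \<in> T1" for t
    proof -
      have "br y t = - br t y" using that y(1) X(1) by (intro antisym) (auto simp: T1_def)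
      then have "br y t \<in> cvs.span T" using y(3)[OF that] cvs.span_neg by simp
      moreover have "br y t \<in> X" using X(2) y(1) that by (auto simp: T1_def)
      ultimately show ?thesis by (simp add: T1_def)
    qed
    obtain n where n: "\<forall>v\<in>L. (br y ^^ n) v = 0" using nil[OF y(1)] by blast
    have "(act_span (insert y T1) ^^ (n * m)) L \<subseteq> {0}"
      by (rule extend_nilpotent_set[OF _ m1]) (use X(1) y(1) yt n in \<open>auto simp: T1_def\<close>)
    moreover have "br y y = 0" using br_self y(1) X(1) by blast
    ultimately have P2: "P (insert y T1)"
      unfolding P_def using y(1) T1_closed ty yt zero by (auto simp: T1_def)
    have "T \<subseteq> T1" using T(1) cvs.span_superset by (auto simp: P_def T1_def)
    then have "cvs.span T \<subseteq> cvs.span (insert y T1)" by (intro cvs.span_mono) blast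
    moreover have "y \<in> cvs.span (insert y T1)" by (rule cvs.span_base) simp
    ultimately have psub: "cvs.span T \<subset> cvs.span (insert y T1)" using y(2) by blast
    have "cvs.span (insert y T1) \<subseteq> L" using P2 X(1) by (intro cvs.span_minimal subL) (auto simp: P_def)
    then have "cvs.dim (cvs.span T) < cvs.dim (cvs.span (insert y T1))"
      by (intro dim_strict_mono psub fdim_subset[OF fdL]) auto
    then show ?thesis using T(2)[OF P2] by simp
  qed
qed

end

section \<open>Generalised weight spaces of a Cartan subalgebra\<close>

lemma locally_nilpotent_uniform:
  fixes T :: "'a::complex_vector \<Rightarrow> 'a"
  assumes T: "clinear T" and W: "fdim W" "cvs.subspace W" and nil: "\<And>x. x \<in> W \<Longrightarrow> \<exists>N. (T ^^ N) x = 0"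
  shows "\<exists>N. \<forall>x\<in>W. (T ^^ N) x = 0"
proof -
  obtain B where B: "finite B" "cvs.independent B" "cvs.span B = W" "card B = cvs.dim W"
    by (rule fdim_basis[OF W])
  have "\<forall>b\<in>B. \<exists>N. (T ^^ N) b = 0" using nil B(3) cvs.span_superset[of B] by blast
  then obtain N where N: "\<And>b. b \<in> B \<Longrightarrow> (T ^^ N b) b = 0" by metis
  let ?M = "\<Sum>b\<in>B. N b"
  have b0: "(T ^^ ?M) b = 0" if "b \<in> B" for b
  proof -
    have "?M = (?M - N b) + N b" using member_le_sum[OF that _ B(1), of N] by simp
    then have "(T ^^ ?M) b = (T ^^ (?M - N b)) ((T ^^ N b) b)" by (metis funpow_add_apply)
    then show ?thesis using N[OF that] by (simp add: clinear_simps[OF clinear_funpow[OF T]])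
  qed
  have "(T ^^ ?M) x = 0" if "x \<in> W" for x
    using clinear_span_into[OF clinear_funpow[OF T, of ?M] _ cvs.subspace_single_0, of B x] b0 that B(3) by auto
  then show ?thesis by blast
qed

lemma funpow_eigen_zero:
  fixes T :: "'a::complex_vector \<Rightarrow> 'a"
  assumes "clinear T" "T x = a *\<^sub>C x" "(T ^^ N) x = 0" "a \<noteq> 0" shows "x = 0"
proof -
  have "(T ^^ N) x = (a ^ N) *\<^sub>C x"
    by (induction N) (simp_all add: clinear_simps[OF assms(1)] assms(2) scaleC_one mult.commute)
  then show ?thesis using assms(3,4) by simp
qed

locale cartan_pair = fd_lie +
  fixes h :: "'a set"
  assumes subh: "cvs.subspace h" and hL: "h \<subseteq> L"
    and h_closed: "\<And>x y. x \<in> h \<Longrightarrow> y \<in> h \<Longrightarrow> brk g x y \<in> h"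
    and h_nil: "\<exists>c. \<forall>H\<in>h. \<forall>y\<in>h. (brk g H ^^ c) y = 0"
    and self_normalizing: "\<And>x. x \<in> L \<Longrightarrow> (\<And>y. y \<in> h \<Longrightarrow> brk g x y \<in> h) \<Longrightarrow> x \<in> h"
begin

definition shifted :: "'a \<Rightarrow> complex \<Rightarrow> 'a \<Rightarrow> 'a" where
  "shifted H c = (\<lambda>x. br H x - c *\<^sub>C x)"

lemma clinear_shifted: "clinear (shifted H c)"
  unfolding shifted_def by (rule clinear_shift[OF lin_right])

lemmas shifted_pow_simps = clinear_simps[OF clinear_funpow[OF clinear_shifted]]

lemma shifted_0: "shifted H 0 = br H"
  by (simp add: shifted_def)

lemma shifted_mem: "cvs.subspace W \<Longrightarrow> (\<And>x. x \<in> W \<Longrightarrow> br H x \<in> W) \<Longrightarrow> x \<in> W \<Longrightarrow> shifted H c x \<in> W"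
  unfolding shifted_def by (intro cvs.subspace_diff cvs.subspace_scale)

lemma shifted_leibniz:
  assumes "H \<in> L" "x \<in> L" "w \<in> L"
  shows "shifted H (a + b) (br x w) = br (shifted H a x) w + br x (shifted H b w)"
  using jacobi[OF assms] by (simp add: shifted_def br_left br_right cvs.scale_left_distrib algebra_simps)

text \<open>The operator \<open>ad H\<close> is a derivation, so brackets of generalised eigenvectors are generalised
  eigenvectors for the sum of the eigenvalues.\<close>

lemma shifted_pow_bracket:
  assumes "H \<in> L" "x \<in> L" "w \<in> L" "(shifted H a ^^ c) x = 0" "(shifted H b ^^ n) w = 0"
  shows "(shifted H (a + b) ^^ (n + c)) (br x w) = 0"
  using assms(2-)
proof (induction "n + c" arbitrary: n c x w)
  case 0
  then show ?case by (simp add: br_left)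
next
  case (Suc k)
  have SL: "shifted H d v \<in> L" if "v \<in> L" for d v
    by (rule shifted_mem[OF subL closed[OF assms(1)] that])
  show ?case
  proof (cases "n = 0 \<or> c = 0")
    case True
    then have "br x w = 0" using Suc.prems by (auto simp: br_left br_right)
    then show ?thesis by (simp add: shifted_pow_simps)
  next
    case False
    then obtain n' c' where n: "n = Suc n'" "c = Suc c'" by (metis not0_implies_Suc)
    have 1: "(shifted H (a + b) ^^ (n + c')) (br (shifted H a x) w) = 0"
      using Suc.hyps(2) Suc.prems n SL by (intro Suc.hyps(1)) (auto simp: funpow_swap1)
    have 2: "(shifted H (a + b) ^^ (n' + c)) (br x (shifted H b w)) = 0"
      using Suc.hyps(2) Suc.prems n SL by (intro Suc.hyps(1)) (auto simp: funpow_swap1)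
    have "n + c = Suc (n + c')" "n + c' = n' + c" using n by simp_all
    then have "(shifted H (a + b) ^^ (n + c)) (br x w)
        = (shifted H (a + b) ^^ (n + c')) (shifted H (a + b) (br x w))"
      by (simp only: funpow_Suc_right comp_apply)
    also have "\<dots> = 0"
      unfolding shifted_leibniz[OF assms(1) Suc.prems(1,2)] shifted_pow_simps(1) 1
      using 2 \<open>n + c' = n' + c\<close> by simp
    finally show ?thesis .
  qed
qed

text \<open>Joint generalised eigenspaces of \<open>ad h\<close>. That \<open>\<alpha>\<close> is linear on \<open>h\<close> is derived from traces once
  the space is known to be nonzero.\<close>

definition wt :: "('a \<Rightarrow> complex) \<Rightarrow> 'a set" where
  "wt \<alpha> = {x\<in>L. \<forall>H\<in>h. \<exists>N. (shifted H (\<alpha> H) ^^ N) x = 0}"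

lemma wt_L: "wt \<alpha> \<subseteq> L" by (auto simp: wt_def)

lemma hL': "H \<in> h \<Longrightarrow> H \<in> L" using hL by blast

lemma wt_subspace: "cvs.subspace (wt \<alpha>)"
proof (rule cvs.subspaceI)
  show "0 \<in> wt \<alpha>" by (auto simp: wt_def cvs.subspace_0[OF subL] intro!: exI[of _ 0])
  show "x + y \<in> wt \<alpha>" if xy: "x \<in> wt \<alpha>" "y \<in> wt \<alpha>" for x y
    unfolding wt_def
  proof (intro CollectI conjI ballI)
    show "x + y \<in> L" using xy subL cvs.subspace_add by (auto simp: wt_def)
    fix H assume "H \<in> h"
    then obtain M N where MN: "(shifted H (\<alpha> H) ^^ M) x = 0" "(shifted H (\<alpha> H) ^^ N) y = 0"
      using xy unfolding wt_def by blast
    have "(shifted H (\<alpha> H) ^^ (N + M)) x = 0" by (simp add: funpow_add_apply MN shifted_pow_simps)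
    moreover have "(shifted H (\<alpha> H) ^^ (M + N)) y = 0" by (simp only: funpow_add_apply MN shifted_pow_simps)
    ultimately show "\<exists>N. (shifted H (\<alpha> H) ^^ N) (x + y) = 0"
      by (intro exI[of _ "N + M"]) (simp add: shifted_pow_simps add.commute)
  qed
  show "c *\<^sub>C x \<in> wt \<alpha>" if x: "x \<in> wt \<alpha>" for c x
    unfolding wt_def
  proof (intro CollectI conjI ballI)
    show "c *\<^sub>C x \<in> L" using x subL cvs.subspace_scale by (auto simp: wt_def)
    fix H assume "H \<in> h"
    then obtain N where "(shifted H (\<alpha> H) ^^ N) x = 0" using x by (auto simp: wt_def)
    then show "\<exists>N. (shifted H (\<alpha> H) ^^ N) (c *\<^sub>C x) = 0"
      by (intro exI[of _ N]) (simp add: shifted_pow_simps)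
  qed
qed

lemma wt_fdim: "fdim (wt \<alpha>)" by (rule fdim_subset[OF fdL wt_L])

lemma wt_bracket: "x \<in> wt \<alpha> \<Longrightarrow> y \<in> wt \<beta> \<Longrightarrow> br x y \<in> wt (\<lambda>H. \<alpha> H + \<beta> H)"
  unfolding wt_def using closed hL' by (auto, metis shifted_pow_bracket hL')

lemma h_wt_0: "h \<subseteq> wt (\<lambda>_. 0)"
  using h_nil hL by (auto simp: wt_def shifted_0)

lemma wt_h_stable: "H \<in> h \<Longrightarrow> x \<in> wt \<alpha> \<Longrightarrow> br H x \<in> wt \<alpha>"
  using wt_bracket[of H "\<lambda>_. 0" x \<alpha>] h_wt_0 by auto

text \<open>Functionals on \<open>h\<close> are extended by \<open>0\<close>, so that different weights differ at a point of \<open>h\<close>;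
  this is what makes their weight spaces independent.\<close>

definition ext :: "('a \<Rightarrow> complex) set" where
  "ext = {\<alpha>. \<forall>H. H \<notin> h \<longrightarrow> \<alpha> H = 0}"

text \<open>Moving \<open>y\<close> past one factor of the power produces a bracket of \<open>H\<close> with \<open>y\<close>, and after \<open>c\<close>
  brackets nothing is left.\<close>

lemma shifted_pow_image_stable:
  assumes W: "cvs.subspace W" "W \<subseteq> L" "\<And>H x. H \<in> h \<Longrightarrow> x \<in> W \<Longrightarrow> br H x \<in> W" and H: "H \<in> h"
    and y: "y \<in> h" "(br H ^^ c) y = 0" and w: "w \<in> W"
  shows "br y ((shifted H a ^^ (m + c)) w) \<in> (shifted H a ^^ m) ` W"
  using y
proof (induction "m + c" arbitrary: m c y)
  case 0
  then show ?case using w by (auto simp: br_left cvs.subspace_0[OF W(1)])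
next
  case (Suc k)
  let ?S = "shifted H a"
  have SW: "?S x \<in> W" if "x \<in> W" for x by (rule shifted_mem[OF W(1) W(3)[OF H] that])
  have powW: "(?S ^^ j) w \<in> W" for j by (rule funpow_stable[OF SW w])
  have sub: "cvs.subspace ((?S ^^ j) ` W)" for j
    by (rule clinear_image_subspace[OF clinear_funpow[OF clinear_shifted] W(1)])
  show ?case
  proof (cases m)
    case 0
    then show ?thesis using W(3)[OF Suc.prems(1) powW] by simp
  next
    case m: (Suc m')
    show ?thesis
    proof (cases c)
      case 0
      then show ?thesis using Suc.prems cvs.subspace_0[OF sub] by (simp add: br_left)
    next
      case c: (Suc c')
      define u where "u = (?S ^^ (m' + c)) w"
      have uL: "u \<in> L" using powW W(2) by (auto simp: u_def)
      have Su: "(?S ^^ (m + c)) w = ?S u" by (simp add: u_def m)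
      have "br y u \<in> (?S ^^ m') ` W" unfolding u_def using Suc.hyps(2) Suc.prems m by (intro Suc.hyps(1)) auto
      then have 1: "?S (br y u) \<in> (?S ^^ m) ` W" unfolding m funpow_image_Suc by blast
      have "br (br H y) ((?S ^^ (m + c')) w) \<in> (?S ^^ m) ` W"
        using Suc.hyps(2) Suc.prems c H h_closed by (intro Suc.hyps(1)) (auto simp: funpow_swap1)
      then have 2: "br (br H y) u \<in> (?S ^^ m) ` W" by (simp add: u_def m c)
      have "br y (?S u) = ?S (br y u) - br (br H y) u"
        using jacobi[OF hL'[OF H] hL'[OF Suc.prems(1)] uL] by (simp add: shifted_def br_right)
      then show ?thesis unfolding Su using cvs.subspace_diff[OF sub 1 2] by simp
    qed
  qed
qed

text \<open>If some \<open>H\<close> in \<open>h\<close> has more than one eigenvalue on \<open>W\<close>, the two Fitting components of \<open>W\<close> for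
  one of them are proper and, as \<open>h\<close> is nilpotent, stable under \<open>h\<close>; otherwise \<open>W\<close> lies in a single
  weight space.\<close>

lemma weight_decomposition:
  assumes "cvs.subspace W" "W \<subseteq> L" "\<And>H x. H \<in> h \<Longrightarrow> x \<in> W \<Longrightarrow> br H x \<in> W"
  shows "W \<subseteq> cvs.span (\<Union>\<alpha>\<in>ext. W \<inter> wt \<alpha>)"
  using assms
proof (induction "cvs.dim W" arbitrary: W rule: less_induct)
  case less
  have fdW: "fdim W" by (rule fdim_subset[OF fdL less.prems(2)])
  have SW: "shifted H c x \<in> W" if "H \<in> h" "x \<in> W" for H c x
    by (rule shifted_mem[OF less.prems(1) less.prems(3)[OF that(1)] that(2)])
  show ?case
  proof (cases "\<forall>H\<in>h. \<exists>c n. \<forall>x\<in>W. (shifted H c ^^ n) x = 0")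
    case True
    then obtain c where c: "\<And>H. H \<in> h \<Longrightarrow> \<exists>n. \<forall>x\<in>W. (shifted H (c H) ^^ n) x = 0" by metis
    define \<alpha> where "\<alpha> H = (if H \<in> h then c H else 0)" for H
    have "\<alpha> \<in> ext" by (simp add: ext_def \<alpha>_def)
    moreover have "W \<subseteq> wt \<alpha>" using c less.prems(2) by (fastforce simp: wt_def \<alpha>_def)
    ultimately show ?thesis by (blast intro: cvs.span_base)
  next
    case False
    then obtain H where H: "H \<in> h" "\<nexists>c n. \<forall>x\<in>W. (shifted H c ^^ n) x = 0" by blast
    have "W \<noteq> {0}"
    proof
      assume "W = {0}"
      then have "\<forall>x\<in>W. (shifted H 0 ^^ 0) x = 0" by simp
      then show False using H(2) by blast
    qed
    then obtain c v where v: "v \<in> W" "v \<noteq> 0" "br H v = c *\<^sub>C v"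
      using eigenvector_exists[OF lin_right fdW less.prems(1)] less.prems(3)[OF H(1)] by metis
    define S where "S = shifted H c"
    have linS: "clinear S" unfolding S_def by (rule clinear_shifted)
    obtain n where n: "S ` ((S ^^ n) ` W) = (S ^^ n) ` W"
      "\<And>v. v \<in> (S ^^ n) ` W \<Longrightarrow> S v = 0 \<Longrightarrow> v = 0"
      "\<And>w. w \<in> W \<Longrightarrow> \<exists>u\<in>W. \<exists>v\<in>(S ^^ n) ` W. w = u + v \<and> (S ^^ n) u = 0"
      by (rule fitting[OF linS fdW less.prems(1)]) (use SW H(1) in \<open>auto simp: S_def\<close>)
    define R where "R = (S ^^ n) ` W"
    define K where "K = {x\<in>W. (S ^^ n) x = 0}"
    have subR: "cvs.subspace R" unfolding R_def by (intro clinear_image_subspace clinear_funpow linS less.prems(1))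
    have subK: "cvs.subspace K" unfolding K_def by (intro clinear_kernel_subspace clinear_funpow linS less.prems(1))
    have RW: "R \<subseteq> W" unfolding R_def by (rule funpow_image_stable) (use SW H(1) in \<open>auto simp: S_def\<close>)
    have KW: "K \<subseteq> W" by (auto simp: K_def)
    have Rpow: "(S ^^ m) ` R = R" for m
    proof (induction m)
      case (Suc m)
      show ?case unfolding funpow_image_Suc Suc using n(1) by (simp add: R_def)
    qed simp
    have Rinj: "v = 0" if "v \<in> R" "(S ^^ m) v = 0" for v m
      using that
    proof (induction m arbitrary: v)
      case (Suc m)
      have "S v \<in> R" using Suc.prems(1) n(1) by (auto simp: R_def)
      then have "S v = 0" using Suc by (simp add: funpow_swap1)
      then show ?case using n(2) Suc.prems(1) by (simp add: R_def)
    qed simp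
    have nil: "\<exists>d. (br H ^^ d) y = 0" if "y \<in> h" for y using h_nil H(1) that by blast
    have Rstab: "br y x \<in> R" if y: "y \<in> h" and x: "x \<in> R" for y x
    proof -
      obtain d where d: "(br H ^^ d) y = 0" using nil[OF y] by blast
      have "R = (S ^^ d) ` R" using Rpow by simp
      also have "\<dots> = (S ^^ (n + d)) ` W"
        unfolding R_def image_image by (simp only: funpow_add_apply[symmetric] add.commute[of d n])
      finally obtain w where w: "w \<in> W" "x = (S ^^ (n + d)) w" using x by blast
      show ?thesis unfolding w(2) R_def S_def
        by (rule shifted_pow_image_stable[OF less.prems H(1) y d w(1)])
    qed
    have Kstab: "br y x \<in> K" if y: "y \<in> h" and x: "x \<in> K" for y x
    proof -
      obtain d where d: "(br H ^^ d) y = 0" using nil[OF y] by blast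
      have "(shifted H (0 + c) ^^ (n + d)) (br y x) = 0"
        using d x less.prems(2) H(1) y hL' by (intro shifted_pow_bracket) (auto simp: shifted_0 K_def S_def)
      then have "(S ^^ d) ((S ^^ n) (br y x)) = 0" by (simp add: S_def funpow_add_apply[symmetric] add.commute)
      moreover have brW: "br y x \<in> W" using less.prems(3)[OF y] x KW by auto
      then have "(S ^^ n) (br y x) \<in> R" unfolding R_def by (rule imageI)
      ultimately have "(S ^^ n) (br y x) = 0" using Rinj by metis
      then show ?thesis using brW by (simp add: K_def)
    qed
    have "K \<noteq> W" using H(2) by (auto simp: K_def S_def)
    then have "cvs.dim K < cvs.dim W" using KW by (intro dim_strict_mono fdW subK less.prems(1)) auto
    then have Kspan: "K \<subseteq> cvs.span (\<Union>\<alpha>\<in>ext. K \<inter> wt \<alpha>)"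
      using KW less.prems(2) by (intro less.hyps subK Kstab) auto
    have "v \<notin> R" using n(2)[of v] v by (auto simp: R_def S_def shifted_def)
    then have "cvs.dim R < cvs.dim W" using RW v(1) by (intro dim_strict_mono fdW subR less.prems(1)) auto
    then have Rspan: "R \<subseteq> cvs.span (\<Union>\<alpha>\<in>ext. R \<inter> wt \<alpha>)"
      using RW less.prems(2) by (intro less.hyps subR Rstab) auto
    have "cvs.span (\<Union>\<alpha>\<in>ext. K \<inter> wt \<alpha>) \<subseteq> cvs.span (\<Union>\<alpha>\<in>ext. W \<inter> wt \<alpha>)"
      "cvs.span (\<Union>\<alpha>\<in>ext. R \<inter> wt \<alpha>) \<subseteq> cvs.span (\<Union>\<alpha>\<in>ext. W \<inter> wt \<alpha>)"
      using KW RW by (intro cvs.span_mono; blast)+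
    then have KR: "K \<subseteq> cvs.span (\<Union>\<alpha>\<in>ext. W \<inter> wt \<alpha>)" "R \<subseteq> cvs.span (\<Union>\<alpha>\<in>ext. W \<inter> wt \<alpha>)"
      using Kspan Rspan by blast+
    show ?thesis
    proof
      fix w assume "w \<in> W"
      then obtain u v where uv: "u \<in> W" "v \<in> R" "w = u + v" "(S ^^ n) u = 0"
        using n(3) unfolding R_def by blast
      then have "u \<in> K" by (simp add: K_def)
      then show "w \<in> cvs.span (\<Union>\<alpha>\<in>ext. W \<inter> wt \<alpha>)"
        unfolding uv(3) using uv(2) KR by (intro cvs.span_add) auto
    qed
  qed
qed

text \<open>A power of \<open>ad H - \<beta> H\<close> kills the component in the weight space of \<open>\<beta>\<close> and is injective on the
  one of \<open>\<alpha>\<close> whenever \<open>\<alpha> H \<noteq> \<beta> H\<close>.\<close>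

lemma wt_independent: "finite A \<Longrightarrow> A \<subseteq> ext \<Longrightarrow> independent_spaces A wt"
proof (induction A rule: finite_induct)
  case (insert \<beta> A)
  show ?case unfolding independent_spaces_def
  proof (intro allI impI)
    fix v assume v: "(\<forall>\<alpha>\<in>insert \<beta> A. v \<alpha> \<in> wt \<alpha>) \<and> sum v (insert \<beta> A) = 0"
    have A0: "v \<alpha> = 0" if \<alpha>: "\<alpha> \<in> A" for \<alpha>
    proof -
      have "\<alpha> \<noteq> \<beta>" using \<alpha> insert.hyps by blast
      then obtain H where "\<alpha> H \<noteq> \<beta> H" by blast
      moreover have "\<alpha> \<in> ext" "\<beta> \<in> ext" using \<alpha> insert.prems by auto
      ultimately have H: "H \<in> h" "\<alpha> H \<noteq> \<beta> H" by (metis (mono_tags, lifting) ext_def mem_Collect_eq, blast)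
      obtain N where N: "(shifted H (\<beta> H) ^^ N) (v \<beta>) = 0" using v H by (auto simp: wt_def)
      let ?T = "shifted H (\<beta> H) ^^ N"
      have "?T (sum v (insert \<beta> A)) = 0" using v by (simp add: shifted_pow_simps)
      then have "(\<Sum>\<gamma>\<in>A. ?T (v \<gamma>)) = 0" using insert.hyps N by (simp add: shifted_pow_simps)
      moreover have "\<forall>\<gamma>\<in>A. ?T (v \<gamma>) \<in> wt \<gamma>"
      proof
        fix \<gamma> assume "\<gamma> \<in> A"
        then have "v \<gamma> \<in> wt \<gamma>" using v by blast
        then show "?T (v \<gamma>) \<in> wt \<gamma>"
          by (rule funpow_stable[rotated]) (rule shifted_mem[OF wt_subspace wt_h_stable[OF H(1)]])
      qed
      ultimately have T0: "?T (v \<alpha>) = 0"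
        using insert.IH insert.prems \<alpha> unfolding independent_spaces_def
        by (metis (no_types, lifting) insert_subset)
      have inj: "x = 0" if x: "x \<in> wt \<alpha>" "shifted H (\<beta> H) x = 0" for x
      proof -
        obtain M where "(shifted H (\<alpha> H) ^^ M) x = 0" using x H by (auto simp: wt_def)
        moreover have "shifted H (\<alpha> H) x = (\<beta> H - \<alpha> H) *\<^sub>C x"
          using x(2) by (simp add: shifted_def cvs.scale_left_diff_distrib)
        ultimately show ?thesis
          using funpow_eigen_zero[OF clinear_shifted, of H "\<alpha> H" x "\<beta> H - \<alpha> H" M] H(2) by simp
      qed
      have "x = 0" if "x \<in> wt \<alpha>" "(shifted H (\<beta> H) ^^ M) x = 0" for x M
        using that
      proof (induction M arbitrary: x)
        case (Suc M)
        have "shifted H (\<beta> H) x = 0"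
        proof (rule Suc.IH)
          show "shifted H (\<beta> H) x \<in> wt \<alpha>"
            by (rule shifted_mem[OF wt_subspace wt_h_stable[OF H(1)] Suc.prems(1)])
          show "(shifted H (\<beta> H) ^^ M) (shifted H (\<beta> H) x) = 0"
            using Suc.prems(2) by (simp only: funpow_Suc_right comp_apply)
        qed
        then show ?case by (rule inj[OF Suc.prems(1)])
      qed simp
      then show ?thesis using T0 v \<alpha> by blast
    qed
    then have "sum v (insert \<beta> A) = v \<beta>" using insert.hyps by simp
    then show "\<forall>\<alpha>\<in>insert \<beta> A. v \<alpha> = 0" using v A0 by simp
  qed
qed (simp add: independent_spaces_def)

definition weights :: "('a \<Rightarrow> complex) set" where
  "weights = {\<alpha>\<in>ext. wt \<alpha> \<noteq> {0}}"

lemma weights_ext: "weights \<subseteq> ext" by (auto simp: weights_def)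

lemma finite_weights: "finite weights"
proof (rule ccontr)
  assume "infinite weights"
  then obtain A where A: "finite A" "card A = Suc (cvs.dim L)" "A \<subseteq> weights"
    using infinite_arbitrarily_large by blast
  have "\<exists>x. x \<in> wt \<alpha> \<and> x \<noteq> 0" if "\<alpha> \<in> A" for \<alpha>
    using that A(3) cvs.subspace_0[OF wt_subspace[of \<alpha>]] by (auto simp: weights_def)
  then obtain v where v: "\<And>\<alpha>. \<alpha> \<in> A \<Longrightarrow> v \<alpha> \<in> wt \<alpha> \<and> v \<alpha> \<noteq> 0" by metis
  have ind: "independent_spaces A wt" using wt_independent A weights_ext by blast
  have "card A \<le> cvs.dim L"
    by (rule independent_spaces_card_le[OF A(1) ind wt_subspace, of v]) (use v wt_L fdL subL in auto)
  then show False using A(2) by simp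
qed

lemma span_weights: "cvs.span (\<Union>\<alpha>\<in>weights. wt \<alpha>) = L"
proof
  show "cvs.span (\<Union>\<alpha>\<in>weights. wt \<alpha>) \<subseteq> L" using wt_L by (intro cvs.span_minimal subL) blast
  have "L \<subseteq> cvs.span (\<Union>\<alpha>\<in>ext. L \<inter> wt \<alpha>)"
    by (rule weight_decomposition[OF subL]) (use closed hL in auto)
  also have "\<dots> \<subseteq> cvs.span (\<Union>\<alpha>\<in>weights. wt \<alpha>)"
  proof (rule cvs.span_minimal)
    show "(\<Union>\<alpha>\<in>ext. L \<inter> wt \<alpha>) \<subseteq> cvs.span (\<Union>\<alpha>\<in>weights. wt \<alpha>)"
    proof
      fix x assume "x \<in> (\<Union>\<alpha>\<in>ext. L \<inter> wt \<alpha>)"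
      then obtain \<alpha> where \<alpha>: "\<alpha> \<in> ext" "x \<in> wt \<alpha>" by blast
      show "x \<in> cvs.span (\<Union>\<alpha>\<in>weights. wt \<alpha>)"
      proof (cases "x = 0")
        case False
        then have "\<alpha> \<in> weights" using \<alpha> by (auto simp: weights_def)
        then show ?thesis using \<alpha> by (blast intro: cvs.span_base)
      qed (simp add: cvs.span_zero)
    qed
  qed simp
  finally show "L \<subseteq> cvs.span (\<Union>\<alpha>\<in>weights. wt \<alpha>)" .
qed

lemma weights_independent: "A \<subseteq> weights \<Longrightarrow> independent_spaces A wt"
  using wt_independent finite_weights finite_subset weights_ext by (metis order_trans)

lemma trace_weights:
  assumes "clinear A" "\<And>\<alpha> x. \<alpha> \<in> weights \<Longrightarrow> x \<in> wt \<alpha> \<Longrightarrow> A x \<in> wt \<alpha>"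
  shows "trace_on L A = (\<Sum>\<alpha>\<in>weights. trace_on (wt \<alpha>) A)"
  using trace_on_direct_sum[OF finite_weights assms(1) wt_fdim wt_subspace assms(2) weights_independent]
  by (simp add: span_weights)

definition mult :: "('a \<Rightarrow> complex) \<Rightarrow> nat" where "mult \<alpha> = cvs.dim (wt \<alpha>)"

lemma mult_pos: "\<alpha> \<in> weights \<Longrightarrow> mult \<alpha> > 0"
proof -
  assume "\<alpha> \<in> weights"
  then have "{0} \<subset> wt \<alpha>" using cvs.subspace_0[OF wt_subspace[of \<alpha>]] by (auto simp: weights_def)
  then have "cvs.dim {0::'a} < mult \<alpha>"
    unfolding mult_def by (intro dim_strict_mono wt_fdim wt_subspace) auto
  then show ?thesis by simp
qed

lemma wt_fd_space: "fd_space (wt \<alpha>)"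
  by unfold_locales (rule wt_fdim, rule wt_subspace)

lemma op_on_wt: "H \<in> h \<Longrightarrow> fd_space.op_on (wt \<alpha>) (br H)"
  by (intro fd_space.op_onI[OF wt_fd_space] lin_right wt_h_stable)

lemma shifted_trace: "H \<in> h \<Longrightarrow> trace_on (wt \<alpha>) (shifted H (\<alpha> H)) = 0"
proof -
  assume H: "H \<in> h"
  obtain N where "\<forall>x\<in>wt \<alpha>. (shifted H (\<alpha> H) ^^ N) x = 0"
    using locally_nilpotent_uniform[OF clinear_shifted wt_fdim wt_subspace, of \<alpha> H "\<alpha> H"] H by (auto simp: wt_def)
  then show ?thesis
    by (intro trace_on_nilpotent[OF wt_fdim wt_subspace clinear_shifted, of _ _ _ N]
        shifted_mem[OF wt_subspace wt_h_stable[OF H]]) auto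
qed

lemma weight_trace: "H \<in> h \<Longrightarrow> trace_on (wt \<alpha>) (br H) = \<alpha> H * of_nat (mult \<alpha>)"
proof -
  assume H: "H \<in> h"
  interpret S: fd_space "wt \<alpha>" by (rule wt_fd_space)
  have id: "S.op_on (\<lambda>x. \<alpha> H *\<^sub>C x)" by (rule S.op_on_scale[OF S.op_on_ident])
  have "trace_on (wt \<alpha>) (\<lambda>x. br H x - \<alpha> H *\<^sub>C x) = trace_on (wt \<alpha>) (br H) - trace_on (wt \<alpha>) (\<lambda>x. \<alpha> H *\<^sub>C x)"
    by (rule S.trace_diff[OF op_on_wt[OF H] id])
  moreover have "trace_on (wt \<alpha>) (\<lambda>x. \<alpha> H *\<^sub>C x) = \<alpha> H * of_nat (mult \<alpha>)"
    unfolding mult_def by (rule S.trace_scalar) simp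
  ultimately show ?thesis using shifted_trace[OF H, of \<alpha>] by (simp add: shifted_def)
qed

text \<open>A weight is a trace divided by a dimension, hence linear on \<open>h\<close>.\<close>

lemma weight_unique:
  assumes "\<alpha> \<in> weights" "H \<in> h" "trace_on (wt \<alpha>) (br H) = c * of_nat (mult \<alpha>)" shows "\<alpha> H = c"
  using weight_trace[OF assms(2), of \<alpha>] assms(3) mult_pos[OF assms(1)] by simp

lemma weight_add:
  assumes "\<alpha> \<in> weights" "H \<in> h" "K \<in> h" shows "\<alpha> (H + K) = \<alpha> H + \<alpha> K"
proof (rule weight_unique[OF assms(1)])
  interpret S: fd_space "wt \<alpha>" by (rule wt_fd_space)
  show "H + K \<in> h" using assms subh cvs.subspace_add by blast
  have "br (H + K) = (\<lambda>x. br H x + br K x)" by (rule HOL.ext) (simp add: br_left)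
  then show "trace_on (wt \<alpha>) (br (H + K)) = (\<alpha> H + \<alpha> K) * of_nat (mult \<alpha>)"
    using S.trace_add[OF op_on_wt[OF assms(2)] op_on_wt[OF assms(3)]]
    by (simp add: weight_trace assms(2,3) algebra_simps)
qed

lemma weight_scale:
  assumes "\<alpha> \<in> weights" "H \<in> h" shows "\<alpha> (c *\<^sub>C H) = c * \<alpha> H"
proof (rule weight_unique[OF assms(1)])
  interpret S: fd_space "wt \<alpha>" by (rule wt_fd_space)
  show "c *\<^sub>C H \<in> h" using assms subh cvs.subspace_scale by blast
  have "br (c *\<^sub>C H) = (\<lambda>x. c *\<^sub>C br H x)" by (rule HOL.ext) (simp add: br_left)
  then show "trace_on (wt \<alpha>) (br (c *\<^sub>C H)) = (c * \<alpha> H) * of_nat (mult \<alpha>)"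
    using S.trace_scale[OF op_on_wt[OF assms(2)]] by (simp add: weight_trace assms(2))
qed

text \<open>By Engel's theorem for \<open>h\<close> acting on its zero weight space, a larger zero weight space would
  contain a vector outside \<open>h\<close> that normalises \<open>h\<close>.\<close>

lemma wt_0: "wt (\<lambda>_. 0) = h"
proof
  let ?Z = "wt (\<lambda>_. 0)"
  interpret Z: fd_lie g ?Z
  proof (rule fd_lie.intro)
    show "br x y \<in> ?Z" if "x \<in> ?Z" "y \<in> ?Z" for x y using wt_bracket[OF that] by simp
    show "br x y = - br y x" if "x \<in> ?Z" "y \<in> ?Z" for x y using antisym that wt_L by blast
    show "br x (br y z) = br (br x y) z + br y (br x z)" if "x \<in> ?Z" "y \<in> ?Z" "z \<in> ?Z" for x y z
      using jacobi that wt_L by blast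
    show "clinear (br x)" "clinear (\<lambda>x. br x y)" for x y by (rule lin_right, rule lin_left)
  qed (rule wt_fdim wt_subspace)+
  have "\<exists>m. (Z.act_span h ^^ m) ?Z \<subseteq> {0}"
  proof (rule Z.engel_jacobson[OF h_wt_0 h_closed])
    fix H assume H: "H \<in> h"
    show "\<exists>n. \<forall>v\<in>?Z. (br H ^^ n) v = 0"
      by (rule locally_nilpotent_uniform[OF lin_right wt_fdim wt_subspace]) (use H in \<open>auto simp: wt_def shifted_0\<close>)
  qed
  then have ex: "\<exists>m. (Z.act_span h ^^ m) ?Z \<subseteq> h" using cvs.subspace_0[OF subh] by blast
  define m where "m = (LEAST m. (Z.act_span h ^^ m) ?Z \<subseteq> h)"
  have m: "(Z.act_span h ^^ m) ?Z \<subseteq> h" unfolding m_def by (rule LeastI_ex[OF ex])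
  show "?Z \<subseteq> h"
  proof (cases m)
    case 0
    then show ?thesis using m by simp
  next
    case (Suc m')
    then have "\<not> (Z.act_span h ^^ m') ?Z \<subseteq> h" using not_less_Least[of m' "\<lambda>m. (Z.act_span h ^^ m) ?Z \<subseteq> h"]
      by (simp add: m_def)
    then obtain v where v: "v \<in> (Z.act_span h ^^ m') ?Z" "v \<notin> h" by blast
    have vL: "v \<in> L" using v(1) Z.act_span_pow_subset[OF h_wt_0] wt_L by blast
    have "br v H \<in> h" if "H \<in> h" for H
    proof -
      have "br H v \<in> h" using Z.act_spanI[OF that v(1)] m Suc by auto
      then show ?thesis using antisym[OF vL hL'[OF that]] cvs.subspace_neg[OF subh] by simp
    qed
    then have "v \<in> h" by (rule self_normalizing[OF vL])
    then show ?thesis using v by blast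
  qed
qed (rule h_wt_0)

end

section \<open>Dual bases and operators with prescribed eigenvalues\<close>

text \<open>The operator \<open>T x = \<Sum>c. F x c *\<^sub>C c\<close> on the space spanned by \<open>B\<close> is injective by
  nondegeneracy, hence surjective; preimages of the vectors of \<open>B\<close> form the dual basis.\<close>

lemma dual_basis_exists:
  fixes F :: "'a::complex_vector \<Rightarrow> 'a \<Rightarrow> complex"
  assumes B: "finite B" "cvs.independent B" "cvs.span B = S"
    and add_l: "\<And>x y z. x \<in> S \<Longrightarrow> y \<in> S \<Longrightarrow> z \<in> S \<Longrightarrow> F (x + y) z = F x z + F y z"
    and scale_l: "\<And>c x z. x \<in> S \<Longrightarrow> z \<in> S \<Longrightarrow> F (c *\<^sub>C x) z = c * F x z"
    and add_r: "\<And>x y z. x \<in> S \<Longrightarrow> y \<in> S \<Longrightarrow> z \<in> S \<Longrightarrow> F z (x + y) = F z x + F z y"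
    and scale_r: "\<And>c x z. x \<in> S \<Longrightarrow> z \<in> S \<Longrightarrow> F z (c *\<^sub>C x) = c * F z x"
    and nondeg: "\<And>x. x \<in> S \<Longrightarrow> (\<And>y. y \<in> S \<Longrightarrow> F x y = 0) \<Longrightarrow> x = 0"
  obtains d where "\<And>b. b \<in> B \<Longrightarrow> d b \<in> S" "\<And>b c. b \<in> B \<Longrightarrow> c \<in> B \<Longrightarrow> F (d b) c = (if b = c then 1 else 0)"
proof -
  have subS: "cvs.subspace S" using B(3) by (metis cvs.subspace_span)
  have BS: "b \<in> S" if "b \<in> B" for b using that B(3) cvs.span_base by blast
  have zero_l: "F 0 z = 0" if "z \<in> S" for z using scale_l[OF that that, of 0] by simp
  have zero_r: "F z 0 = 0" if "z \<in> S" for z using scale_r[OF that that, of 0] by simp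
  obtain T :: "'a \<Rightarrow> 'a" where T: "clinear T" "\<forall>x\<in>B. T x = (\<Sum>c\<in>B. F x c *\<^sub>C c)"
    using cvp.linear_independent_extend[OF B(2), of "\<lambda>x. \<Sum>c\<in>B. F x c *\<^sub>C c"] by blast
  have TS: "T x = (\<Sum>c\<in>B. F x c *\<^sub>C c)" if "x \<in> S" for x
  proof -
    have "x \<in> cvs.span B" using that B(3) by simp
    then have "x \<in> S \<and> T x = (\<Sum>c\<in>B. F x c *\<^sub>C c)"
    proof (induction rule: cvs.span_induct_alt)
      case base
      show ?case using subS BS by (simp add: cvs.subspace_0 clinear_simps[OF T(1)] zero_l)
    next
      case (step c x y)
      have "T (c *\<^sub>C x + y) = (\<Sum>b\<in>B. (c * F x b + F y b) *\<^sub>C b)"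
        using step T by (simp add: clinear_simps cvs.scale_left_distrib sum.distrib cvs.scale_sum_right)
      moreover have "F (c *\<^sub>C x + y) b = c * F x b + F y b" if "b \<in> B" for b
        using step BS that subS by (simp add: add_l scale_l cvs.subspace_scale)
      ultimately show ?case using step BS subS by (simp add: cvs.subspace_add cvs.subspace_scale)
    qed
    then show ?thesis by simp
  qed
  have coeff: "f b = g b" if "(\<Sum>c\<in>B. f c *\<^sub>C c) = (\<Sum>c\<in>B. g c *\<^sub>C c)" "b \<in> B" for f g b
  proof -
    have "(\<Sum>c\<in>B. (f c - g c) *\<^sub>C c) = 0" using that(1) by (simp add: cvs.scale_left_diff_distrib sum_subtractf)
    then show ?thesis using cvs.independentD[OF B(2) B(1) order_refl _ that(2)] by fastforce
  qed
  have "T ` S = S"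
  proof (rule injective_imp_surjective_on[OF T(1) _ subS])
    show "fdim S" unfolding fdim_def using B by blast
    show "T ` S \<subseteq> S" using TS BS subS by (auto intro!: cvs.subspace_sum cvs.subspace_scale)
    fix x assume x: "x \<in> S" "T x = 0"
    have xb: "F x b = 0" if "b \<in> B" for b
      using coeff[of "F x" "\<lambda>_. 0" b] TS[OF x(1)] x(2) that by simp
    show "x = 0"
    proof (rule nondeg[OF x(1)])
      fix y assume "y \<in> S"
      then have "y \<in> cvs.span B" using B(3) by simp
      then have "y \<in> S \<and> F x y = 0"
        by (induction rule: cvs.span_induct_alt)
           (use x subS BS xb in \<open>simp_all add: zero_r cvs.subspace_0 add_r scale_r cvs.subspace_scale cvs.subspace_add\<close>)
      then show "F x y = 0" by simp
    qed
  qed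
  then have "\<forall>b\<in>B. \<exists>x\<in>S. T x = b" using BS by (metis imageE)
  then obtain d where d: "\<And>b. b \<in> B \<Longrightarrow> d b \<in> S \<and> T (d b) = b" by metis
  have "F (d b) c = (if b = c then 1 else 0)" if "b \<in> B" "c \<in> B" for b c
  proof -
    have "(\<Sum>e\<in>B. F (d b) e *\<^sub>C e) = b" using TS d[OF that(1)] by metis
    also have "b = (\<Sum>e\<in>B. (if b = e then 1 else 0) *\<^sub>C e)"
      using B(1) that(1) by (simp add: if_distrib[of "\<lambda>c. c *\<^sub>C _"] scaleC_one cong: if_cong)
    finally show ?thesis using that(2) by (rule coeff)
  qed
  then show ?thesis using that d by blast
qed

text \<open>Supplies the semisimple part of \<open>ad H\<close> as an operator defined on the whole space.\<close>

lemma operator_with_eigenspaces: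
  fixes W :: "'i \<Rightarrow> 'a::complex_vector set"
  assumes "finite I" "\<And>i. i \<in> I \<Longrightarrow> fdim (W i)" "\<And>i. i \<in> I \<Longrightarrow> cvs.subspace (W i)" "independent_spaces I W"
  obtains S where "clinear S" "\<And>i v. i \<in> I \<Longrightarrow> v \<in> W i \<Longrightarrow> S v = c i *\<^sub>C v"
proof -
  have "\<exists>S. clinear S \<and> (\<forall>i\<in>I. \<forall>v\<in>W i. S v = c i *\<^sub>C v)"
    using assms
  proof (induction I rule: finite_induct)
    case empty
    have "clinear (\<lambda>x::'a. x)" by (rule clinearI) simp_all
    then show ?case by blast
  next
    case (insert i I)
    let ?U = "cvs.span (\<Union>j\<in>I. W j)"
    have ind: "independent_spaces I W" "W i \<inter> ?U = {0}"
      using independent_spaces_insert[OF insert.hyps insert.prems(3)] insert.prems(2) by blast+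
    obtain S where S: "clinear S" "\<forall>j\<in>I. \<forall>v\<in>W j. S v = c j *\<^sub>C v"
      using insert.IH insert.prems ind(1) by blast
    have fdU: "fdim ?U" by (rule fdim_span_Union) (use insert in auto)
    obtain B where B: "finite B" "cvs.independent B" "cvs.span B = ?U" "card B = cvs.dim ?U"
      by (rule fdim_basis[OF fdU]) simp
    obtain C where C: "finite C" "cvs.independent C" "cvs.span C = W i" "card C = cvs.dim (W i)"
      using fdim_basis[of "W i"] insert.prems by blast
    have BC: "cvs.independent (B \<union> C)" "B \<inter> C = {}"
      using independent_Un[OF C(1) B(2) C(2)] B(3) C(3) ind(2) by auto
    obtain R :: "'a \<Rightarrow> 'a" where R: "clinear R" "\<forall>x\<in>B \<union> C. R x = (if x \<in> B then S x else c i *\<^sub>C x)"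
      using cvp.linear_independent_extend[OF BC(1), of "\<lambda>x. if x \<in> B then S x else c i *\<^sub>C x"] by blast
    have sc: "clinear (\<lambda>x::'a. c i *\<^sub>C x)" by (intro clinearI) (simp_all add: cvs.scale_right_distrib mult.commute)
    have "R v = S v" if "v \<in> ?U" for v
      by (rule cvp.linear_eq_on[OF R(1) S(1), of _ B]) (use that B(3) R(2) in auto)
    moreover have "R v = c i *\<^sub>C v" if "v \<in> W i" for v
      by (rule cvp.linear_eq_on[OF R(1) sc, of _ C]) (use that C(3) R(2) BC(2) in auto)
    moreover have "v \<in> ?U" if "j \<in> I" "v \<in> W j" for j v using that by (blast intro: cvs.span_base)
    ultimately have "\<forall>j\<in>insert i I. \<forall>v\<in>W j. R v = c j *\<^sub>C v" using S(2) by auto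
    then show ?case using R(1) by blast
  qed
  then show ?thesis using that by blast
qed

section \<open>The trace form of the adjoint representation\<close>

context cartan_pair
begin

lemma fd_space_L: "fd_space L"
  by unfold_locales (rule fdL, rule subL)

sublocale SL: fd_space L by (rule fd_space_L)

lemma op_br: "x \<in> L \<Longrightarrow> SL.op_on (br x)"
  by (intro SL.op_onI lin_right closed)

definition kil :: "'a \<Rightarrow> 'a \<Rightarrow> complex" where
  "kil x y = trace_on L (\<lambda>v. br x (br y v))"

lemma kil_sym: "x \<in> L \<Longrightarrow> y \<in> L \<Longrightarrow> kil x y = kil y x"
  unfolding kil_def by (intro SL.trace_commute op_br)

lemma kil_add_right:
  assumes "x \<in> L" "y \<in> L" "z \<in> L" shows "kil x (y + z) = kil x y + kil x z"
  unfolding kil_def using assms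
  by (simp add: SL.trace_add[symmetric] op_br SL.op_on_comp br_left br_right)

lemma kil_scale_right:
  assumes "x \<in> L" "y \<in> L" shows "kil x (c *\<^sub>C y) = c * kil x y"
  unfolding kil_def using assms
  by (simp add: SL.trace_scale[symmetric] op_br SL.op_on_comp br_left br_right)

lemma kil_add_left: "x \<in> L \<Longrightarrow> y \<in> L \<Longrightarrow> z \<in> L \<Longrightarrow> kil (x + y) z = kil x z + kil y z"
  using kil_add_right kil_sym cvs.subspace_add[OF subL] by metis

lemma kil_scale_left: "x \<in> L \<Longrightarrow> y \<in> L \<Longrightarrow> kil (c *\<^sub>C x) y = c * kil x y"
  using kil_scale_right kil_sym cvs.subspace_scale[OF subL] by metis

lemma kil_invariant:
  assumes x: "x \<in> L" and y: "y \<in> L" and z: "z \<in> L" shows "kil (br x y) z = kil x (br y z)"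
proof -
  note op = op_br[OF x] op_br[OF y] op_br[OF z]
  note op3 = SL.op_on_comp[OF op(1) SL.op_on_comp[OF op(2,3)]] SL.op_on_comp[OF op(2) SL.op_on_comp[OF op(1,3)]]
    SL.op_on_comp[OF op(1) SL.op_on_comp[OF op(3,2)]]
  have "kil (br x y) z = trace_on L (\<lambda>v. br x (br y (br z v)) - br y (br x (br z v)))"
    unfolding kil_def using jacobi[OF x y closed[OF z]] by (intro trace_on_cong[OF _ fdL subL]) simp
  also have "\<dots> = trace_on L (\<lambda>v. br x (br y (br z v))) - trace_on L (\<lambda>v. br y (br x (br z v)))"
    by (rule SL.trace_diff[OF op3(1,2)])
  also have "trace_on L (\<lambda>v. br y (br x (br z v))) = trace_on L (\<lambda>v. br x (br z (br y v)))"
    by (rule SL.trace_commute[OF op(2) SL.op_on_comp[OF op(1,3)]])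
  also have "trace_on L (\<lambda>v. br x (br y (br z v))) - \<dots> = trace_on L (\<lambda>v. br x (br y (br z v)) - br x (br z (br y v)))"
    by (rule SL.trace_diff[OF op3(1,3), symmetric])
  also have "\<dots> = kil x (br y z)"
    unfolding kil_def using jacobi[OF y z] by (intro trace_on_cong[OF _ fdL subL]) (simp add: br_right)
  finally show ?thesis .
qed

lemma ext_add: "\<alpha> \<in> ext \<Longrightarrow> \<beta> \<in> ext \<Longrightarrow> (\<lambda>H. \<alpha> H + \<beta> H) \<in> ext"
  by (simp add: ext_def)

lemma wt_not_weight: "\<gamma> \<in> ext \<Longrightarrow> \<gamma> \<notin> weights \<Longrightarrow> x \<in> wt \<gamma> \<Longrightarrow> x = 0"
  by (auto simp: weights_def)

lemma L_induct [consumes 1, case_names wt zero comb]: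
  assumes "x \<in> L" and "\<And>\<gamma> x. \<gamma> \<in> weights \<Longrightarrow> x \<in> wt \<gamma> \<Longrightarrow> P x" and "P 0"
    and "\<And>c x y. x \<in> L \<Longrightarrow> y \<in> L \<Longrightarrow> P x \<Longrightarrow> P y \<Longrightarrow> P (c *\<^sub>C x + y)"
  shows "P x"
proof -
  have "x \<in> cvs.span (\<Union>\<alpha>\<in>weights. wt \<alpha>)" using assms(1) span_weights by simp
  then have "x \<in> L \<and> P x"
  proof (induction rule: cvs.span_induct_alt)
    case (step c x y)
    then obtain \<gamma> where "\<gamma> \<in> weights" "x \<in> wt \<gamma>" by blast
    then have "x \<in> L" "P x" using assms(2) wt_L by blast+
    then show ?case using step assms(4) subL by (simp add: cvs.subspace_add cvs.subspace_scale)
  qed (simp add: assms(3) cvs.subspace_0[OF subL])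
  then show ?thesis by simp
qed

text \<open>The weights \<open>\<gamma> + n \<delta>\<close> are pairwise distinct and only finitely many weight spaces are nonzero.\<close>

lemma weight_shift_nilpotent:
  assumes A: "clinear A" and \<delta>: "\<delta> \<in> ext" "\<delta> H0 \<noteq> 0"
    and shift: "\<And>\<gamma> x. \<gamma> \<in> ext \<Longrightarrow> x \<in> wt \<gamma> \<Longrightarrow> A x \<in> wt (\<lambda>H. \<gamma> H + \<delta> H)"
  shows "\<exists>N. \<forall>x\<in>L. (A ^^ N) x = 0"
proof (rule locally_nilpotent_uniform[OF A fdL subL])
  fix x assume "x \<in> L"
  then show "\<exists>N. (A ^^ N) x = 0"
  proof (induction rule: L_induct)
    case (wt \<gamma> x)
    define s where "s n = (\<lambda>H. \<gamma> H + of_nat n * \<delta> H)" for n :: nat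
    have sext: "s n \<in> ext" for n using \<delta>(1) wt(1) weights_ext by (auto simp: ext_def s_def)
    have pow: "(A ^^ n) x \<in> wt (s n)" for n
    proof (induction n)
      case 0
      then show ?case using wt(2) by (simp add: s_def)
    next
      case (Suc n)
      have "(\<lambda>H. s n H + \<delta> H) = s (Suc n)" by (auto simp: s_def algebra_simps)
      then show ?case using shift[OF sext Suc] by simp
    qed
    have "inj s"
    proof (rule injI)
      fix m n assume "s m = s n"
      then have "s m H0 = s n H0" by simp
      then show "m = n" using \<delta>(2) by (simp add: s_def)
    qed
    then have "\<not> range s \<subseteq> weights" using finite_weights finite_subset range_inj_infinite by blast
    then obtain n where "s n \<notin> weights" by blast
    then show ?case using wt_not_weight[OF sext _ pow] by blast
  next
    case zero
    show ?case by (rule exI[of _ 0]) simp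
  next
    case (comb c x y)
    then obtain M N where MN: "(A ^^ M) x = 0" "(A ^^ N) y = 0" by blast
    have "(A ^^ (M + N)) x = 0"
      by (subst add.commute) (simp add: funpow_add_apply MN clinear_simps[OF clinear_funpow[OF A]])
    moreover have "(A ^^ (M + N)) y = 0" by (simp add: funpow_add_apply MN clinear_simps[OF clinear_funpow[OF A]])
    ultimately show ?case by (intro exI[of _ "M + N"]) (simp add: clinear_simps[OF clinear_funpow[OF A]])
  qed
qed

text \<open>The operator \<open>ad x \<circ> ad y\<close> shifts weights by \<open>\<alpha> + \<beta>\<close>, so it is nilpotent.\<close>

lemma kil_wt_orthogonal:
  assumes \<alpha>: "\<alpha> \<in> ext" "x \<in> wt \<alpha>" and \<beta>: "\<beta> \<in> ext" "y \<in> wt \<beta>" and ne: "\<alpha> H0 + \<beta> H0 \<noteq> 0"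
  shows "kil x y = 0"
proof -
  have xy: "x \<in> L" "y \<in> L" using \<alpha> \<beta> wt_L by blast+
  have lin: "clinear (\<lambda>v. br x (br y v))" by (intro clinearI) (simp_all add: br_right)
  have "\<exists>N. \<forall>v\<in>L. ((\<lambda>v. br x (br y v)) ^^ N) v = 0"
  proof (rule weight_shift_nilpotent[OF lin ext_add[OF \<alpha>(1) \<beta>(1)] ne])
    fix \<gamma> v assume "\<gamma> \<in> ext" "v \<in> wt \<gamma>"
    then have "br x (br y v) \<in> wt (\<lambda>H. \<alpha> H + (\<beta> H + \<gamma> H))" using wt_bracket \<alpha> \<beta> by blast
    then show "br x (br y v) \<in> wt (\<lambda>H. \<gamma> H + (\<alpha> H + \<beta> H))" by (simp add: algebra_simps)
  qed
  then obtain N where "\<forall>v\<in>L. ((\<lambda>v. br x (br y v)) ^^ N) v = 0" by blast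
  then show ?thesis unfolding kil_def
    by (intro trace_on_nilpotent[OF fdL subL lin, of N] closed) (use xy in auto)
qed

text \<open>Polarising the identity that the square of a nilpotent operator has trace \<open>0\<close> avoids
  simultaneous triangularisation.\<close>

lemma shifted_trace_prod:
  assumes \<gamma>: "\<gamma> \<in> weights" and H: "H \<in> h" and K: "K \<in> h"
  shows "trace_on (wt \<gamma>) (\<lambda>v. shifted H (\<gamma> H) (shifted K (\<gamma> K) v)) = 0"
proof -
  interpret S: fd_space "wt \<gamma>" by (rule wt_fd_space)
  define T where "T J = shifted J (\<gamma> J)" for J
  have op: "S.op_on (T J)" if "J \<in> h" for J
    unfolding T_def by (intro S.op_onI clinear_shifted shifted_mem[OF wt_subspace wt_h_stable[OF that]])
  have sq: "trace_on (wt \<gamma>) (\<lambda>v. T J (T J v)) = 0" if J: "J \<in> h" for J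
  proof -
    obtain N where N: "\<forall>x\<in>wt \<gamma>. (T J ^^ N) x = 0"
      using locally_nilpotent_uniform[OF clinear_shifted wt_fdim wt_subspace, of \<gamma> J "\<gamma> J"] J
      by (auto simp: wt_def T_def)
    have powTT: "((\<lambda>v. T J (T J v)) ^^ n) x = (T J ^^ n) ((T J ^^ n) x)" for n x
      by (induction n) (simp_all add: funpow_swap1)
    have lin: "clinear (T J)" using op[OF J] by (simp add: S.op_on_def)
    show ?thesis
    proof (rule trace_on_nilpotent[OF wt_fdim wt_subspace, where n = N])
      show "T J (T J x) \<in> wt \<gamma>" if "x \<in> wt \<gamma>" for x
        using S.op_on_comp[OF op[OF J] op[OF J]] that by (auto simp: S.op_on_def)
      show "((\<lambda>v. T J (T J v)) ^^ N) x = 0" if "x \<in> wt \<gamma>" for x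
        unfolding powTT using N that by (simp add: clinear_simps[OF clinear_funpow[OF lin]])
    qed (use S.op_on_comp[OF op[OF J] op[OF J]] in \<open>auto simp: S.op_on_def\<close>)
  qed
  have HK: "H + K \<in> h" using H K subh cvs.subspace_add by blast
  note ops = op[OF H] op[OF K]
  have lin: "clinear (T H)" "clinear (T K)" using ops by (auto simp: S.op_on_def)
  have "T (H + K) v = T H v + T K v" for v
    by (simp add: T_def shifted_def br_left weight_add[OF \<gamma> H K] cvs.scale_left_distrib)
  then have "(\<lambda>v. T (H + K) (T (H + K) v)) =
      (\<lambda>v. (T H (T H v) + T H (T K v)) + (T K (T H v) + T K (T K v)))"
    by (intro HOL.ext) (simp add: clinear_simps(1)[OF lin(1)] clinear_simps(1)[OF lin(2)])
  then have "0 = trace_on (wt \<gamma>) (\<lambda>v. (T H (T H v) + T H (T K v)) + (T K (T H v) + T K (T K v)))"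
    using sq[OF HK] by simp
  also have "\<dots> = (trace_on (wt \<gamma>) (\<lambda>v. T H (T H v)) + trace_on (wt \<gamma>) (\<lambda>v. T H (T K v)))
      + (trace_on (wt \<gamma>) (\<lambda>v. T K (T H v)) + trace_on (wt \<gamma>) (\<lambda>v. T K (T K v)))"
    by (simp add: S.trace_add S.op_on_add S.op_on_comp ops)
  also have "\<dots> = 2 * trace_on (wt \<gamma>) (\<lambda>v. T H (T K v))"
    using sq[OF H] sq[OF K] S.trace_commute[OF ops] by simp
  finally show ?thesis by (simp add: T_def)
qed

lemma wt_trace_prod:
  assumes \<gamma>: "\<gamma> \<in> weights" and H: "H \<in> h" and K: "K \<in> h"
  shows "trace_on (wt \<gamma>) (\<lambda>v. br H (br K v)) = of_nat (mult \<gamma>) * \<gamma> H * \<gamma> K"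
proof -
  interpret S: fd_space "wt \<gamma>" by (rule wt_fd_space)
  define T where "T J = shifted J (\<gamma> J)" for J
  have op: "S.op_on (T J)" if "J \<in> h" for J
    unfolding T_def by (intro S.op_onI clinear_shifted shifted_mem[OF wt_subspace wt_h_stable[OF that]])
  note ops = op[OF H] op[OF K] op_on_wt[OF K, of \<gamma>]
  have lin: "clinear (T H)" using ops by (auto simp: S.op_on_def)
  have "(\<lambda>v. br H (br K v)) = (\<lambda>v. (T H (T K v) + \<gamma> K *\<^sub>C T H v) + \<gamma> H *\<^sub>C br K v)"
    by (intro HOL.ext) (simp add: T_def shifted_def br_right cvs.scale_right_diff_distrib mult.commute)
  then have "trace_on (wt \<gamma>) (\<lambda>v. br H (br K v)) =
      trace_on (wt \<gamma>) (\<lambda>v. T H (T K v)) + \<gamma> K * trace_on (wt \<gamma>) (T H) + \<gamma> H * trace_on (wt \<gamma>) (br K)"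
    by (simp add: S.trace_add S.trace_scale S.op_on_add S.op_on_comp S.op_on_scale ops)
  also have "\<dots> = of_nat (mult \<gamma>) * \<gamma> H * \<gamma> K"
    using shifted_trace_prod[OF \<gamma> H K] shifted_trace[OF H, of \<gamma>] weight_trace[OF K, of \<gamma>] by (simp add: T_def)
  finally show ?thesis .
qed

lemma kil_h:
  assumes H: "H \<in> h" and K: "K \<in> h"
  shows "kil H K = (\<Sum>\<gamma>\<in>weights. of_nat (mult \<gamma>) * \<gamma> H * \<gamma> K)"
proof -
  have lin: "clinear (\<lambda>v. br H (br K v))" by (intro clinearI) (simp_all add: br_right)
  have "kil H K = (\<Sum>\<gamma>\<in>weights. trace_on (wt \<gamma>) (\<lambda>v. br H (br K v)))"
    unfolding kil_def by (intro trace_weights lin wt_h_stable H K)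
  then show ?thesis using wt_trace_prod[OF _ H K] by simp
qed

text \<open>The sum of the weight spaces along the string through \<open>\<beta>\<close> is stable under \<open>e\<close> and \<open>f\<close>, so the
  commutator has trace \<open>0\<close> there.\<close>

lemma weight_string:
  assumes \<alpha>: "\<alpha> \<in> ext" and e: "e \<in> wt \<alpha>" and f: "f \<in> wt (\<lambda>H. - \<alpha> H)" and \<beta>: "\<beta> \<in> weights"
  obtains r :: real where "\<beta> (br e f) = of_real r * \<alpha> (br e f)"
proof -
  define A where "A = {\<gamma>\<in>weights. \<exists>n::int. \<forall>H. \<gamma> H = \<beta> H + of_int n * \<alpha> H}"
  obtain n :: "('a \<Rightarrow> complex) \<Rightarrow> int" where n: "\<And>\<gamma> H. \<gamma> \<in> A \<Longrightarrow> \<gamma> H = \<beta> H + of_int (n \<gamma>) * \<alpha> H"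
  proof -
    have "\<forall>\<gamma>\<in>A. \<exists>n::int. \<forall>H. \<gamma> H = \<beta> H + of_int n * \<alpha> H" by (simp add: A_def)
    then obtain n :: "('a \<Rightarrow> complex) \<Rightarrow> int" where "\<forall>\<gamma>\<in>A. \<forall>H. \<gamma> H = \<beta> H + of_int (n \<gamma>) * \<alpha> H"
      unfolding bchoice_iff by blast
    then show ?thesis using that by blast
  qed
  have Aw: "A \<subseteq> weights" by (auto simp: A_def)
  have finA: "finite A" using Aw finite_weights finite_subset by blast
  have \<beta>A: "\<beta> \<in> A" using \<beta> by (auto simp: A_def intro!: exI[of _ 0])
  define V where "V = cvs.span (\<Union>\<gamma>\<in>A. wt \<gamma>)"
  have fdV: "fdim V" unfolding V_def by (intro fdim_span_Union finA wt_fdim)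
  have subV: "cvs.subspace V" by (simp add: V_def)
  have VL: "V \<subseteq> L" unfolding V_def by (intro cvs.span_minimal subL) (use wt_L in blast)
  interpret V: fd_space V using fdV subV by unfold_locales
  have stab: "br y v \<in> V" if y: "y \<in> wt (\<lambda>H. of_int m * \<alpha> H)" and v: "v \<in> V" for y m v
  proof (rule clinear_span_into[OF lin_right _ subV v[unfolded V_def]])
    fix x assume "x \<in> (\<Union>\<gamma>\<in>A. wt \<gamma>)"
    then obtain \<gamma> where \<gamma>: "\<gamma> \<in> A" "x \<in> wt \<gamma>" by blast
    define \<delta> where "\<delta> = (\<lambda>H. of_int m * \<alpha> H + \<gamma> H)"
    have \<delta>: "br y x \<in> wt \<delta>" unfolding \<delta>_def by (rule wt_bracket[OF y \<gamma>(2)])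
    have "\<delta> \<in> ext" using \<alpha> \<gamma>(1) Aw weights_ext by (auto simp: \<delta>_def ext_def subset_iff)
    have \<delta>eq: "\<delta> H = \<beta> H + of_int (n \<gamma> + m) * \<alpha> H" for H
      using n[OF \<gamma>(1), of H] by (simp add: \<delta>_def algebra_simps)
    show "br y x \<in> V"
    proof (cases "\<delta> \<in> weights")
      case True
      then have "\<delta> \<in> A" using \<delta>eq unfolding A_def by blast
      then show ?thesis unfolding V_def using \<delta> by (blast intro: cvs.span_base)
    next
      case False
      then show ?thesis using wt_not_weight[OF \<open>\<delta> \<in> ext\<close> _ \<delta>] cvs.subspace_0[OF subV] by simp
    qed
  qed
  have ope: "V.op_on (br e)" using stab[of e 1] e by (intro V.op_onI lin_right) simp
  have opf: "V.op_on (br f)" using stab[of f "-1"] f by (intro V.op_onI lin_right) simp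
  have xh: "br e f \<in> h" using wt_bracket[OF e f] by (simp add: wt_0)
  define x where "x = br e f"
  have "trace_on V (br x) = trace_on V (\<lambda>v. br e (br f v) - br f (br e v))"
  proof (rule trace_on_cong[OF _ fdV subV])
    fix v assume "v \<in> V"
    then have "br e (br f v) = br (br e f) v + br f (br e v)"
      using e f wt_L VL by (intro jacobi) auto
    then show "br x v = br e (br f v) - br f (br e v)" by (simp add: x_def)
  qed
  also have "\<dots> = 0"
    using V.trace_commute[OF ope opf] by (simp add: V.trace_diff[OF V.op_on_comp[OF ope opf] V.op_on_comp[OF opf ope]])
  finally have tr0: "trace_on V (br x) = 0" .
  have "trace_on V (br x) = (\<Sum>\<gamma>\<in>A. trace_on (wt \<gamma>) (br x))"
    unfolding V_def
    by (rule trace_on_direct_sum[OF finA lin_right wt_fdim wt_subspace wt_h_stable[OF xh[folded x_def]]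
        weights_independent[OF Aw]])
  also have "\<dots> = (\<Sum>\<gamma>\<in>A. (\<beta> x + of_int (n \<gamma>) * \<alpha> x) * of_nat (mult \<gamma>))"
    using weight_trace[OF xh[folded x_def]] n by (intro sum.cong) auto
  also have "\<dots> = \<beta> x * of_real (\<Sum>\<gamma>\<in>A. real (mult \<gamma>)) + of_real (\<Sum>\<gamma>\<in>A. of_int (n \<gamma>) * real (mult \<gamma>)) * \<alpha> x"
    by (simp add: algebra_simps sum.distrib sum_distrib_left sum_distrib_right)
  finally have eq: "\<beta> x * of_real (\<Sum>\<gamma>\<in>A. real (mult \<gamma>)) + of_real (\<Sum>\<gamma>\<in>A. of_int (n \<gamma>) * real (mult \<gamma>)) * \<alpha> x = 0"
    using tr0 by simp
  define M where "M = (\<Sum>\<gamma>\<in>A. real (mult \<gamma>))"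
  define N where "N = (\<Sum>\<gamma>\<in>A. of_int (n \<gamma>) * real (mult \<gamma>))"
  have "real (mult \<beta>) \<le> M" unfolding M_def by (rule member_le_sum[OF \<beta>A _ finA]) simp
  then have "M \<noteq> 0" using mult_pos[OF \<beta>] by simp
  have "\<beta> x = of_real (- N / M) * \<alpha> x"
    using eq \<open>M \<noteq> 0\<close> unfolding M_def[symmetric] N_def[symmetric]
    by (simp add: field_simps eq_neg_iff_add_eq_0)
  then show ?thesis using that unfolding x_def by blast
qed

definition kil_rad :: "'a set" where
  "kil_rad = {x\<in>L. \<forall>y\<in>L. kil x y = 0}"

lemma kil_rad_L: "kil_rad \<subseteq> L" by (auto simp: kil_rad_def)

lemma kil_zero_left: "y \<in> L \<Longrightarrow> kil 0 y = 0"
  using kil_scale_left[of 0 y 0] cvs.subspace_0[OF subL] by simp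

lemma kil_rad_subspace: "cvs.subspace kil_rad"
  unfolding cvs.subspace_def
  by (auto simp: kil_rad_def kil_zero_left kil_add_left kil_scale_left subL cvs.subspace_0 cvs.subspace_add
      cvs.subspace_scale)

lemma kil_rad_ideal: "x \<in> L \<Longrightarrow> y \<in> kil_rad \<Longrightarrow> br x y \<in> kil_rad"
proof -
  assume x: "x \<in> L" and y: "y \<in> kil_rad"
  have yL: "y \<in> L" using y kil_rad_L by blast
  have "kil (br x y) z = 0" if "z \<in> L" for z
  proof -
    have "br x y = - br y x" by (rule antisym[OF x yL])
    then have "kil (br x y) z = - kil (br y x) z"
      using kil_scale_left[OF closed[OF yL x] that, of "-1"] by (simp add: scaleC_one)
    also have "kil (br y x) z = kil y (br x z)" by (rule kil_invariant[OF yL x that])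
    finally show ?thesis using y closed[OF x that] by (simp add: kil_rad_def)
  qed
  then show ?thesis using closed[OF x yL] by (simp add: kil_rad_def)
qed

text \<open>The part of degree \<open>\<delta>\<close> of the bracket of \<open>L\<close> with the radical of the trace form.\<close>

definition rad_bracket :: "('a \<Rightarrow> complex) \<Rightarrow> 'a set" where
  "rad_bracket \<delta> = cvs.span {br a i |a i \<gamma> \<alpha>. \<gamma> \<in> ext \<and> \<alpha> \<in> ext \<and> a \<in> wt \<gamma> \<and> i \<in> kil_rad \<inter> wt \<alpha> \<and>
     (\<lambda>H. \<gamma> H + \<alpha> H) = \<delta>}"

lemma rad_bracketI:
  "\<gamma> \<in> ext \<Longrightarrow> \<alpha> \<in> ext \<Longrightarrow> a \<in> wt \<gamma> \<Longrightarrow> i \<in> kil_rad \<Longrightarrow> i \<in> wt \<alpha> \<Longrightarrow> br a i \<in> rad_bracket (\<lambda>H. \<gamma> H + \<alpha> H)"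
  unfolding rad_bracket_def by (rule cvs.span_base) blast

lemma rad_bracket_sub: "rad_bracket \<delta> \<subseteq> kil_rad \<inter> wt \<delta>"
  unfolding rad_bracket_def
  by (rule cvs.span_minimal[OF _ cvs.subspace_inter[OF kil_rad_subspace wt_subspace]])
     (use kil_rad_ideal wt_L wt_bracket in blast)

text \<open>For \<open>x = [e, f]\<close> in the radical of the trace form all weights have values proportional to \<open>\<gamma>
  x\<close> with real factors, and \<open>0 = kil x x\<close> is a sum of squares.\<close>

lemma rad_bracket_zero_weights:
  assumes x: "x \<in> rad_bracket (\<lambda>_. 0)" and \<beta>: "\<beta> \<in> weights"
  shows "\<beta> x = 0"
proof -
  define N where "N = {x\<in>h. \<forall>\<beta>\<in>weights. \<beta> x = 0}"
  have w0: "\<gamma> 0 = 0" if "\<gamma> \<in> weights" for \<gamma>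
    using weight_scale[OF that cvs.subspace_0[OF subh], of 0] by simp
  have "cvs.subspace N" unfolding N_def cvs.subspace_def
    using subh by (auto simp: w0 weight_add weight_scale cvs.subspace_0 cvs.subspace_add cvs.subspace_scale)
  moreover have "{br a i |a i \<gamma> \<alpha>. \<gamma> \<in> ext \<and> \<alpha> \<in> ext \<and> a \<in> wt \<gamma> \<and> i \<in> kil_rad \<inter> wt \<alpha> \<and>
     (\<lambda>H. \<gamma> H + \<alpha> H) = (\<lambda>_. 0)} \<subseteq> N"
  proof clarify
    fix a i \<gamma> \<alpha> assume *: "\<gamma> \<in> ext" "\<alpha> \<in> ext" "a \<in> wt \<gamma>" "i \<in> kil_rad" "i \<in> wt \<alpha>" "(\<lambda>H. \<gamma> H + \<alpha> H) = (\<lambda>_. 0)"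
    have \<alpha>: "\<alpha> = (\<lambda>H. - \<gamma> H)"
    proof
      fix H show "\<alpha> H = - \<gamma> H" using fun_cong[OF *(6), of H] by (simp add: eq_neg_iff_add_eq_0 add.commute)
    qed
    let ?x = "br a i"
    have xh: "?x \<in> h" using wt_bracket[OF *(3,5)] unfolding *(6) wt_0 .
    have xrad: "?x \<in> kil_rad" using kil_rad_ideal *(3,4) wt_L by blast
    have "\<forall>\<beta>\<in>weights. \<exists>r::real. \<beta> ?x = of_real r * \<gamma> ?x"
      using weight_string[OF *(1,3) *(5)[unfolded \<alpha>]] by metis
    then obtain r :: "('a \<Rightarrow> complex) \<Rightarrow> real" where r: "\<And>\<beta>. \<beta> \<in> weights \<Longrightarrow> \<beta> ?x = of_real (r \<beta>) * \<gamma> ?x"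
      by metis
    show "?x \<in> N"
    proof (cases "\<gamma> \<in> weights")
      case False
      then have "a = 0" by (rule wt_not_weight[OF *(1) _ *(3)])
      then have "?x = 0" by (simp add: br_left)
      then show ?thesis using xh w0 by (simp add: N_def)
    next
      case \<gamma>w: True
      have "\<gamma> ?x = 0"
      proof (rule ccontr)
        assume ne: "\<gamma> ?x \<noteq> 0"
      have "0 = kil ?x ?x" using xrad kil_rad_L by (auto simp: kil_rad_def)
      also have "\<dots> = (\<Sum>\<beta>\<in>weights. of_nat (mult \<beta>) * \<beta> ?x * \<beta> ?x)" by (rule kil_h[OF xh xh])
      also have "\<dots> = (\<Sum>\<beta>\<in>weights. of_real (real (mult \<beta>) * (r \<beta>)\<^sup>2) * (\<gamma> ?x)\<^sup>2)"
        by (rule sum.cong) (simp_all add: r power2_eq_square)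
      also have "\<dots> = of_real (\<Sum>\<beta>\<in>weights. real (mult \<beta>) * (r \<beta>)\<^sup>2) * (\<gamma> ?x)\<^sup>2"
        by (simp add: sum_distrib_right)
      finally have "(\<Sum>\<beta>\<in>weights. real (mult \<beta>) * (r \<beta>)\<^sup>2) = 0" using ne by (simp add: of_real_eq_0_iff[symmetric, where 'a=complex] del: of_real_eq_0_iff of_real_sum)
      then have "real (mult \<gamma>) * (r \<gamma>)\<^sup>2 = 0"
        using sum_nonneg_eq_0_iff[OF finite_weights, of "\<lambda>\<beta>. real (mult \<beta>) * (r \<beta>)\<^sup>2"] \<gamma>w by simp
      then have "r \<gamma> = 0" using mult_pos[OF \<gamma>w] by simp
      then show False using r[OF \<gamma>w] ne by simp
      qed
      then show ?thesis using xh r by (simp add: N_def)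
    qed
  qed
  ultimately have "rad_bracket (\<lambda>_. 0) \<subseteq> N" unfolding rad_bracket_def by (intro cvs.span_minimal)
  then show ?thesis using x \<beta> by (auto simp: N_def)
qed

end

section \<open>Cartan subalgebras of reductive Lie algebras\<close>

locale reductive_cartan = cartan_pair +
  assumes reductive: "reductive_lie g L"
    and form_right: "\<And>x. cfunctional (form g x)" and form_left: "\<And>y. cfunctional (\<lambda>x. form g x y)"
    and form_inv: "\<And>x y z. form g (brk g x y) z = form g x (brk g y z)"
    and form_sym: "\<And>x y. x \<in> L \<Longrightarrow> y \<in> L \<Longrightarrow> form g x y = form g y x"
    and form_nondeg: "\<And>x. x \<in> L \<Longrightarrow> (\<And>y. y \<in> L \<Longrightarrow> form g x y = 0) \<Longrightarrow> x = 0"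
begin

abbreviation Z :: "'a set" where "Z \<equiv> lie_center g L"

lemma form_add_right: "form g x (y + z) = form g x y + form g x z"
  and form_scale_right: "form g x (c *\<^sub>C y) = c * form g x y"
  and form_add_left: "form g (x + y) z = form g x z + form g y z"
  and form_scale_left: "form g (c *\<^sub>C x) z = c * form g x z"
  using form_right[of x] form_left[of z] by (simp_all add: Vector_Spaces.linear_iff)

lemma form_zero_left: "form g 0 y = 0" and form_zero_right: "form g y 0 = 0"
  using form_scale_left[of 0 0 y] form_scale_right[of y 0 0] by simp_all

lemma center_subspace: "cvs.subspace Z"
  unfolding cvs.subspace_def lie_center_def
  by (auto simp: br_left cvs.subspace_0[OF subL] cvs.subspace_add[OF subL] cvs.subspace_scale[OF subL])

lemma center_L: "Z \<subseteq> L" by (auto simp: lie_center_def)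

lemma center_br: "z \<in> Z \<Longrightarrow> x \<in> L \<Longrightarrow> br z x = 0" "z \<in> Z \<Longrightarrow> x \<in> L \<Longrightarrow> br x z = 0"
  using antisym[of x z] by (auto simp: lie_center_def)

lemma derived_series_subspace: "cvs.subspace J \<Longrightarrow> cvs.subspace (derived_series g J n)"
  by (cases n) auto

lemma solvable_if_central_brackets:
  assumes J: "cvs.subspace J" "J \<subseteq> L" and br: "\<And>x y. x \<in> J \<Longrightarrow> y \<in> J \<Longrightarrow> br x y \<in> Z"
  shows "solvable_lie g J"
proof -
  have 1: "derived_series g J 1 \<subseteq> Z"
    unfolding One_nat_def derived_series.simps
    by (rule cvs.span_minimal[OF _ center_subspace]) (use br in blast)
  have "derived_series g J 2 \<subseteq> {0}"
    unfolding numeral_2_eq_2 derived_series.simps(2)[of g J "Suc 0"]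
  proof (rule cvs.span_minimal)
    have "br x y = 0" if "x \<in> derived_series g J (Suc 0)" "y \<in> derived_series g J (Suc 0)" for x y
      using that 1 center_L by (intro center_br(1)) auto
    then show "{br x y |x y. x \<in> derived_series g J (Suc 0) \<and> y \<in> derived_series g J (Suc 0)} \<subseteq> {0}"
      by blast
  qed simp
  then have "derived_series g J 2 = {0}"
    using cvs.subspace_0[OF derived_series_subspace[OF J(1)]] by blast
  then show ?thesis unfolding solvable_lie_def by blast
qed

lemma solvable_ideal_central:
  "cvs.subspace J \<Longrightarrow> J \<subseteq> L \<Longrightarrow> (\<And>x y. x \<in> L \<Longrightarrow> y \<in> J \<Longrightarrow> br x y \<in> J) \<Longrightarrow> solvable_lie g J \<Longrightarrow> J \<subseteq> Z"
  using reductive unfolding reductive_lie_def lie_ideal_def by blast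

text \<open>The elements whose brackets are all central form a solvable ideal.\<close>

lemma second_center: "x \<in> L \<Longrightarrow> (\<And>y. y \<in> L \<Longrightarrow> br x y \<in> Z) \<Longrightarrow> x \<in> Z"
proof -
  define J where "J = {x\<in>L. \<forall>y\<in>L. br x y \<in> Z}"
  assume "x \<in> L" "\<And>y. y \<in> L \<Longrightarrow> br x y \<in> Z"
  then have "x \<in> J" by (simp add: J_def)
  also have "J \<subseteq> Z"
  proof (rule solvable_ideal_central)
    show sub: "cvs.subspace J" unfolding cvs.subspace_def J_def
      using center_subspace subL by (auto simp: br_left cvs.subspace_0 cvs.subspace_add cvs.subspace_scale)
    show JL: "J \<subseteq> L" by (auto simp: J_def)
    have ZJ: "Z \<subseteq> J" using center_br center_L cvs.subspace_0[OF center_subspace] by (auto simp: J_def)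
    show "br x y \<in> J" if "x \<in> L" "y \<in> J" for x y
    proof -
      have "br x y = - br y x" using antisym that JL by blast
      also have "\<dots> \<in> Z" using that cvs.subspace_neg[OF center_subspace] by (auto simp: J_def)
      finally show ?thesis using ZJ by blast
    qed
    show "solvable_lie g J" by (rule solvable_if_central_brackets[OF sub JL]) (auto simp: J_def)
  qed
  finally show ?thesis .
qed

text \<open>The homogeneous brackets of \<open>L\<close> with the radical of the trace form are ad-nilpotent: in
  nonzero degree because they shift weights, in degree zero because all weights vanish on them. By
  the Engel--Jacobson theorem they span a solvable ideal, which is central.\<close>

lemma rad_bracket_central: "\<delta> \<in> ext \<Longrightarrow> rad_bracket \<delta> \<subseteq> Z"
proof -
  define X where "X = (\<Union>\<delta>\<in>ext. rad_bracket \<delta>)"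
  have XL: "X \<subseteq> L" unfolding X_def using rad_bracket_sub wt_L by blast
  have Xbr: "br y x \<in> X" if "\<gamma> \<in> ext" "y \<in> wt \<gamma>" "x \<in> X" for \<gamma> x y
  proof -
    obtain \<delta> where \<delta>: "\<delta> \<in> ext" "x \<in> rad_bracket \<delta>" using \<open>x \<in> X\<close> by (auto simp: X_def)
    then have "br y x \<in> rad_bracket (\<lambda>H. \<gamma> H + \<delta> H)"
      using that rad_bracket_sub[of \<delta>] by (intro rad_bracketI) auto
    then show ?thesis unfolding X_def using ext_add[OF that(1) \<delta>(1)] by blast
  qed
  have nil: "\<exists>n. \<forall>v\<in>L. (br x ^^ n) v = 0" if "x \<in> X" for x
  proof -
    obtain \<delta> where \<delta>: "\<delta> \<in> ext" "x \<in> rad_bracket \<delta>" using \<open>x \<in> X\<close> by (auto simp: X_def)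
    have xw: "x \<in> wt \<delta>" using \<delta> rad_bracket_sub by blast
    show ?thesis
    proof (cases "\<delta> = (\<lambda>_. 0)")
      case False
      then obtain H0 where "\<delta> H0 \<noteq> 0" by blast
      then show ?thesis
      proof (rule weight_shift_nilpotent[OF lin_right \<delta>(1)])
        fix \<gamma> v assume "v \<in> wt \<gamma>"
        then have "br x v \<in> wt (\<lambda>H. \<delta> H + \<gamma> H)" by (rule wt_bracket[OF xw])
        then show "br x v \<in> wt (\<lambda>H. \<gamma> H + \<delta> H)" by (simp add: add.commute)
      qed
    next
      case True
      have xh: "x \<in> h" using xw True by (simp add: wt_0)
      have x0: "\<beta> x = 0" if "\<beta> \<in> weights" for \<beta>
        using rad_bracket_zero_weights \<delta>(2) True that by blast
      show ?thesis
      proof (rule locally_nilpotent_uniform[OF lin_right fdL subL])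
        fix v assume "v \<in> L"
        then show "\<exists>N. (br x ^^ N) v = 0"
        proof (induction rule: L_induct)
          case (wt \<gamma> v)
          then show ?case using xh x0 by (fastforce simp: wt_def shifted_0)
        next
          case zero
          show ?case by (rule exI[of _ 0]) simp
        next
          case (comb c u v)
          then obtain M N where MN: "(br x ^^ M) u = 0" "(br x ^^ N) v = 0" by blast
          note lin = clinear_simps[OF clinear_funpow[OF lin_right]]
          have "(br x ^^ (M + N)) u = 0" by (subst add.commute) (simp add: funpow_add_apply MN lin)
          moreover have "(br x ^^ (M + N)) v = 0" by (simp add: funpow_add_apply MN lin)
          ultimately show ?case by (intro exI[of _ "M + N"]) (simp add: lin)
        qed
      qed
    qed
  qed
  have "br x y \<in> X" if "x \<in> X" "y \<in> X" for x y
  proof -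
    obtain \<gamma> where "\<gamma> \<in> ext" "x \<in> rad_bracket \<gamma>" using \<open>x \<in> X\<close> by (auto simp: X_def)
    then show ?thesis using Xbr[of \<gamma> x y] rad_bracket_sub[of \<gamma>] \<open>y \<in> X\<close> by blast
  qed
  then obtain m where m: "(act_span X ^^ m) L \<subseteq> {0}" using engel_jacobson[OF XL _ nil] by blast
  define J where "J = cvs.span X"
  have JL: "J \<subseteq> L" unfolding J_def by (rule cvs.span_minimal[OF XL subL])
  have "J \<subseteq> Z"
  proof (rule solvable_ideal_central[OF _ JL])
    show sub: "cvs.subspace J" by (simp add: J_def)
    show "br y x \<in> J" if "y \<in> L" "x \<in> J" for x y
    proof (rule clinear_span_into[OF lin_right _ sub that(2)[unfolded J_def]])
      fix x assume "x \<in> X"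
      show "br y x \<in> J"
        using \<open>y \<in> L\<close>
      proof (induction rule: L_induct)
        case (wt \<gamma> y)
        then show ?case using Xbr[OF _ _ \<open>x \<in> X\<close>] weights_ext unfolding J_def by (blast intro: cvs.span_base)
      next
        case zero
        then show ?case using cvs.subspace_0[OF sub] by (simp add: br_left)
      next
        case (comb c y z)
        then show ?case using cvs.subspace_add[OF sub] cvs.subspace_scale[OF sub] by (simp add: br_left)
      qed
    qed
    have "derived_series g J n \<subseteq> J \<and> derived_series g J n \<subseteq> (act_span X ^^ n) L" for n
    proof (induction n)
      case 0
      show ?case using JL by simp
    next
      case (Suc n)
      have "derived_series g J (Suc n) \<subseteq> act_span X (derived_series g J n)"
        using Suc.IH act_spanI act_span_mono_span[of J X, OF _ order_refl]
        unfolding derived_series.simps J_def by (intro cvs.span_minimal[OF _ act_span_subspace]) blast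
      also have "\<dots> \<subseteq> act_span X ((act_span X ^^ n) L)"
        using Suc.IH by (intro act_span_mono_span cvs.span_superset) blast
      finally have "derived_series g J (Suc n) \<subseteq> (act_span X ^^ Suc n) L" by simp
      moreover have "derived_series g J (Suc n) \<subseteq> J"
        unfolding derived_series.simps
      proof (rule cvs.span_minimal[OF _ sub], clarify)
        fix x y assume "x \<in> derived_series g J n" "y \<in> derived_series g J n"
        then have "x \<in> L" "y \<in> J" using Suc.IH JL by auto
        then show "br x y \<in> J" by fact
      qed
      ultimately show ?case by simp
    qed
    then have "derived_series g J m \<subseteq> {0}" using m by blast
    then have "derived_series g J m = {0}" using cvs.subspace_0[OF derived_series_subspace[OF sub]] by blast
    then show "solvable_lie g J" unfolding solvable_lie_def by blast
  qed
  then show "\<delta> \<in> ext \<Longrightarrow> rad_bracket \<delta> \<subseteq> Z" unfolding J_def X_def using cvs.span_superset by blast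
qed

text \<open>The brackets of \<open>L\<close> with the radical are central, so the radical is a solvable ideal and
  itself central.\<close>

lemma kil_rad_center: "kil_rad \<subseteq> Z"
proof -
  have br_rad: "br a i \<in> Z" if a: "a \<in> L" and i: "i \<in> kil_rad" for a i
  proof -
    have stab: "br H x \<in> kil_rad" if "H \<in> h" "x \<in> kil_rad" for H x using kil_rad_ideal hL' that by blast
    have i': "i \<in> cvs.span (\<Union>\<alpha>\<in>ext. kil_rad \<inter> wt \<alpha>)"
      using weight_decomposition[OF kil_rad_subspace kil_rad_L stab] i by blast
    show ?thesis
    proof (rule clinear_span_into[OF lin_right _ center_subspace i'])
      fix x assume "x \<in> (\<Union>\<alpha>\<in>ext. kil_rad \<inter> wt \<alpha>)"
      then obtain \<alpha> where \<alpha>: "\<alpha> \<in> ext" "x \<in> kil_rad" "x \<in> wt \<alpha>" by blast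
      show "br a x \<in> Z"
        using a
      proof (induction rule: L_induct)
        case (wt \<gamma> y)
        have \<gamma>: "\<gamma> \<in> ext" using wt(1) weights_ext by blast
        show ?case using rad_bracketI[OF \<gamma> \<alpha>(1) wt(2) \<alpha>(2,3)] rad_bracket_central[OF ext_add[OF \<gamma> \<alpha>(1)]] by blast
      next
        case zero
        then show ?case using cvs.subspace_0[OF center_subspace] by (simp add: br_left)
      next
        case (comb c y z)
        then show ?case
          using cvs.subspace_add[OF center_subspace] cvs.subspace_scale[OF center_subspace] by (simp add: br_left)
      qed
    qed
  qed
  show ?thesis
    by (rule solvable_ideal_central[OF kil_rad_subspace kil_rad_L kil_rad_ideal
        solvable_if_central_brackets[OF kil_rad_subspace kil_rad_L]])
       (use br_rad kil_rad_L in auto)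
qed

text \<open>If \<open>S\<close> is the operator acting on each weight space \<open>L\<^sub>\<gamma>\<close> by \<open>\<gamma> H\<close>, then \<open>S\<close> and \<open>ad H\<close> pair in
  the same way with \<open>ad h\<close> under the trace; comparing the two shows that \<open>[H, x] - \<beta>(H) x\<close> lies in
  the radical of the trace form.\<close>

lemma h_acts_semisimply_mod_center:
  assumes \<beta>: "\<beta> \<in> ext" "x \<in> wt \<beta>" and H: "H \<in> h"
  shows "br H x - \<beta> H *\<^sub>C x \<in> Z"
proof -
  let ?x = "br H x - \<beta> H *\<^sub>C x"
  have xL: "x \<in> L" and HL: "H \<in> L" using \<beta>(2) wt_L H hL by blast+
  have x'w: "?x \<in> wt \<beta>"
    using wt_h_stable[OF H \<beta>(2)] \<beta>(2) wt_subspace by (simp add: cvs.subspace_diff cvs.subspace_scale)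
  then have x'L: "?x \<in> L" using wt_L by blast
  obtain S where S: "clinear S" "\<And>\<gamma> v. \<gamma> \<in> weights \<Longrightarrow> v \<in> wt \<gamma> \<Longrightarrow> S v = \<gamma> H *\<^sub>C v"
    by (rule operator_with_eigenspaces[OF finite_weights wt_fdim wt_subspace weights_independent[OF order_refl],
          of "\<lambda>\<gamma>. \<gamma> H"]) blast
  have SL: "S v \<in> L" if "v \<in> L" for v
    using that
  proof (induction rule: L_induct)
    case (wt \<gamma> x)
    then show ?case using S(2) wt_L cvs.subspace_scale[OF subL] by fastforce
  qed (simp_all add: clinear_simps[OF S(1)] cvs.subspace_0[OF subL] cvs.subspace_add[OF subL] cvs.subspace_scale[OF subL])
  have opS: "SL.op_on S" using S(1) SL by (rule SL.op_onI)
  have opx: "SL.op_on (br x)" by (rule op_br[OF xL])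
  have kilS: "kil H K = trace_on L (\<lambda>v. S (br K v))" if K: "K \<in> h" for K
  proof -
    have lin: "clinear (\<lambda>v. S (br K v))" by (intro clinearI) (simp_all add: br_right clinear_simps[OF S(1)])
    have stab: "S (br K v) \<in> wt \<gamma>" if "\<gamma> \<in> weights" "v \<in> wt \<gamma>" for \<gamma> v
      using S(2)[OF that(1) wt_h_stable[OF K that(2)]] cvs.subspace_scale[OF wt_subspace wt_h_stable[OF K that(2)]] by simp
    have "trace_on L (\<lambda>v. S (br K v)) = (\<Sum>\<gamma>\<in>weights. trace_on (wt \<gamma>) (\<lambda>v. S (br K v)))"
      by (rule trace_weights[OF lin stab])
    also have "\<dots> = (\<Sum>\<gamma>\<in>weights. of_nat (mult \<gamma>) * \<gamma> H * \<gamma> K)"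
    proof (rule sum.cong[OF refl])
      fix \<gamma> assume \<gamma>: "\<gamma> \<in> weights"
      interpret W: fd_space "wt \<gamma>" by (rule wt_fd_space)
      have "trace_on (wt \<gamma>) (\<lambda>v. S (br K v)) = trace_on (wt \<gamma>) (\<lambda>v. \<gamma> H *\<^sub>C br K v)"
        by (rule trace_on_cong[OF _ wt_fdim wt_subspace]) (rule S(2)[OF \<gamma> wt_h_stable[OF K]])
      also have "\<dots> = \<gamma> H * trace_on (wt \<gamma>) (br K)" by (rule W.trace_scale[OF op_on_wt[OF K]])
      finally show "trace_on (wt \<gamma>) (\<lambda>v. S (br K v)) = of_nat (mult \<gamma>) * \<gamma> H * \<gamma> K"
        using weight_trace[OF K, of \<gamma>] by simp
    qed
    finally show ?thesis using kil_h[OF H K] by simp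
  qed
  have comm: "S (br x v) - br x (S v) = \<beta> H *\<^sub>C br x v" if "v \<in> L" for v
    using that
  proof (induction rule: L_induct)
    case (wt \<gamma> v)
    have \<gamma>: "\<gamma> \<in> ext" using wt(1) weights_ext by blast
    have bxv: "br x v \<in> wt (\<lambda>H. \<beta> H + \<gamma> H)" by (rule wt_bracket[OF \<beta>(2) wt(2)])
    have "S (br x v) = (\<beta> H + \<gamma> H) *\<^sub>C br x v"
    proof (cases "(\<lambda>H. \<beta> H + \<gamma> H) \<in> weights")
      case True
      then show ?thesis using S(2) bxv by blast
    next
      case False
      then have "br x v = 0" using wt_not_weight[OF ext_add[OF \<beta>(1) \<gamma>] _ bxv] by blast
      then show ?thesis by (simp add: clinear_simps[OF S(1)])
    qed
    then show ?case using S(2)[OF wt] by (simp add: br_right cvs.scale_left_distrib)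
  next
    case zero
    then show ?case by (simp add: br_right clinear_simps[OF S(1)])
  next
    case (comb c u v)
    have "S (br x (c *\<^sub>C u + v)) - br x (S (c *\<^sub>C u + v))
        = c *\<^sub>C (S (br x u) - br x (S u)) + (S (br x v) - br x (S v))"
      by (simp add: br_right clinear_simps[OF S(1)] cvs.scale_right_diff_distrib)
    then show ?case by (simp add: comb br_right cvs.scale_right_distrib mult.commute)
  qed
  have "kil ?x y = 0" if "y \<in> L" for y
    using that
  proof (induction rule: L_induct)
    case (wt \<gamma> y)
    have \<gamma>: "\<gamma> \<in> ext" using wt(1) weights_ext by blast
    have yL: "y \<in> L" using wt(2) wt_L by blast
    show ?case
    proof (cases "\<exists>H0. \<beta> H0 + \<gamma> H0 \<noteq> 0")
      case True
      then show ?thesis using kil_wt_orthogonal[OF \<beta>(1) x'w \<gamma> wt(2)] by blast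
    next
      case False
      then have "(\<lambda>H. \<beta> H + \<gamma> H) = (\<lambda>_. 0)" by auto
      then have Kh: "br x y \<in> h" using wt_bracket[OF \<beta>(2) wt(2)] by (simp add: wt_0)
      note opy = op_br[OF yL]
      note opxy = SL.op_on_comp[OF opx opy]
      note opSxy = SL.op_on_comp[OF opS opxy] and opSyx = SL.op_on_comp[OF opS SL.op_on_comp[OF opy opx]]
        and opxSy = SL.op_on_comp[OF opx SL.op_on_comp[OF opS opy]]
      have "kil (br H x) y = trace_on L (\<lambda>v. S (br (br x y) v))"
        using kil_invariant[OF HL xL yL] kilS[OF Kh] by simp
      also have "\<dots> = trace_on L (\<lambda>v. S (br x (br y v)) - S (br y (br x v)))"
      proof (rule trace_on_cong[OF _ fdL subL])
        fix v assume "v \<in> L"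
        then have "br (br x y) v = br x (br y v) - br y (br x v)" using jacobi[OF xL yL] by simp
        then show "S (br (br x y) v) = S (br x (br y v)) - S (br y (br x v))" by (simp add: clinear_simps[OF S(1)])
      qed
      also have "\<dots> = trace_on L (\<lambda>v. S (br x (br y v))) - trace_on L (\<lambda>v. S (br y (br x v)))"
        by (rule SL.trace_diff[OF opSxy opSyx])
      also have "trace_on L (\<lambda>v. S (br y (br x v))) = trace_on L (\<lambda>v. br x (S (br y v)))"
        using SL.trace_commute[OF SL.op_on_comp[OF opS opy] opx] .
      also have "trace_on L (\<lambda>v. S (br x (br y v))) - \<dots> = trace_on L (\<lambda>v. S (br x (br y v)) - br x (S (br y v)))"
        by (rule SL.trace_diff[OF opSxy opxSy, symmetric])
      also have "\<dots> = trace_on L (\<lambda>v. \<beta> H *\<^sub>C br x (br y v))"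
        using comm closed[OF yL] by (intro trace_on_cong[OF _ fdL subL]) auto
      also have "\<dots> = \<beta> H * kil x y" unfolding kil_def by (rule SL.trace_scale[OF opxy])
      finally have "kil (br H x) y = \<beta> H * kil x y" .
      moreover have "kil ?x y = kil (br H x) y - \<beta> H * kil x y"
        using kil_add_left[OF closed[OF HL xL] cvs.subspace_scale[OF subL xL] yL, of "- \<beta> H"]
          kil_scale_left[OF xL yL, of "- \<beta> H"] by simp
      ultimately show ?thesis by simp
    qed
  next
    case zero
    then show ?case using kil_scale_right[OF x'L cvs.subspace_0[OF subL], of 0] by simp
  next
    case (comb c u v)
    then show ?case using x'L by (simp add: kil_add_right kil_scale_right cvs.subspace_scale[OF subL])
  qed
  then have "?x \<in> kil_rad" using x'L by (simp add: kil_rad_def)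
  then show ?thesis using kil_rad_center by blast
qed

text \<open>The invariant form enters here: for \<open>z\<close> in the intersection, the functional \<open>(z|\<cdot>)\<close> vanishes
  on the centre, which is the radical of the trace form, so it equals \<open>kil x\<close> for some \<open>x\<close>;
  invariance puts \<open>x\<close> in the second centre, hence in the centre, and then \<open>kil x = 0\<close>.\<close>

lemma center_inter_derived:
  assumes z: "z \<in> Z" and d: "z \<in> cvs.span {br x y |x y. x \<in> L \<and> y \<in> L}"
  shows "z = 0"
proof -
  have zZ: "form g z w = 0" if w: "w \<in> Z" for w
    using d
  proof (induction rule: cvs.span_induct_alt)
    case (step c u v)
    then obtain x y where "u = br x y" "x \<in> L" "y \<in> L" by blast
    then have "form g u w = 0" using form_inv center_br w by (simp add: form_zero_right)
    then show ?case using step by (simp add: form_add_left form_scale_left)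
  qed (simp add: form_zero_left)
  have kilZ: "kil w y = 0" "kil y w = 0" if w: "w \<in> Z" and y: "y \<in> L" for w y
  proof -
    have "kil w y = trace_on L (\<lambda>v. 0)"
      unfolding kil_def by (rule trace_on_cong[OF _ fdL subL]) (simp add: center_br(1)[OF w] closed[OF y])
    also have "\<dots> = 0 * of_nat (cvs.dim L)" by (rule SL.trace_scalar) simp
    finally show "kil w y = 0" by simp
    then show "kil y w = 0" using kil_sym w y center_L by auto
  qed
  obtain BZ where BZ: "finite BZ" "cvs.independent BZ" "cvs.span BZ = Z" "card BZ = cvs.dim Z"
    by (rule fdim_basis[OF fdim_subset[OF fdL center_L] center_subspace])
  have "BZ \<subseteq> L" using BZ(3) cvs.span_superset center_L by blast
  then obtain B where B: "BZ \<subseteq> B" "B \<subseteq> L" "cvs.independent B" "L \<subseteq> cvs.span B"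
    using cvs.maximal_independent_subset_extend[OF _ BZ(2)] by metis
  have finB: "finite B" by (rule fdim_independent_finite[OF fdL B(2,3)])
  have spB: "cvs.span B = L" using B subL by (simp add: cvs.span_subspace)
  define C where "C = B - BZ"
  define M where "M = cvs.span C"
  have CM: "finite C" "cvs.independent C" "cvs.span C = M"
    using finB cvs.independent_mono[OF B(3), of "B - BZ"] by (auto simp: C_def M_def)
  have MsubL: "M \<subseteq> L" unfolding M_def using B(2) by (intro cvs.span_minimal subL) (auto simp: C_def)
  have subM: "cvs.subspace M" by (simp add: M_def)
  have split: "\<exists>a\<in>Z. \<exists>b\<in>M. y = a + b" if "y \<in> L" for y
  proof -
    have "B = BZ \<union> C" using B(1) by (auto simp: C_def)
    then have "y \<in> cvs.span (BZ \<union> C)" using that spB by simp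
    then show ?thesis unfolding cvs.span_Un BZ(3) CM(3) by blast
  qed
  have disj: "x = 0" if "x \<in> Z" "x \<in> M" for x
  proof -
    have "BZ \<union> C = B" using B(1) by (auto simp: C_def)
    show ?thesis
    proof (rule ccontr)
      assume "x \<noteq> 0"
      have rep: "cvs.representation B x = cvs.representation BZ x" "cvs.representation B x = cvs.representation C x"
        using that BZ(3) CM(3) B(1) by (auto intro!: cvs.representation_extend[OF B(3)] simp: C_def)
      have "cvs.representation B x b = 0" for b
        using cvs.representation_ne_zero[of BZ x b] cvs.representation_ne_zero[of C x b] rep by (auto simp: C_def)
      then have "x = 0" using cvs.sum_representation_eq[OF B(3) _ finB order_refl, of x] that MsubL spB by auto
      then show False using \<open>x \<noteq> 0\<close> by simp
    qed
  qed
  obtain e where e: "\<And>b. b \<in> C \<Longrightarrow> e b \<in> M"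
      "\<And>b c. b \<in> C \<Longrightarrow> c \<in> C \<Longrightarrow> kil (e b) c = (if b = c then 1 else 0)"
  proof (rule dual_basis_exists[OF CM, of kil])
    fix x assume x: "x \<in> M" "\<And>y. y \<in> M \<Longrightarrow> kil x y = 0"
    have "kil x y = 0" if yL: "y \<in> L" for y
    proof -
      obtain a b where ab: "a \<in> Z" "b \<in> M" "y = a + b" using split[OF yL] by blast
      then have "kil x y = kil x a + kil x b" using x MsubL center_L by (simp add: kil_add_right subset_iff)
      then show ?thesis using x ab kilZ(2)[of a x] MsubL by auto
    qed
    then have "x \<in> kil_rad" using x(1) MsubL by (auto simp: kil_rad_def)
    then show "x = 0" using disj kil_rad_center x(1) by blast
  qed (use MsubL in \<open>auto intro!: kil_add_left kil_add_right kil_scale_left kil_scale_right\<close>)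
  define x where "x = (\<Sum>b\<in>C. form g z b *\<^sub>C e b)"
  have eL: "e b \<in> L" if "b \<in> C" for b using e(1)[OF that] MsubL by blast
  have xL: "x \<in> L" unfolding x_def by (intro cvs.subspace_sum[OF subL] cvs.subspace_scale[OF subL] eL)
  have kil_sum: "kil (\<Sum>b\<in>A. f b *\<^sub>C e b) y = (\<Sum>b\<in>A. f b * kil (e b) y)" if "A \<subseteq> C" "y \<in> L" for A f y
  proof -
    have "finite A" using that CM(1) finite_subset by blast
    then show ?thesis using that
    proof (induction A rule: finite_induct)
      case (insert b A)
      have "(\<Sum>b\<in>A. f b *\<^sub>C e b) \<in> L"
        using insert.prems eL by (intro cvs.subspace_sum[OF subL] cvs.subspace_scale[OF subL]) auto
      moreover have "e b \<in> L" using insert.prems eL by blast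
      ultimately show ?case using insert
        by (simp add: kil_add_left kil_scale_left cvs.subspace_scale[OF subL])
    qed (simp add: kil_zero_left)
  qed
  have xb: "kil x b = form g z b" if b: "b \<in> C" for b
  proof -
    have "kil x b = (\<Sum>c\<in>C. form g z c * kil (e c) b)"
      unfolding x_def using b B(2) by (intro kil_sum) (auto simp: C_def)
    also have "\<dots> = (\<Sum>c\<in>C. if c = b then form g z c else 0)"
      using e(2) b by (intro sum.cong) auto
    finally show ?thesis using CM(1) b by simp
  qed
  have xM: "kil x y = form g z y" if "y \<in> M" for y
  proof -
    have "y \<in> cvs.span C" using that by (simp add: M_def)
    then have "y \<in> L \<and> kil x y = form g z y"
    proof (induction rule: cvs.span_induct_alt)
      case base
      then show ?case using kil_scale_right[OF xL cvs.subspace_0[OF subL], of 0]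
        by (simp add: cvs.subspace_0[OF subL] form_zero_right)
    next
      case (step c u v)
      then have "u \<in> L" using B(2) by (auto simp: C_def)
      then show ?case using step xL xb
        by (simp add: cvs.subspace_add[OF subL] cvs.subspace_scale[OF subL] kil_add_right kil_scale_right
            form_add_right form_scale_right)
    qed
    then show ?thesis by simp
  qed
  have x_form: "kil x y = form g z y" if yL: "y \<in> L" for y
  proof -
    obtain a b where ab: "a \<in> Z" "b \<in> M" "y = a + b" using split[OF yL] by blast
    then have "kil x y = kil x a + kil x b" using xL MsubL center_L by (simp add: kil_add_right subset_iff)
    then show ?thesis using ab xM kilZ(2)[OF ab(1) xL] zZ by (simp add: form_add_right)
  qed
  have "x \<in> Z"
  proof (rule second_center[OF xL])
    fix y assume y: "y \<in> L"
    have "kil (br x y) w = 0" if w: "w \<in> L" for w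
    proof -
      have "kil (br x y) w = form g z (br y w)"
        using kil_invariant[OF xL y w] x_form[OF closed[OF y w]] by simp
      also have "\<dots> = form g (br z y) w" by (rule form_inv[symmetric])
      finally show ?thesis using center_br(1)[OF z y] by (simp add: form_zero_left)
    qed
    then show "br x y \<in> Z" using closed[OF xL y] kil_rad_center by (auto simp: kil_rad_def)
  qed
  then have "form g z y = 0" if "y \<in> L" for y using x_form[OF that] kilZ(1)[OF _ that] by simp
  then show "z = 0" using form_nondeg z center_L by blast
qed

text \<open>Brackets of elements of \<open>h = wt 0\<close> are central by \<open>h_acts_semisimply_mod_center\<close> and lie in
  the derived algebra.\<close>

lemma h_abelian: "H \<in> h \<Longrightarrow> K \<in> h \<Longrightarrow> br H K = 0"
proof -
  assume H: "H \<in> h" and K: "K \<in> h"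
  have "br H K - 0 *\<^sub>C K \<in> Z"
    by (rule h_acts_semisimply_mod_center[of "\<lambda>_. 0", OF _ _ H]) (use K h_wt_0 in \<open>auto simp: ext_def\<close>)
  then show ?thesis using H K hL by (intro center_inter_derived) (auto intro!: cvs.span_base)
qed

text \<open>The correction term is central, and a central element has weight \<open>0\<close>.\<close>

lemma h_acts_semisimply:
  assumes \<beta>: "\<beta> \<in> ext" "x \<in> wt \<beta>" and H: "H \<in> h" shows "br H x = \<beta> H *\<^sub>C x"
proof (cases "\<beta> = (\<lambda>_. 0)")
  case True
  then show ?thesis using h_abelian H \<beta>(2) by (simp add: wt_0)
next
  case False
  let ?x = "br H x - \<beta> H *\<^sub>C x"
  have "?x \<in> Z" by (rule h_acts_semisimply_mod_center[OF assms])
  moreover have "?x \<in> wt \<beta>"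
    using wt_h_stable[OF H \<beta>(2)] \<beta>(2) wt_subspace by (simp add: cvs.subspace_diff cvs.subspace_scale)
  moreover have "y = 0" if y: "y \<in> Z" "y \<in> wt \<beta>" for y
  proof -
    obtain H0 where H0: "\<beta> H0 \<noteq> 0" using False by blast
    then have h0: "H0 \<in> h" using \<beta>(1) by (auto simp: ext_def)
    then obtain N where N: "(shifted H0 (\<beta> H0) ^^ N) y = 0" using y(2) by (auto simp: wt_def)
    have "shifted H0 (\<beta> H0) y = (- \<beta> H0) *\<^sub>C y" using center_br(2)[OF y(1) hL'[OF h0]] by (simp add: shifted_def)
    then show ?thesis using funpow_eigen_zero[OF clinear_shifted _ N, of "- \<beta> H0"] H0 by simp
  qed
  ultimately have "?x = 0" by blast
  then show ?thesis by simp
qed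

lemma form_wt_orthogonal:
  assumes \<alpha>: "\<alpha> \<in> ext" "x \<in> wt \<alpha>" and \<beta>: "\<beta> \<in> ext" "y \<in> wt \<beta>" and H: "\<alpha> H + \<beta> H \<noteq> 0"
  shows "form g x y = 0"
proof -
  have h: "H \<in> h"
  proof (rule ccontr)
    assume "H \<notin> h"
    then show False using H \<alpha>(1) \<beta>(1) by (simp add: ext_def)
  qed
  have xL: "x \<in> L" using \<alpha>(2) wt_L by blast
  have "\<alpha> H * form g x y = form g (br H x) y"
    unfolding h_acts_semisimply[OF \<alpha> h] by (rule form_scale_left[symmetric])
  also have "\<dots> = form g ((-1) *\<^sub>C br x H) y" using antisym[OF hL'[OF h] xL] by (simp add: scaleC_one)
  also have "\<dots> = - form g x (br H y)" unfolding form_scale_left form_inv by simp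
  also have "\<dots> = - \<beta> H * form g x y" unfolding h_acts_semisimply[OF \<beta> h] form_scale_right by simp
  finally have "(\<alpha> H + \<beta> H) * form g x y = 0" by (simp add: algebra_simps)
  then show ?thesis using H by simp
qed

lemma h_nondeg:
  assumes "H \<in> h" "\<And>K. K \<in> h \<Longrightarrow> form g H K = 0" shows "H = 0"
proof (rule form_nondeg[OF hL'[OF assms(1)]])
  fix y assume "y \<in> L"
  then show "form g H y = 0"
  proof (induction rule: L_induct)
    case (wt \<gamma> y)
    show ?case
    proof (cases "\<gamma> = (\<lambda>_. 0)")
      case True
      then show ?thesis using wt assms(2) by (simp add: wt_0)
    next
      case False
      then obtain H0 where "\<gamma> H0 \<noteq> 0" by blast
      moreover have "\<gamma> \<in> ext" using wt weights_ext by blast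
      ultimately show ?thesis
        using form_wt_orthogonal[of "\<lambda>_. 0" H \<gamma> y H0] wt assms(1) by (simp add: wt_0 ext_def)
    qed
  qed (simp_all add: form_zero_right form_add_right form_scale_right)
qed

text \<open>The bracket \<open>[e, f]\<close> is normalised to represent \<open>\<beta>\<close> under the invariant form.\<close>

definition coroot_triple :: "('a \<Rightarrow> complex) \<Rightarrow> 'a \<Rightarrow> 'a \<Rightarrow> bool" where
  "coroot_triple \<beta> e f \<longleftrightarrow> e \<in> wt \<beta> \<and> f \<in> wt (\<lambda>H. - \<beta> H) \<and> br e f \<in> h \<and> (\<forall>H\<in>h. form g (br e f) H = \<beta> H)"

lemma coroot_triple_exists:
  assumes \<beta>: "\<beta> \<in> weights" shows "\<exists>e f. coroot_triple \<beta> e f"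
proof -
  have \<beta>e: "\<beta> \<in> ext" using \<beta> weights_ext by blast
  obtain e where e: "e \<in> wt \<beta>" "e \<noteq> 0" using \<beta> cvs.subspace_0[OF wt_subspace[of \<beta>]] by (auto simp: weights_def)
  have eL: "e \<in> L" using e wt_L by blast
  have "\<exists>\<gamma>\<in>weights. \<exists>y\<in>wt \<gamma>. form g e y \<noteq> 0"
  proof (rule ccontr)
    assume no: "\<not> ?thesis"
    have "form g e y = 0" if "y \<in> L" for y
      using that by (induction rule: L_induct) (use no in \<open>auto simp: form_zero_right form_add_right form_scale_right\<close>)
    then show False using form_nondeg[OF eL] e(2) by blast
  qed
  then obtain \<gamma> y where y: "\<gamma> \<in> weights" "y \<in> wt \<gamma>" "form g e y \<noteq> 0" by blast
  have \<gamma>e: "\<gamma> \<in> ext" using y(1) weights_ext by blast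
  have "\<beta> H + \<gamma> H = 0" for H using form_wt_orthogonal[OF \<beta>e e(1) \<gamma>e y(2)] y(3) by blast
  then have \<gamma>: "\<gamma> = (\<lambda>H. - \<beta> H)" by (auto simp: eq_neg_iff_add_eq_0 add.commute)
  define f where "f = (1 / form g e y) *\<^sub>C y"
  have f: "f \<in> wt \<gamma>" unfolding f_def by (rule cvs.subspace_scale[OF wt_subspace y(2)])
  have fL: "f \<in> L" using f wt_L by blast
  have th: "br e f \<in> h" using wt_bracket[OF e(1) f] by (simp add: \<gamma> wt_0)
  have "form g (br e f) H = \<beta> H" if H: "H \<in> h" for H
  proof -
    have "br f H = - br H f" by (rule antisym[OF fL hL'[OF H]])
    also have "\<dots> = \<beta> H *\<^sub>C f" using h_acts_semisimply[OF \<gamma>e f H] by (simp add: \<gamma>)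
    finally have "form g (br e f) H = \<beta> H * form g e f" by (simp add: form_inv form_scale_right)
    then show ?thesis using y(3) by (simp add: f_def form_scale_right)
  qed
  then show ?thesis unfolding coroot_triple_def using e f th \<gamma> by blast
qed

lemma zero_weights_central:
  assumes "H \<in> h" "\<And>\<gamma>. \<gamma> \<in> weights \<Longrightarrow> \<gamma> H = 0" shows "H \<in> Z"
proof -
  have "br H y = 0" if "y \<in> L" for y
    using that
  proof (induction rule: L_induct)
    case (wt \<gamma> y)
    then show ?case using h_acts_semisimply[OF _ wt(2) assms(1)] weights_ext assms(2) by auto
  qed (simp_all add: br_right)
  then show ?thesis using hL'[OF assms(1)] by (simp add: lie_center_def)
qed

text \<open>Otherwise all weights vanish on the coroot by the string property, and the coroot is central.\<close>

lemma coroot_nonzero: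
  assumes Z0: "Z = {0}" and \<beta>: "\<beta> \<in> weights" "\<beta> \<noteq> (\<lambda>_. 0)" and ct: "coroot_triple \<beta> e f"
  shows "\<beta> (br e f) \<noteq> 0"
proof
  assume 0: "\<beta> (br e f) = 0"
  have \<beta>e: "\<beta> \<in> ext" using \<beta> weights_ext by blast
  have "br e f \<in> Z"
  proof (rule zero_weights_central)
    show "br e f \<in> h" using ct by (simp add: coroot_triple_def)
    fix \<gamma> assume "\<gamma> \<in> weights"
    then obtain r :: real where "\<gamma> (br e f) = of_real r * \<beta> (br e f)"
      using weight_string[OF \<beta>e] ct unfolding coroot_triple_def by metis
    then show "\<gamma> (br e f) = 0" using 0 by simp
  qed
  then have "\<beta> H = 0" if "H \<in> h" for H using ct that Z0 by (auto simp: coroot_triple_def form_zero_left)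
  then show False using \<beta>(2) \<beta>e by (auto simp: ext_def fun_eq_iff)
qed

text \<open>A vector of \<open>h\<close> orthogonal to all coroots is killed by all weights, hence central.\<close>

lemma coroots_span:
  assumes Z0: "Z = {0}" and ct: "\<And>\<beta>. \<beta> \<in> weights - {\<lambda>_. 0} \<Longrightarrow> coroot_triple \<beta> (e \<beta>) (f \<beta>)"
  shows "h \<subseteq> cvs.span ((\<lambda>\<beta>. br (e \<beta>) (f \<beta>)) ` (weights - {\<lambda>_. 0}))"
proof (rule ccontr)
  let ?T = "cvs.span ((\<lambda>\<beta>. br (e \<beta>) (f \<beta>)) ` (weights - {\<lambda>_. 0}))"
  assume no: "\<not> h \<subseteq> ?T"
  have Th: "?T \<subseteq> h" using ct by (intro cvs.span_minimal subh) (auto simp: coroot_triple_def)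
  have fdh: "fdim h" by (rule fdim_subset[OF fdL hL])
  obtain B0 where B0: "finite B0" "cvs.independent B0" "cvs.span B0 = ?T" "card B0 = cvs.dim ?T"
    by (rule fdim_basis[OF fdim_subset[OF fdh Th]]) simp
  have "B0 \<subseteq> h" using B0(3) Th cvs.span_superset[of B0] by blast
  then obtain B where B: "B0 \<subseteq> B" "B \<subseteq> h" "cvs.independent B" "h \<subseteq> cvs.span B"
    using cvs.maximal_independent_subset_extend[OF _ B0(2)] by metis
  have finB: "finite B" by (rule fdim_independent_finite[OF fdh B(2,3)])
  have spB: "cvs.span B = h" using B subh by (simp add: cvs.span_subspace)
  have "\<not> B \<subseteq> B0"
  proof
    assume "B \<subseteq> B0"
    then have "h \<subseteq> ?T" using cvs.span_mono[of B B0] unfolding spB B0(3) by simp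
    then show False using no by simp
  qed
  then obtain b where b: "b \<in> B" "b \<notin> B0" by blast
  obtain d where d: "\<And>b. b \<in> B \<Longrightarrow> d b \<in> h" "\<And>b c. b \<in> B \<Longrightarrow> c \<in> B \<Longrightarrow> form g (d b) c = (if b = c then 1 else 0)"
  proof (rule dual_basis_exists[OF finB B(3) spB, of "form g"])
    show "x = 0" if "x \<in> h" "\<And>y. y \<in> h \<Longrightarrow> form g x y = 0" for x by (rule h_nondeg[OF that])
    fix d assume "\<And>b. b \<in> B \<Longrightarrow> d b \<in> h" "\<And>b c. b \<in> B \<Longrightarrow> c \<in> B \<Longrightarrow> form g (d b) c = (if b = c then 1 else 0)"
    then show thesis by (rule that)
  qed (simp_all add: form_add_left form_add_right form_scale_left form_scale_right)
  have orth0: "form g (d b) c = 0" if "c \<in> B0" for c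
  proof -
    have "c \<in> B" "b \<noteq> c" using that b(2) B(1) by auto
    then show ?thesis using d(2)[OF b(1)] by simp
  qed
  have orth: "form g (d b) t = 0" if "t \<in> ?T" for t
  proof -
    have "t \<in> cvs.span B0" using that B0(3) by simp
    then show ?thesis
      by (induction rule: cvs.span_induct_alt)
         (simp_all add: orth0 form_zero_right form_add_right form_scale_right)
  qed
  have "d b \<in> Z"
  proof (rule zero_weights_central[OF d(1)[OF b(1)]])
    fix \<gamma> assume \<gamma>: "\<gamma> \<in> weights"
    show "\<gamma> (d b) = 0"
    proof (cases "\<gamma> = (\<lambda>_. 0)")
      case False
      let ?t = "br (e \<gamma>) (f \<gamma>)"
      have "?t \<in> ?T" using \<gamma> False by (intro cvs.span_base) blast
      then have "form g (d b) ?t = 0" by (rule orth)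
      moreover have c: "coroot_triple \<gamma> (e \<gamma>) (f \<gamma>)" using ct \<gamma> False by blast
      moreover have "form g (d b) ?t = form g ?t (d b)"
        using c d(1)[OF b(1)] hL' by (intro form_sym) (auto simp: coroot_triple_def)
      ultimately show ?thesis using d(1)[OF b(1)] by (simp add: coroot_triple_def)
    qed simp
  qed
  then have "d b = 0" using Z0 by blast
  then show False using d(2)[OF b(1) b(1)] by (simp add: form_zero_left)
qed

end

section \<open>Semisimplicity of the Cartan element of sl2\<close>

text \<open>Split off the Fitting component of one eigenvalue and induct on the dimension.\<close>

lemma generalized_eigenvectors_span:
  assumes T: "clinear T" and "fdim W" "cvs.subspace W" "\<And>x. x \<in> W \<Longrightarrow> T x \<in> W"
  shows "W \<subseteq> cvs.span {x\<in>W. \<exists>c N. ((\<lambda>u. T u - c *\<^sub>C u) ^^ N) x = 0}"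
  using assms(2-)
proof (induction "cvs.dim W" arbitrary: W rule: less_induct)
  case less
  show ?case
  proof (cases "W = {0}")
    case True
    then show ?thesis using cvs.span_zero by blast
  next
    case False
    obtain c v where v: "v \<in> W" "v \<noteq> 0" "T v = c *\<^sub>C v"
      by (rule eigenvector_exists[OF T less.prems False])
    define S where "S = (\<lambda>u. T u - c *\<^sub>C u)"
    have S: "clinear S" unfolding S_def by (rule clinear_shift[OF T])
    have SW: "S x \<in> W" if "x \<in> W" for x
      using that less.prems by (simp add: S_def cvs.subspace_diff cvs.subspace_scale)
    obtain n where n: "S ` ((S ^^ n) ` W) = (S ^^ n) ` W"
      "\<And>v. v \<in> (S ^^ n) ` W \<Longrightarrow> S v = 0 \<Longrightarrow> v = 0"
      "\<And>w. w \<in> W \<Longrightarrow> \<exists>u\<in>W. \<exists>v\<in>(S ^^ n) ` W. w = u + v \<and> (S ^^ n) u = 0"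
      by (rule fitting[OF S less.prems(1,2)]) (use SW in auto)
    let ?R = "(S ^^ n) ` W"
    have RW: "?R \<subseteq> W" by (rule funpow_image_stable) (use SW in auto)
    have subR: "cvs.subspace ?R" by (intro clinear_image_subspace clinear_funpow S less.prems)
    have "T x \<in> ?R" if x: "x \<in> ?R" for x
    proof -
      have "S x \<in> S ` ?R" using x by (rule imageI)
      then have "S x \<in> ?R" unfolding n(1) .
      then have "S x + c *\<^sub>C x \<in> ?R" by (rule cvs.subspace_add[OF subR _ cvs.subspace_scale[OF subR x]])
      then show ?thesis by (simp add: S_def)
    qed
    moreover have "v \<notin> ?R" using n(2)[of v] v by (auto simp: S_def)
    then have "cvs.dim ?R < cvs.dim W" using RW v(1) by (intro dim_strict_mono less.prems subR) auto
    ultimately have IH: "?R \<subseteq> cvs.span {x\<in>?R. \<exists>c N. ((\<lambda>u. T u - c *\<^sub>C u) ^^ N) x = 0}"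
      by (intro less.hyps subR fdim_subset[OF less.prems(1) RW])
    also have "\<dots> \<subseteq> cvs.span {x\<in>W. \<exists>c N. ((\<lambda>u. T u - c *\<^sub>C u) ^^ N) x = 0}"
      by (rule cvs.span_mono) (use RW in blast)
    finally have R: "?R \<subseteq> cvs.span {x\<in>W. \<exists>c N. ((\<lambda>u. T u - c *\<^sub>C u) ^^ N) x = 0}" .
    show ?thesis
    proof
      fix w assume "w \<in> W"
      then obtain u v where uv: "u \<in> W" "v \<in> ?R" "w = u + v" "(S ^^ n) u = 0" using n(3) by blast
      then have "u \<in> {x\<in>W. \<exists>c N. ((\<lambda>u. T u - c *\<^sub>C u) ^^ N) x = 0}" unfolding S_def by blast
      then show "w \<in> cvs.span {x\<in>W. \<exists>c N. ((\<lambda>u. T u - c *\<^sub>C u) ^^ N) x = 0}"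
        unfolding uv(3) using R uv(2) by (intro cvs.span_add) (auto intro: cvs.span_base)
    qed
  qed
qed

lemma finite_eigenvalues:
  assumes T: "clinear T" and W: "fdim W" "cvs.subspace W"
  shows "finite {c. \<exists>v\<in>W. v \<noteq> 0 \<and> T v = c *\<^sub>C v}"
proof (rule ccontr)
  assume "infinite {c. \<exists>v\<in>W. v \<noteq> 0 \<and> T v = c *\<^sub>C v}"
  then obtain A where A: "finite A" "card A = Suc (cvs.dim W)" "A \<subseteq> {c. \<exists>v\<in>W. v \<noteq> 0 \<and> T v = c *\<^sub>C v}"
    using infinite_arbitrarily_large by blast
  then have "\<forall>c\<in>A. \<exists>v. v \<in> W \<and> v \<noteq> 0 \<and> T v = c *\<^sub>C v" by blast
  then obtain v where v: "\<And>c. c \<in> A \<Longrightarrow> v c \<in> W \<and> v c \<noteq> 0 \<and> T (v c) = c *\<^sub>C v c" by metis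
  have "independent_spaces A (\<lambda>c. {x. T x = c *\<^sub>C x})"
    unfolding independent_spaces_def
  proof (intro allI impI)
    fix u assume u: "(\<forall>c\<in>A. u c \<in> {x. T x = c *\<^sub>C x}) \<and> sum u A = 0"
    have "\<forall>c\<in>A. u c \<in> {0}"
      by (rule eigen_components_in_stable[OF T cvs.subspace_single_0 _ A(1)]) (use u clinear_simps[OF T] in auto)
    then show "\<forall>c\<in>A. u c = 0" by simp
  qed
  moreover have "cvs.subspace {x. T x = c *\<^sub>C x}" for c
    by (auto simp: cvs.subspace_def clinear_simps[OF T] cvs.scale_right_distrib mult.commute)
  ultimately have "card A \<le> cvs.dim W" by (rule independent_spaces_card_le[OF A(1) _ _ _ W]) (use v in auto)
  then show False using A(2) by simp
qed

locale sl2_rep =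
  fixes e f t :: "'w \<Rightarrow> 'w::complex_vector" and W :: "'w set"
  assumes fdW: "fdim W" and subW: "cvs.subspace W"
    and lin_e: "clinear e" and lin_f: "clinear f" and lin_t: "clinear t"
    and eW: "\<And>v. v \<in> W \<Longrightarrow> e v \<in> W" and fW: "\<And>v. v \<in> W \<Longrightarrow> f v \<in> W" and tW: "\<And>v. v \<in> W \<Longrightarrow> t v \<in> W"
    and te: "\<And>v. v \<in> W \<Longrightarrow> t (e v) = e (t v) + 2 *\<^sub>C e v"
    and tf: "\<And>v. v \<in> W \<Longrightarrow> t (f v) = f (t v) - 2 *\<^sub>C f v"
    and ef: "\<And>v. v \<in> W \<Longrightarrow> e (f v) = f (e v) + t v"
begin

text \<open>For \<open>v\<close> with \<open>D c (D c v) = 0\<close> the aim is \<open>D c v = 0\<close>: generalised eigenvectors are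
  eigenvectors.\<close>

definition D :: "complex \<Rightarrow> 'w \<Rightarrow> 'w" where "D c v = t v - c *\<^sub>C v"

lemma lin_D: "clinear (D c)"
  unfolding D_def by (rule clinear_shift[OF lin_t])

lemma D_W: "v \<in> W \<Longrightarrow> D c v \<in> W"
  using subW tW by (simp add: D_def cvs.subspace_diff cvs.subspace_scale)

lemma D_e: "v \<in> W \<Longrightarrow> D (c + 2) (e v) = e (D c v)"
  by (simp add: D_def te clinear_simps[OF lin_e] cvs.scale_left_distrib)

lemma D_f: "v \<in> W \<Longrightarrow> D (c - 2) (f v) = f (D c v)"
  by (simp add: D_def tf clinear_simps[OF lin_f] cvs.scale_left_diff_distrib)

lemma ePow_W: "v \<in> W \<Longrightarrow> (e ^^ j) v \<in> W" by (rule funpow_stable[OF eW])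
lemma fPow_W: "v \<in> W \<Longrightarrow> (f ^^ j) v \<in> W" by (rule funpow_stable[OF fW])

lemma D_ePow: "v \<in> W \<Longrightarrow> D (c + 2 * of_nat j) ((e ^^ j) v) = (e ^^ j) (D c v)"
proof (induction j)
  case (Suc j)
  have "D (c + 2 * of_nat (Suc j)) ((e ^^ Suc j) v) = D ((c + 2 * of_nat j) + 2) (e ((e ^^ j) v))"
    by (simp add: algebra_simps)
  also have "\<dots> = e ((e ^^ j) (D c v))" using D_e[OF ePow_W[OF Suc.prems]] Suc by simp
  finally show ?case by simp
qed simp

lemma D_fPow: "v \<in> W \<Longrightarrow> D (c - 2 * of_nat j) ((f ^^ j) v) = (f ^^ j) (D c v)"
proof (induction j)
  case (Suc j)
  have "D (c - 2 * of_nat (Suc j)) ((f ^^ Suc j) v) = D ((c - 2 * of_nat j) - 2) (f ((f ^^ j) v))"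
    by (simp add: algebra_simps)
  also have "\<dots> = f ((f ^^ j) (D c v))" using D_f[OF fPow_W[OF Suc.prems]] Suc by simp
  finally show ?case by simp
qed simp

lemma ePow_f:
  "v \<in> W \<Longrightarrow> (e ^^ Suc j) (f v) = f ((e ^^ Suc j) v) + of_nat (Suc j) *\<^sub>C (e ^^ j) (t v + of_nat j *\<^sub>C v)"
proof (induction j arbitrary: v)
  case 0
  then show ?case by (simp add: ef scaleC_one)
next
  case (Suc j)
  note le = clinear_simps[OF clinear_funpow[OF lin_e]]
  have "(e ^^ Suc (Suc j)) (f v) = (e ^^ Suc j) (f (e v) + t v)"
    using ef[OF Suc.prems] by (simp only: funpow_Suc_right comp_apply)
  also have "\<dots> = f ((e ^^ Suc j) (e v)) + of_nat (Suc j) *\<^sub>C (e ^^ j) (t (e v) + of_nat j *\<^sub>C e v) + (e ^^ Suc j) (t v)"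
    using Suc.IH[OF eW[OF Suc.prems]] by (simp only: le)
  also have "t (e v) + of_nat j *\<^sub>C e v = e (t v + (2 + of_nat j) *\<^sub>C v)"
    by (simp add: te[OF Suc.prems] clinear_simps[OF lin_e] cvs.scale_left_distrib)
  also have "f ((e ^^ Suc j) (e v)) + of_nat (Suc j) *\<^sub>C (e ^^ j) (e (t v + (2 + of_nat j) *\<^sub>C v)) + (e ^^ Suc j) (t v)
      = f ((e ^^ Suc (Suc j)) v) + of_nat (Suc j) *\<^sub>C (e ^^ Suc j) (t v + (2 + of_nat j) *\<^sub>C v) + (e ^^ Suc j) (t v)"
    by (simp only: funpow_Suc_right comp_apply)
  also have "\<dots> = f ((e ^^ Suc (Suc j)) v)
      + of_nat (Suc (Suc j)) *\<^sub>C (e ^^ Suc j) (t v + of_nat (Suc j) *\<^sub>C v)"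
  proof -
    let ?a = "(e ^^ Suc j) (t v)" and ?b = "(e ^^ Suc j) v"
    have "of_nat (Suc j) *\<^sub>C (?a + (2 + of_nat j) *\<^sub>C ?b) + ?a
        = (of_nat (Suc j) + 1) *\<^sub>C ?a + (of_nat (Suc j) * (2 + of_nat j)) *\<^sub>C ?b"
      unfolding cvs.scale_right_distrib cvs.scale_left_distrib[of _ 1] scaleC_one cvs.scale_scale
      by (simp only: add.assoc add.left_commute add.commute)
    also have "of_nat (Suc j) + 1 = (of_nat (Suc (Suc j)) :: complex)" by simp
    also have "of_nat (Suc j) * (2 + of_nat j) = (of_nat (Suc (Suc j)) * of_nat (Suc j) :: complex)"
      by (simp add: algebra_simps)
    also have "of_nat (Suc (Suc j)) *\<^sub>C ?a + (of_nat (Suc (Suc j)) * of_nat (Suc j)) *\<^sub>C ?b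
        = of_nat (Suc (Suc j)) *\<^sub>C (?a + of_nat (Suc j) *\<^sub>C ?b)"
      by (simp only: cvs.scale_right_distrib cvs.scale_scale)
    finally show ?thesis by (simp only: le add.assoc)
  qed
  finally show ?case .
qed

lemma fPow_e:
  "v \<in> W \<Longrightarrow> e v = 0 \<Longrightarrow> e ((f ^^ Suc j) v) = of_nat (Suc j) *\<^sub>C (f ^^ j) (t v - of_nat j *\<^sub>C v)"
proof (induction j)
  case 0
  then show ?case by (simp add: ef clinear_simps[OF lin_f] scaleC_one)
next
  case (Suc j)
  note lf = clinear_simps[OF clinear_funpow[OF lin_f]]
  let ?a = "(f ^^ Suc j) (t v)" and ?b = "(f ^^ Suc j) v"
  have t: "t ?b = ?a - (2 * of_nat (Suc j)) *\<^sub>C ?b"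
    using D_fPow[OF Suc.prems(1), of 0 "Suc j"] unfolding D_def
    by (simp add: eq_diff_eq del: funpow.simps of_nat_Suc)
  have "e ((f ^^ Suc (Suc j)) v) = f (e ?b) + t ?b" using ef[OF fPow_W[OF Suc.prems(1)], of "Suc j"] by simp
  also have "e ?b = of_nat (Suc j) *\<^sub>C (f ^^ j) (t v - of_nat j *\<^sub>C v)" by (rule Suc.IH[OF Suc.prems])
  also have "f (of_nat (Suc j) *\<^sub>C (f ^^ j) (t v - of_nat j *\<^sub>C v)) = of_nat (Suc j) *\<^sub>C (f ^^ Suc j) (t v - of_nat j *\<^sub>C v)"
    by (simp only: clinear_simps[OF lin_f] funpow.simps comp_apply)
  also have "\<dots> = of_nat (Suc j) *\<^sub>C (?a - of_nat j *\<^sub>C ?b)" by (simp only: lf)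
  also have "\<dots> + t ?b = of_nat (Suc (Suc j)) *\<^sub>C (?a - of_nat (Suc j) *\<^sub>C ?b)"
  proof -
    have "of_nat (Suc j) *\<^sub>C (?a - of_nat j *\<^sub>C ?b) + t ?b
        = (of_nat (Suc j) + 1) *\<^sub>C ?a - (of_nat (Suc j) * of_nat j + 2 * of_nat (Suc j)) *\<^sub>C ?b"
      unfolding t cvs.scale_right_diff_distrib cvs.scale_left_distrib scaleC_one cvs.scale_scale
      by (simp only: diff_add_eq add_diff_eq diff_diff_eq add.commute add.left_commute)
    also have "of_nat (Suc j) + 1 = (of_nat (Suc (Suc j)) :: complex)" by simp
    also have "of_nat (Suc j) * of_nat j + 2 * of_nat (Suc j) = (of_nat (Suc (Suc j)) * of_nat (Suc j) :: complex)"
      by (simp add: algebra_simps)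
    finally show ?thesis by (simp only: cvs.scale_right_diff_distrib cvs.scale_scale)
  qed
  finally show ?case by (simp only: lf)
qed

lemma nilpotent_on_generalized:
  assumes v: "v \<in> W" "D c (D c v) = 0"
  shows "\<exists>j. (e ^^ j) v = 0" "\<exists>j. (f ^^ j) v = 0"
proof -
  let ?E = "{c. \<exists>v\<in>W. v \<noteq> 0 \<and> t v = c *\<^sub>C v}"
  have fin: "finite ?E" by (rule finite_eigenvalues[OF lin_t fdW subW])
  have mem: "a \<in> ?E" if "x \<in> W" "x \<noteq> 0" "D a (D a x) = 0" for a x
  proof (cases "D a x = 0")
    case True
    then show ?thesis using that by (auto simp: D_def)
  next
    case False
    then show ?thesis using that(3) D_W[OF that(1), of a] unfolding D_def[of a "D a x"] by auto
  qed
  show "\<exists>j. (e ^^ j) v = 0"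
  proof (rule ccontr)
    assume no: "\<nexists>j. (e ^^ j) v = 0"
    have "c + 2 * of_nat j \<in> ?E" for j
      using no v ePow_W D_W
      by (intro mem[of "(e ^^ j) v"]) (simp_all add: D_ePow clinear_simps[OF clinear_funpow[OF lin_e]])
    then have "range (\<lambda>j::nat. c + 2 * of_nat j) \<subseteq> ?E" by blast
    moreover have "inj (\<lambda>j::nat. c + 2 * of_nat j)" by (rule injI) simp
    ultimately show False using fin finite_subset range_inj_infinite by blast
  qed
  show "\<exists>j. (f ^^ j) v = 0"
  proof (rule ccontr)
    assume no: "\<nexists>j. (f ^^ j) v = 0"
    have "c - 2 * of_nat j \<in> ?E" for j
      using no v fPow_W D_W
      by (intro mem[of "(f ^^ j) v"]) (simp_all add: D_fPow clinear_simps[OF clinear_funpow[OF lin_f]])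
    then have "range (\<lambda>j::nat. c - 2 * of_nat j) \<subseteq> ?E" by blast
    moreover have "inj (\<lambda>j::nat. c - 2 * of_nat j)" by (rule injI) simp
    ultimately show False using fin finite_subset range_inj_infinite by blast
  qed
qed

text \<open>The last nonzero vector \<open>f\<^sup>m v\<close> satisfies \<open>f\<^sup>m (t - m) v = 0\<close> by \<open>fPow_e\<close>; separating \<open>t - m\<close>
  into \<open>D c\<close> and the scalar \<open>c - m\<close> gives the claims.\<close>

lemma highest_weight:
  assumes v: "v \<in> W" "v \<noteq> 0" "e v = 0" "D c (D c v) = 0"
  obtains m where "c = of_nat m" "(f ^^ m) v \<noteq> 0" "(f ^^ m) (D c v) = 0"
proof -
  note lf = clinear_simps[OF clinear_funpow[OF lin_f]]
  have ex: "\<exists>j. (f ^^ j) v = 0" by (rule nilpotent_on_generalized(2)[OF v(1,4)])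
  define n where "n = (LEAST j. (f ^^ j) v = 0)"
  have n: "(f ^^ n) v = 0" unfolding n_def by (rule LeastI_ex[OF ex])
  then have "n \<noteq> 0" using v(2) by (auto intro: ccontr)
  then obtain m where m: "n = Suc m" using not0_implies_Suc by blast
  have ne: "(f ^^ m) v \<noteq> 0" using not_less_Least[of m "\<lambda>j. (f ^^ j) v = 0"] m by (simp add: n_def)
  define x where "x = (f ^^ m) (D c v)"
  have "of_nat (Suc m) *\<^sub>C (f ^^ m) (t v - of_nat m *\<^sub>C v) = 0"
    using fPow_e[OF v(1,3), of m] n m by (simp add: clinear_simps[OF lin_e])
  then have "(f ^^ m) (t v - of_nat m *\<^sub>C v) = 0" by (simp add: cvs.scale_eq_0_iff del: of_nat_Suc)
  moreover have "t v - of_nat m *\<^sub>C v = D c v + (c - of_nat m) *\<^sub>C v"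
    by (simp add: D_def cvs.scale_left_diff_distrib)
  ultimately have eq: "x + (c - of_nat m) *\<^sub>C (f ^^ m) v = 0" by (simp add: x_def lf)
  have Dx: "D (c - 2 * of_nat m) x = 0" unfolding x_def using D_fPow[OF D_W[OF v(1)], of c m c] v(4) by (simp add: lf)
  have "D (c - 2 * of_nat m) (x + (c - of_nat m) *\<^sub>C (f ^^ m) v) = (c - of_nat m) *\<^sub>C x"
    using D_fPow[OF v(1), of c m] Dx by (simp add: clinear_simps[OF lin_D] x_def)
  then have "(c - of_nat m) *\<^sub>C x = 0" unfolding eq by (simp add: clinear_simps[OF lin_D])
  then have "c = of_nat m" using eq ne by auto
  then show ?thesis using that[of m] ne eq by (simp add: x_def)
qed

text \<open>If \<open>D c v\<close> were nonzero it would be a highest weight vector with the same \<open>m\<close>, yet \<open>f\<^sup>m\<close> kills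
  it.\<close>

lemma killed_by_e:
  assumes v: "v \<in> W" "e v = 0" "D c (D c v) = 0" shows "D c v = 0"
proof (rule ccontr)
  assume ne: "D c v \<noteq> 0"
  then have v0: "v \<noteq> 0" by (auto simp: clinear_simps[OF lin_D])
  obtain m where m: "c = of_nat m" "(f ^^ m) (D c v) = 0" by (rule highest_weight[OF v(1) v0 v(2,3)])
  have "e (D c v) = 0" using D_e[OF v(1), of c] v(2) by (simp add: clinear_simps[OF lin_D])
  moreover have "D c (D c (D c v)) = 0" using v(3) by (simp add: clinear_simps[OF lin_D])
  ultimately obtain n where "c = of_nat n" "(f ^^ n) (D c v) \<noteq> 0"
    using highest_weight[OF D_W[OF v(1)] ne] by metis
  then show False using m by simp
qed

text \<open>Induction on the power of \<open>e\<close> that kills \<open>v\<close>. As \<open>e \<circ> f\<close> is invertible on generalised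
  eigenvectors whose eigenvalue has positive real part, \<open>e v = e (f u)\<close> for some \<open>u\<close> to which the
  induction hypothesis applies, and \<open>e\<close> kills \<open>v - f u\<close>.\<close>

lemma generalized_eigenvector_nonneg:
  assumes "Re c \<ge> 0" "v \<in> W" "D c (D c v) = 0" shows "D c v = 0"
proof -
  note le = clinear_simps[OF clinear_funpow[OF lin_e]]
  note lD = clinear_simps[OF lin_D]
  have "D c v = 0" if "Re c \<ge> 0" "v \<in> W" "D c (D c v) = 0" "(e ^^ Suc j) v = 0" for j c v
    using that
  proof (induction j arbitrary: c v)
    case 0
    then show ?case by (auto intro: killed_by_e[of v c])
  next
    case (Suc j)
    define K where "K = {u\<in>W. D (c + 2) (D (c + 2) u) = 0 \<and> (e ^^ Suc j) u = 0}"
    have KW: "K \<subseteq> W" by (auto simp: K_def)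
    have subK: "cvs.subspace K" unfolding cvs.subspace_def K_def
      using subW by (simp add: lD le cvs.subspace_0 cvs.subspace_add cvs.subspace_scale del: funpow.simps)
    have lin: "clinear (\<lambda>u. e (f u))" by (intro clinearI) (simp_all add: clinear_simps[OF lin_e] clinear_simps[OF lin_f])
    have "(\<lambda>u. e (f u)) ` K = K"
    proof (rule injective_imp_surjective_on[OF lin fdim_subset[OF fdW KW] subK])
      show "(\<lambda>u. e (f u)) ` K \<subseteq> K"
      proof clarify
        fix u assume u: "u \<in> K"
        then have uW: "u \<in> W" using KW by blast
        have comm: "D a (e (f x)) = e (f (D a x))" if "x \<in> W" for a x
          using D_e[OF fW[OF that], of "a - 2"] D_f[OF that, of a] by simp
        have "D (c + 2) (D (c + 2) (e (f u))) = 0"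
          using u comm[OF uW] comm[OF D_W[OF uW]] by (simp add: K_def clinear_simps[OF lin_e] clinear_simps[OF lin_f])
        moreover have "(e ^^ Suc j) (e (f u)) = 0"
        proof -
          have 0: "(e ^^ Suc j) u = 0" using u by (simp add: K_def)
          have "(e ^^ Suc j) (D 0 u) = D (0 + 2 * of_nat (Suc j)) ((e ^^ Suc j) u)" by (rule D_ePow[OF uW, symmetric])
          then have 1: "(e ^^ Suc j) (t u) = 0" unfolding 0 by (simp add: D_def lD clinear_simps[OF lin_t] del: funpow.simps)
          have "(e ^^ Suc j) (e (f u)) = (e ^^ Suc (Suc j)) (f u)" by (simp only: funpow_Suc_right comp_apply)
          also have "\<dots> = f ((e ^^ Suc (Suc j)) u) + of_nat (Suc (Suc j)) *\<^sub>C (e ^^ Suc j) (t u + of_nat (Suc j) *\<^sub>C u)"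
            by (rule ePow_f[OF uW])
          also have "(e ^^ Suc (Suc j)) u = 0" using 0 by (simp add: clinear_simps[OF lin_e])
          also have "(e ^^ Suc j) (t u + of_nat (Suc j) *\<^sub>C u) = 0" by (simp only: le 0 1) simp
          finally show ?thesis by (simp add: clinear_simps[OF lin_f])
        qed
        ultimately show "e (f u) \<in> K" using eW fW uW by (simp add: K_def)
      qed
    next
      fix u assume u: "u \<in> K" and efu: "e (f u) = 0"
      have uW: "u \<in> W" using u KW by blast
      show "u = 0"
      proof (rule ccontr)
        assume u0: "u \<noteq> 0"
        have ex: "\<exists>i. (e ^^ i) u = 0" using u by (auto simp: K_def simp del: funpow.simps)
        define n where "n = (LEAST i. (e ^^ i) u = 0)"
        have n: "(e ^^ n) u = 0" unfolding n_def by (rule LeastI_ex[OF ex])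
        then have "n \<noteq> 0" using u0 by (auto intro: ccontr)
        then obtain i where i: "n = Suc i" using not0_implies_Suc by blast
        have ne: "(e ^^ i) u \<noteq> 0" using not_less_Least[of i "\<lambda>i. (e ^^ i) u = 0"] i by (simp add: n_def)
        have "(e ^^ Suc i) (f u) = (e ^^ i) (e (f u))" by (simp only: funpow_Suc_right comp_apply)
        then have "of_nat (Suc i) *\<^sub>C (e ^^ i) (t u + of_nat i *\<^sub>C u) = 0"
          using ePow_f[OF uW, of i] n i efu by (simp add: le clinear_simps[OF lin_f] del: of_nat_Suc)
        then have "(e ^^ i) (t u + of_nat i *\<^sub>C u) = 0" by (simp del: of_nat_Suc)
        moreover define \<mu> where "\<mu> = c + 2 + of_nat i"
        moreover have "t u + of_nat i *\<^sub>C u = D (c + 2) u + \<mu> *\<^sub>C u"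
          by (simp add: D_def \<mu>_def cvs.scale_left_distrib)
        moreover define x where "x = (e ^^ i) (D (c + 2) u)"
        ultimately have eq: "x + \<mu> *\<^sub>C (e ^^ i) u = 0" by (simp add: le)
        have "Re \<mu> > 0" using Suc.prems(1) by (simp add: \<mu>_def)
        then have \<mu>0: "\<mu> \<noteq> 0" by auto
        have Dx: "D (c + 2 + 2 * of_nat i) x = 0"
          unfolding x_def D_ePow[OF D_W[OF uW]] using u by (simp add: K_def le)
        have "D (c + 2 + 2 * of_nat i) (x + \<mu> *\<^sub>C (e ^^ i) u) = \<mu> *\<^sub>C x"
          using D_ePow[OF uW, of "c + 2" i] Dx by (simp add: lD x_def)
        then have "\<mu> *\<^sub>C x = 0" unfolding eq by (simp add: lD)
        then show False using eq ne \<mu>0 by simp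
      qed
    qed
    moreover have "e v \<in> K"
    proof -
      have "D (c + 2) (D (c + 2) (e v)) = 0"
        using D_e[OF Suc.prems(2)] D_e[OF D_W[OF Suc.prems(2)]] Suc.prems(3) by (simp add: clinear_simps[OF lin_e])
      moreover have "(e ^^ Suc j) (e v) = 0" using Suc.prems(4) by (simp only: funpow_Suc_right comp_apply)
      ultimately show ?thesis using eW[OF Suc.prems(2)] by (simp add: K_def)
    qed
    ultimately obtain u where u: "u \<in> K" "e v = e (f u)" by blast
    have uW: "u \<in> W" using u(1) KW by blast
    have "D (c + 2) u = 0" by (rule Suc.IH) (use u(1) Suc.prems(1) in \<open>auto simp: K_def\<close>)
    then have Dfu: "D c (f u) = 0" using D_f[OF uW, of "c + 2"] by (simp add: clinear_simps[OF lin_f])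
    have "D c (v - f u) = 0"
      by (rule killed_by_e)
         (use Suc.prems u(2) uW fW Dfu in \<open>auto simp: cvs.subspace_diff[OF subW] clinear_simps[OF lin_e] lD\<close>)
    then show ?case using Dfu by (simp add: lD)
  qed
  moreover obtain j where "(e ^^ j) v = 0" using nilpotent_on_generalized(1)[OF assms(2,3)] by blast
  then have "(e ^^ Suc j) v = 0" by (simp add: clinear_simps[OF lin_e])
  ultimately show ?thesis using assms by blast
qed

text \<open>Exchanging \<open>e\<close> and \<open>f\<close> reduces eigenvalues with negative real part to the case treated above.\<close>

lemma opposite: "sl2_rep f e (\<lambda>v. - t v) W"
proof
  show "- t (f v) = f (- t v) + 2 *\<^sub>C f v" if "v \<in> W" for v
    using tf[OF that] by (simp add: clinear_simps[OF lin_f])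
  show "- t (e v) = e (- t v) - 2 *\<^sub>C e v" if "v \<in> W" for v
    using te[OF that] by (simp add: clinear_simps[OF lin_e])
  show "f (e v) = e (f v) + - t v" if "v \<in> W" for v using ef[OF that] by simp
qed (use fdW subW eW fW tW in \<open>auto simp: clinear_simps[OF lin_e] clinear_simps[OF lin_f] clinear_simps[OF lin_t]
      cvs.subspace_neg cvs.scale_right_distrib\<close>)

lemma generalized_eigenvector:
  assumes "v \<in> W" "D c (D c v) = 0" shows "D c v = 0"
proof (cases "Re c \<ge> 0")
  case True
  then show ?thesis using generalized_eigenvector_nonneg assms by blast
next
  case False
  interpret O: sl2_rep f e "\<lambda>v. - t v" W by (rule opposite)
  have OD: "O.D (- c) x = - D c x" for x by (simp add: O.D_def D_def)
  have "O.D (- c) v = 0"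
    using O.generalized_eigenvector_nonneg[of "- c" v] False assms by (simp add: OD clinear_simps[OF lin_D])
  then show ?thesis by (simp add: OD)
qed

lemma diagonalizable: "W \<subseteq> cvs.span {v\<in>W. \<exists>c. t v = c *\<^sub>C v}"
proof -
  have "D c x = 0" if "(D c ^^ N) x = 0" "x \<in> W" for c N x
    using that
  proof (induction N arbitrary: x)
    case (Suc N)
    have "D c (D c x) = 0" using Suc.prems by (intro Suc.IH D_W) (simp_all add: funpow_swap1)
    then show ?case by (rule generalized_eigenvector[OF Suc.prems(2)])
  qed (simp add: clinear_simps[OF lin_D])
  then have "{x\<in>W. \<exists>c N. ((\<lambda>u. t u - c *\<^sub>C u) ^^ N) x = 0} \<subseteq> {v\<in>W. \<exists>c. t v = c *\<^sub>C v}"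
    unfolding D_def[abs_def] by fastforce
  then show ?thesis using generalized_eigenvectors_span[OF lin_t fdW subW tW] cvs.span_mono by blast
qed

end

section \<open>The Casimir element\<close>

definition bilinear_map :: "('a::complex_vector \<Rightarrow> 'a \<Rightarrow> 'b::complex_vector) \<Rightarrow> bool" where
  "bilinear_map F \<longleftrightarrow> (\<forall>x. clinear (F x)) \<and> (\<forall>y. clinear (\<lambda>x. F x y))"

lemma bilinear_map_sum:
  assumes "bilinear_map F"
  shows "F x (\<Sum>i\<in>A. c i *\<^sub>C y i) = (\<Sum>i\<in>A. c i *\<^sub>C F x (y i))"
    and "F (\<Sum>i\<in>A. c i *\<^sub>C y i) x = (\<Sum>i\<in>A. c i *\<^sub>C F (y i) x)"
proof -
  have "clinear (F x)" "clinear (\<lambda>y. F y x)" using assms by (auto simp: bilinear_map_def)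
  note l = clinear_simps[OF this(1)] clinear_simps[OF this(2)]
  show "F x (\<Sum>i\<in>A. c i *\<^sub>C y i) = (\<Sum>i\<in>A. c i *\<^sub>C F x (y i))"
    and "F (\<Sum>i\<in>A. c i *\<^sub>C y i) x = (\<Sum>i\<in>A. c i *\<^sub>C F (y i) x)" by (simp_all add: l)
qed

locale basic_superalgebra =
  fixes g :: "'g::complex_vector super_lie"
  assumes basic: "basic_lie_superalgebra g"
begin

lemma lie_super: "lie_superalgebra g" and reductive_even: "reductive_lie g (gpar g 0)"
  and inv_form: "invariant_form g"
  using basic by (simp_all add: basic_lie_superalgebra_def simple_lie_superalgebra_def)

lemma simple:
  assumes "graded_subspace (gpar g) I" "\<And>x y. y \<in> I \<Longrightarrow> brk g x y \<in> I" shows "I = {0} \<or> I = UNIV"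
proof -
  have "\<forall>I. graded_subspace (gpar g) I \<and> (\<forall>x. \<forall>y\<in>I. brk g x y \<in> I) \<longrightarrow> I = {0} \<or> I = UNIV"
    using basic unfolding basic_lie_superalgebra_def simple_lie_superalgebra_def by (elim conjE)
  then show ?thesis using assms by (elim allE[of _ I]) auto
qed

lemma nonzero_vector: obtains w :: 'g where "w \<noteq> 0"
proof -
  have "\<exists>x y. brk g x y \<noteq> 0"
    using basic unfolding basic_lie_superalgebra_def simple_lie_superalgebra_def by (elim conjE)
  then show ?thesis using that by (elim exE)
qed

lemma fdim_g: "fdim (W :: 'g set)"
proof -
  obtain E :: "'g set" where "finite E" "cvs.span E = UNIV"
    using basic unfolding basic_lie_superalgebra_def by (elim conjE exE)
  then show ?thesis unfolding fdim_def by (intro exI[of _ E]) simp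
qed

lemma super: "superspace (gpar g)"
  using lie_super unfolding lie_superalgebra_def by (elim conjE)

lemma par_subspace: "cvs.subspace (gpar g p)"
  using super by (simp add: superspace_def)

lemma par_inter: "x \<in> gpar g 0 \<Longrightarrow> x \<in> gpar g 1 \<Longrightarrow> x = 0"
  using super by (auto simp: superspace_def)

lemma par_decompose: obtains a b where "a \<in> gpar g 0" "b \<in> gpar g 1" "x = a + b"
proof -
  have "\<forall>v. \<exists>a\<in>gpar g 0. \<exists>b\<in>gpar g 1. v = a + b"
    using super unfolding superspace_def by (elim conjE)
  then have "\<exists>a\<in>gpar g 0. \<exists>b\<in>gpar g 1. x = a + b" by (rule spec)
  then show ?thesis using that by (elim bexE)
qed

lemma brk_linear: "clinear (brk g x)" "clinear (\<lambda>x. brk g x y)"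
proof -
  have "\<forall>x. clinear (brk g x)"
    using lie_super unfolding lie_superalgebra_def by (elim conjE)
  moreover have "\<forall>y. clinear (\<lambda>x. brk g x y)"
    using lie_super unfolding lie_superalgebra_def by (elim conjE)
  ultimately show "clinear (brk g x)" and "clinear (\<lambda>x. brk g x y)" by simp_all
qed

lemmas brk_simps = clinear_simps[OF brk_linear(1)] clinear_simps[OF brk_linear(2)]

lemma brk_par: "x \<in> gpar g p \<Longrightarrow> y \<in> gpar g q \<Longrightarrow> brk g x y \<in> gpar g (p + q)"
proof -
  have "\<forall>p q. \<forall>x\<in>gpar g p. \<forall>y\<in>gpar g q. brk g x y \<in> gpar g (p + q)"
    using lie_super unfolding lie_superalgebra_def by (elim conjE)
  then show "x \<in> gpar g p \<Longrightarrow> y \<in> gpar g q \<Longrightarrow> brk g x y \<in> gpar g (p + q)" by simp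
qed

lemma brk_antisym:
  assumes "x \<in> gpar g p" "y \<in> gpar g q" shows "brk g x y = - (koszul p q *\<^sub>C brk g y x)"
proof -
  have "\<forall>p q. \<forall>x\<in>gpar g p. \<forall>y\<in>gpar g q. brk g x y = - (koszul p q *\<^sub>C brk g y x)"
    using lie_super unfolding lie_superalgebra_def by (elim conjE)
  then show ?thesis using assms by (elim allE ballE) auto
qed

lemma brk_jacobi:
  assumes "x \<in> gpar g p" "y \<in> gpar g q"
  shows "brk g x (brk g y z) = brk g (brk g x y) z + koszul p q *\<^sub>C brk g y (brk g x z)"
proof -
  have "\<forall>p q. \<forall>x\<in>gpar g p. \<forall>y\<in>gpar g q. \<forall>z.
      brk g x (brk g y z) = brk g (brk g x y) z + koszul p q *\<^sub>C brk g y (brk g x z)"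
    using lie_super unfolding lie_superalgebra_def by (elim conjE)
  then show ?thesis using assms by (elim allE ballE) auto
qed

lemma koszul_simps: "koszul 0 p = 1" "koszul p 0 = 1" "koszul p q * koszul p q = 1"
  by (simp_all add: koszul_def)

lemma koszul_commute: "koszul p q = koszul q p"
  by (simp add: koszul_def conj_commute)

lemma brk_even: "x \<in> gpar g 0 \<Longrightarrow> brk g y x = - brk g x y"
proof -
  assume x: "x \<in> gpar g 0"
  obtain a b where "a \<in> gpar g 0" "b \<in> gpar g 1" "y = a + b" by (rule par_decompose)
  then show ?thesis using brk_antisym[OF _ x, of a 0] brk_antisym[OF _ x, of b 1]
    by (simp add: brk_simps koszul_simps scaleC_one)
qed

lemma form_linear: "cfunctional (form g x)" "cfunctional (\<lambda>x. form g x y)"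
proof -
  have "(\<forall>x. cfunctional (form g x)) \<and> (\<forall>y. cfunctional (\<lambda>x. form g x y))"
    using inv_form unfolding invariant_form_def by (elim conjE) (rule conjI)
  then show "cfunctional (form g x)" and "cfunctional (\<lambda>x. form g x y)" by simp_all
qed

lemma form_simps:
  "form g x (y + z) = form g x y + form g x z" "form g x (c *\<^sub>C y) = c * form g x y"
  "form g (y + z) x = form g y x + form g z x" "form g (c *\<^sub>C y) x = c * form g y x"
  "form g x 0 = 0" "form g 0 x = 0" "form g (y - z) x = form g y x - form g z x"
proof -
  have l: "\<And>x y z. form g x (y + z) = form g x y + form g x z" "\<And>x y c. form g x (c *\<^sub>C y) = c * form g x y"
    "\<And>x y z. form g (y + z) x = form g y x + form g z x" "\<And>x y c. form g (c *\<^sub>C y) x = c * form g y x"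
    using form_linear by (simp_all add: Vector_Spaces.linear_iff)
  show "form g x (y + z) = form g x y + form g x z" "form g x (c *\<^sub>C y) = c * form g x y"
    "form g (y + z) x = form g y x + form g z x" "form g (c *\<^sub>C y) x = c * form g y x" by (rule l)+
  show "form g x 0 = 0" using l(2)[of x 0 0] by simp
  show "form g 0 x = 0" using l(4)[of 0 0 x] by simp
  show "form g (y - z) x = form g y x - form g z x" using l(3)[of "y - z" z x] by simp
qed

lemma form_sum_right: "form g x (\<Sum>i\<in>A. u i) = (\<Sum>i\<in>A. form g x (u i))"
  by (induction A rule: infinite_finite_induct) (simp_all add: form_simps)

lemma form_sum_left: "form g (\<Sum>i\<in>A. u i) x = (\<Sum>i\<in>A. form g (u i) x)"
  by (induction A rule: infinite_finite_induct) (simp_all add: form_simps)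

lemma form_orthogonal:
  assumes "x \<in> gpar g p" "y \<in> gpar g q" "p \<noteq> q" shows "form g x y = 0"
proof -
  have "\<forall>x\<in>gpar g 0. \<forall>y\<in>gpar g 1. form g x y = 0 \<and> form g y x = 0"
    using inv_form unfolding invariant_form_def by (elim conjE)
  then show ?thesis using assms by (cases p; cases q) auto
qed

lemma form_supersym:
  assumes "x \<in> gpar g p" "y \<in> gpar g q" shows "form g x y = koszul p q * form g y x"
proof -
  have "\<forall>p q. \<forall>x\<in>gpar g p. \<forall>y\<in>gpar g q. form g x y = koszul p q * form g y x"
    using inv_form unfolding invariant_form_def by (elim conjE)
  then show ?thesis using assms by (elim allE ballE) auto
qed

lemma form_invariant: "form g (brk g x y) z = form g x (brk g y z)"
proof -
  have "\<forall>x y z. form g (brk g x y) z = form g x (brk g y z)"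
    using inv_form unfolding invariant_form_def by (elim conjE)
  then show ?thesis by (elim allE)
qed

lemma form_nondegenerate: "(\<And>y. form g x y = 0) \<Longrightarrow> x = 0"
proof -
  have "\<forall>x. (\<forall>y. form g x y = 0) \<longrightarrow> x = 0"
    using inv_form unfolding invariant_form_def by (elim conjE)
  then show "(\<And>y. form g x y = 0) \<Longrightarrow> x = 0" by simp
qed

lemma form_even_sym: "x \<in> gpar g 0 \<Longrightarrow> form g x y = form g y x"
proof -
  assume x: "x \<in> gpar g 0"
  obtain a b where "a \<in> gpar g 0" "b \<in> gpar g 1" "y = a + b" by (rule par_decompose)
  then show ?thesis using form_supersym[OF x, of a 0] form_supersym[OF x, of b 1]
    by (simp add: form_simps koszul_simps)
qed

lemma form_nondegenerate_par: "x \<in> gpar g p \<Longrightarrow> (\<And>y. y \<in> gpar g p \<Longrightarrow> form g x y = 0) \<Longrightarrow> x = 0"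
proof (rule form_nondegenerate)
  fix y assume x: "x \<in> gpar g p" and 0: "\<And>y. y \<in> gpar g p \<Longrightarrow> form g x y = 0"
  obtain a b where ab: "a \<in> gpar g 0" "b \<in> gpar g 1" "y = a + b" by (rule par_decompose)
  show "form g x y = 0"
    using 0 ab form_orthogonal[OF x ab(1)] form_orthogonal[OF x ab(2)] by (cases p) (auto simp: form_simps)
qed

lemma dual_bases_par: "\<exists>n a b. dual_bases g (gpar g p) n a b"
proof -
  obtain B where B: "finite B" "cvs.independent B" "cvs.span B = gpar g p" "card B = cvs.dim (gpar g p)"
    by (rule fdim_basis[OF fdim_g par_subspace])
  obtain d where d: "\<And>b. b \<in> B \<Longrightarrow> d b \<in> gpar g p"
      "\<And>b c. b \<in> B \<Longrightarrow> c \<in> B \<Longrightarrow> form g (d b) c = (if b = c then 1 else 0)"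
  proof (rule dual_basis_exists[OF B(1-3), of "form g"])
    show "x = 0" if "x \<in> gpar g p" "\<And>y. y \<in> gpar g p \<Longrightarrow> form g x y = 0" for x
      by (rule form_nondegenerate_par[OF that])
    fix d assume "\<And>b. b \<in> B \<Longrightarrow> d b \<in> gpar g p" "\<And>b c. b \<in> B \<Longrightarrow> c \<in> B \<Longrightarrow> form g (d b) c = (if b = c then 1 else 0)"
    then show thesis by (rule that)
  qed (simp_all add: form_simps)
  obtain a where a: "bij_betw a {0..<card B} B" using ex_bij_betw_nat_finite[OF B(1)] by blast
  have aB: "a i \<in> B" if "i < card B" for i using a that by (auto simp: bij_betw_def)
  have im: "a ` {..<card B} = B" using a by (simp add: bij_betw_def atLeast0LessThan)
  have inj: "a i = a j \<longleftrightarrow> i = j" if "i < card B" "j < card B" for i j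
    using a that by (auto simp: bij_betw_def inj_on_def)
  have "dual_bases g (gpar g p) (card B) a (\<lambda>i. d (a i))"
    unfolding dual_bases_def using aB d im inj B(3) cvs.span_base[of _ B] by auto
  then show ?thesis by blast
qed

definition homogeneous_dual_bases :: "nat \<Rightarrow> (nat \<Rightarrow> 'g) \<Rightarrow> (nat \<Rightarrow> 'g) \<Rightarrow> (nat \<Rightarrow> bit) \<Rightarrow> bool" where
  "homogeneous_dual_bases n a b p \<longleftrightarrow> dual_bases g UNIV n a b \<and> (\<forall>i<n. a i \<in> gpar g (p i) \<and> b i \<in> gpar g (p i))"

lemma homogeneous_dual_bases_exist: "\<exists>n a b p. homogeneous_dual_bases n a b p"
proof -
  obtain n0 a0 b0 where 0: "dual_bases g (gpar g 0) n0 a0 b0" using dual_bases_par by blast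
  obtain n1 a1 b1 where 1: "dual_bases g (gpar g 1) n1 a1 b1" using dual_bases_par by blast
  define a where "a i = (if i < n0 then a0 i else a1 (i - n0))" for i
  define b where "b i = (if i < n0 then b0 i else b1 (i - n0))" for i
  define p :: "nat \<Rightarrow> bit" where "p i = (if i < n0 then 0 else 1)" for i
  let ?n = "n0 + n1"
  have hom: "a i \<in> gpar g (p i) \<and> b i \<in> gpar g (p i)" if "i < ?n" for i
    using that 0 1 by (auto simp: a_def b_def p_def dual_bases_def)
  have dual: "form g (b i) (a j) = (if i = j then 1 else 0)" if ij: "i < ?n" "j < ?n" for i j
  proof (cases "p i = p j")
    case True
    then consider "i < n0" "j < n0" | "\<not> i < n0" "\<not> j < n0" by (auto simp: p_def split: if_splits)
    then show ?thesis
    proof cases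
      case 1
      then show ?thesis using 0 by (simp add: a_def b_def dual_bases_def)
    next
      case 2
      then have "i - n0 < n1" "j - n0 < n1" "i - n0 = j - n0 \<longleftrightarrow> i = j" using ij by auto
      then show ?thesis using 1 2 by (simp add: a_def b_def dual_bases_def)
    qed
  next
    case False
    then have "i \<noteq> j" by auto
    then show ?thesis using form_orthogonal[of "b i" "p i" "a j" "p j"] hom ij False by simp
  qed
  have "a0 ` {..<n0} \<subseteq> a ` {..<?n}" by (force simp: a_def)
  moreover have "a1 ` {..<n1} \<subseteq> a ` {..<?n}"
  proof clarify
    fix i assume "i < n1"
    then have "a (i + n0) = a1 i" "i + n0 \<in> {..<?n}" by (auto simp: a_def)
    then show "a1 i \<in> a ` {..<?n}" by (metis image_eqI)
  qed
  ultimately have sub: "gpar g 0 \<subseteq> cvs.span (a ` {..<?n})" "gpar g 1 \<subseteq> cvs.span (a ` {..<?n})"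
    using 0 1 cvs.span_mono unfolding dual_bases_def by (metis, metis)
  have "x \<in> cvs.span (a ` {..<?n})" for x
  proof -
    obtain u v where "u \<in> gpar g 0" "v \<in> gpar g 1" "x = u + v" by (rule par_decompose)
    then show ?thesis using sub by (auto intro: cvs.span_add)
  qed
  then have "dual_bases g UNIV ?n a b" unfolding dual_bases_def using dual by auto
  then show ?thesis using hom unfolding homogeneous_dual_bases_def by blast
qed

lemma dual_bases_expand: "dual_bases g UNIV n a b \<Longrightarrow> x = (\<Sum>i<n. form g (b i) x *\<^sub>C a i)"
proof -
  assume d: "dual_bases g UNIV n a b"
  then have "x \<in> cvs.span (a ` {..<n})" by (simp add: dual_bases_def)
  then show ?thesis
  proof (induction rule: cvs.span_induct_alt)
    case (step c u y)
    then obtain j where j: "j < n" "u = a j" by blast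
    have "(\<Sum>i<n. form g (b i) u *\<^sub>C a i) = (\<Sum>i<n. if i = j then a i else 0)"
      using d j by (intro sum.cong) (auto simp: dual_bases_def scaleC_one)
    then have u: "(\<Sum>i<n. form g (b i) u *\<^sub>C a i) = u" using j by simp
    have "(\<Sum>i<n. form g (b i) (c *\<^sub>C u + y) *\<^sub>C a i)
        = c *\<^sub>C (\<Sum>i<n. form g (b i) u *\<^sub>C a i) + (\<Sum>i<n. form g (b i) y *\<^sub>C a i)"
      by (simp add: form_simps cvs.scale_left_distrib sum.distrib cvs.scale_sum_right)
    then show ?case using step(2) u by simp
  qed (simp add: form_simps)
qed

lemma dual_bases_expand': "dual_bases g UNIV n a b \<Longrightarrow> x = (\<Sum>i<n. form g x (a i) *\<^sub>C b i)"
proof -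
  assume d: "dual_bases g UNIV n a b"
  let ?y = "x - (\<Sum>i<n. form g x (a i) *\<^sub>C b i)"
  have a: "form g ?y (a j) = 0" if "j < n" for j
  proof -
    have "(\<Sum>i<n. form g x (a i) * form g (b i) (a j)) = (\<Sum>i<n. if i = j then form g x (a i) else 0)"
      using d that by (intro sum.cong) (auto simp: dual_bases_def)
    then show ?thesis using that by (simp add: form_simps form_sum_left)
  qed
  have "form g ?y y = 0" for y
    by (subst dual_bases_expand[OF d, of y]) (simp add: form_sum_right form_simps(2) a)
  then have "?y = 0" by (rule form_nondegenerate)
  then show ?thesis by simp
qed

lemma casimir_eq:
  assumes d: "dual_bases g UNIV n a b" and F: "bilinear_map F"
  shows "casimir g UNIV F = (\<Sum>i<n. F (a i) (b i))"
proof -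
  have "(\<Sum>i<m. F (u i) (v i)) = (\<Sum>i<n. F (a i) (b i))" if d': "dual_bases g UNIV m u v" for m u v
  proof -
    have "(\<Sum>i<m. F (u i) (v i)) = (\<Sum>i<m. \<Sum>j<n. form g (b j) (u i) *\<^sub>C F (a j) (v i))"
      by (subst dual_bases_expand[OF d]) (simp add: bilinear_map_sum[OF F])
    also have "\<dots> = (\<Sum>j<n. \<Sum>i<m. form g (b j) (u i) *\<^sub>C F (a j) (v i))" by (rule sum.swap)
    also have "\<dots> = (\<Sum>j<n. F (a j) (\<Sum>i<m. form g (b j) (u i) *\<^sub>C v i))"
      by (simp add: bilinear_map_sum[OF F])
    also have "\<dots> = (\<Sum>j<n. F (a j) (b j))" by (simp add: dual_bases_expand'[OF d', symmetric])
    finally show ?thesis .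
  qed
  then show ?thesis unfolding casimir_def using d by (intro some_equality) (blast, metis)
qed

text \<open>The Casimir tensor is supersymmetric.\<close>

lemma casimir_swap:
  assumes h: "homogeneous_dual_bases n a b p" and F: "bilinear_map F"
  shows "(\<Sum>i<n. F (a i) (b i)) = (\<Sum>i<n. koszul (p i) (p i) *\<^sub>C F (b i) (a i))"
proof -
  have d: "dual_bases g UNIV n a b" using h by (simp add: homogeneous_dual_bases_def)
  have "(\<Sum>i<n. F (a i) (b i)) = (\<Sum>i<n. \<Sum>j<n. form g (b j) (b i) *\<^sub>C F (a i) (a j))"
    by (rule sum.cong[OF refl], subst dual_bases_expand[OF d, of "b _"]) (simp add: bilinear_map_sum[OF F])
  also have "\<dots> = (\<Sum>j<n. \<Sum>i<n. form g (b j) (b i) *\<^sub>C F (a i) (a j))" by (rule sum.swap)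
  also have "\<dots> = (\<Sum>j<n. \<Sum>i<n. koszul (p j) (p j) *\<^sub>C form g (b i) (b j) *\<^sub>C F (a i) (a j))"
  proof (intro sum.cong refl)
    fix i j assume ij: "j \<in> {..<n}" "i \<in> {..<n}"
    then have b: "b i \<in> gpar g (p i)" "b j \<in> gpar g (p j)" using h by (auto simp: homogeneous_dual_bases_def)
    have "form g (b j) (b i) = koszul (p j) (p j) * form g (b i) (b j)"
    proof (cases "p i = p j")
      case True
      then show ?thesis using form_supersym[OF b(2,1)] by simp
    next
      case False
      then show ?thesis using form_orthogonal[OF b] form_orthogonal[OF b(2,1)] by simp
    qed
    then show "form g (b j) (b i) *\<^sub>C F (a i) (a j) = koszul (p j) (p j) *\<^sub>C form g (b i) (b j) *\<^sub>C F (a i) (a j)"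
      by simp
  qed
  also have "\<dots> = (\<Sum>j<n. koszul (p j) (p j) *\<^sub>C F (\<Sum>i<n. form g (b i) (b j) *\<^sub>C a i) (a j))"
    by (simp add: bilinear_map_sum[OF F] cvs.scale_sum_right)
  also have "\<dots> = (\<Sum>j<n. koszul (p j) (p j) *\<^sub>C F (b j) (a j))"
    by (simp add: dual_bases_expand[OF d, symmetric])
  finally show ?thesis .
qed

text \<open>The Casimir tensor is invariant under the adjoint action: both sides have the same
  coefficients because the form is invariant.\<close>

lemma casimir_invariant:
  assumes d: "dual_bases g UNIV n a b" and F: "bilinear_map F"
  shows "(\<Sum>i<n. F (brk g x (a i)) (b i)) = (\<Sum>i<n. F (a i) (brk g (b i) x))"
proof -
  have "(\<Sum>i<n. F (brk g x (a i)) (b i)) = (\<Sum>i<n. \<Sum>j<n. form g (b j) (brk g x (a i)) *\<^sub>C F (a j) (b i))"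
    by (rule sum.cong[OF refl], subst dual_bases_expand[OF d, of "brk g x (a _)"]) (simp add: bilinear_map_sum[OF F])
  also have "\<dots> = (\<Sum>j<n. \<Sum>i<n. form g (b j) (brk g x (a i)) *\<^sub>C F (a j) (b i))" by (rule sum.swap)
  also have "\<dots> = (\<Sum>j<n. F (a j) (\<Sum>i<n. form g (brk g (b j) x) (a i) *\<^sub>C b i))"
    by (simp add: bilinear_map_sum[OF F] form_invariant)
  also have "\<dots> = (\<Sum>j<n. F (a j) (brk g (b j) x))" by (simp add: dual_bases_expand'[OF d, symmetric])
  finally show ?thesis .
qed

lemma casimir_even_invariant:
  assumes d: "dual_bases g UNIV n a b" and F: "bilinear_map F" and x: "x \<in> gpar g 0"
  shows "(\<Sum>i<n. F (brk g x (a i)) (b i) + F (a i) (brk g x (b i))) = 0"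
proof -
  have "F u (- v) = - F u v" for u v using F clinear_simps(5)[of "F u" v] by (simp add: bilinear_map_def)
  then show ?thesis
    using casimir_invariant[OF d F, of x] by (simp add: sum.distrib brk_even[OF x] sum_negf)
qed

lemma bilinear_brk: "bilinear_map (brk g)"
  by (simp add: bilinear_map_def brk_linear)

lemma bilinear_brk_brk: "bilinear_map (\<lambda>x y. brk g x (brk g y v))"
  unfolding bilinear_map_def by (auto intro!: clinearI simp: brk_simps)

lemma casimir_bracket_zero:
  assumes h: "homogeneous_dual_bases n a b p" shows "(\<Sum>i<n. brk g (a i) (b i)) = 0"
proof -
  let ?s = "\<Sum>i<n. brk g (a i) (b i)"
  have "?s = (\<Sum>i<n. koszul (p i) (p i) *\<^sub>C brk g (b i) (a i))" by (rule casimir_swap[OF h bilinear_brk])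
  also have "\<dots> = (\<Sum>i<n. - brk g (a i) (b i))"
  proof (rule sum.cong[OF refl])
    fix i assume "i \<in> {..<n}"
    then have "b i \<in> gpar g (p i)" "a i \<in> gpar g (p i)" using h by (auto simp: homogeneous_dual_bases_def)
    then show "koszul (p i) (p i) *\<^sub>C brk g (b i) (a i) = - brk g (a i) (b i)"
      using brk_antisym[of "b i" "p i" "a i" "p i"] by (simp add: koszul_simps scaleC_one)
  qed
  also have "\<dots> = - ?s" by (simp add: sum_negf)
  finally have "?s + ?s = 0" by (simp add: eq_neg_iff_add_eq_0)
  then have "(2::complex) *\<^sub>C ?s = 0" using scaleC_add_left[of 1 1 ?s] by (simp add: scaleC_one)
  then show ?thesis by simp
qed

text \<open>An eigenspace of the Casimir operator is a graded ideal of \<open>g\<close>, as the operator is even and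
  commutes with the adjoint action.\<close>

lemma casimir_scalar:
  assumes h: "homogeneous_dual_bases n a b p"
  shows "\<exists>c. \<forall>v. (\<Sum>i<n. brk g (a i) (brk g (b i) v)) = c *\<^sub>C v"
proof -
  define \<Omega> where "\<Omega> v = (\<Sum>i<n. brk g (a i) (brk g (b i) v))" for v
  have d: "dual_bases g UNIV n a b" using h by (simp add: homogeneous_dual_bases_def)
  have ab: "a i \<in> gpar g (p i)" "b i \<in> gpar g (p i)" if "i < n" for i
    using h that by (auto simp: homogeneous_dual_bases_def)
  have lin: "clinear \<Omega>"
    unfolding \<Omega>_def by (intro clinearI) (simp_all add: brk_simps sum.distrib cvs.scale_sum_right)
  have comm: "brk g x (\<Omega> v) = \<Omega> (brk g x v)" if x: "x \<in> gpar g q" for x q v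
  proof -
    have "brk g x (\<Omega> v) = (\<Sum>i<n. brk g x (brk g (a i) (brk g (b i) v)))" by (simp add: \<Omega>_def brk_simps)
    also have "\<dots> = (\<Sum>i<n. brk g (brk g x (a i)) (brk g (b i) v)
        - brk g (a i) (brk g (brk g (b i) x) v) + brk g (a i) (brk g (b i) (brk g x v)))"
    proof (rule sum.cong[OF refl])
      fix i assume "i \<in> {..<n}"
      then have i: "a i \<in> gpar g (p i)" "b i \<in> gpar g (p i)" using ab by auto
      have "koszul q (p i) *\<^sub>C brk g (a i) (brk g x (brk g (b i) v))
          = brk g (a i) (brk g (koszul q (p i) *\<^sub>C brk g x (b i)) v) + brk g (a i) (brk g (b i) (brk g x v))"
        unfolding brk_jacobi[OF x i(2)] by (simp add: brk_simps cvs.scale_right_distrib koszul_simps scaleC_one)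
      also have "koszul q (p i) *\<^sub>C brk g x (b i) = - brk g (b i) x"
        using brk_antisym[OF i(2) x] by (simp add: koszul_commute)
      finally show "brk g x (brk g (a i) (brk g (b i) v)) = brk g (brk g x (a i)) (brk g (b i) v)
        - brk g (a i) (brk g (brk g (b i) x) v) + brk g (a i) (brk g (b i) (brk g x v))"
        unfolding brk_jacobi[OF x i(1)] by (simp add: brk_simps)
    qed
    also have "\<dots> = \<Omega> (brk g x v)"
      using casimir_invariant[OF d bilinear_brk_brk, of x v] by (simp add: \<Omega>_def sum.distrib sum_subtractf)
    finally show ?thesis .
  qed
  have par: "\<Omega> v \<in> gpar g q" if "v \<in> gpar g q" for v q
    unfolding \<Omega>_def
  proof (rule cvs.subspace_sum[OF par_subspace])
    fix i assume "i \<in> {..<n}"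
    then have "brk g (a i) (brk g (b i) v) \<in> gpar g (p i + (p i + q))" using ab that by (intro brk_par) auto
    moreover have "p i + (p i + q) = q" by (cases "p i"; cases q) simp_all
    ultimately show "brk g (a i) (brk g (b i) v) \<in> gpar g q" by simp
  qed
  obtain w :: 'g where w: "w \<noteq> 0" by (rule nonzero_vector)
  obtain c v where v: "v \<noteq> 0" "\<Omega> v = c *\<^sub>C v"
  proof (rule eigenvector_exists[OF lin fdim_g cvs.subspace_UNIV])
    have "w \<in> UNIV" "w \<notin> {0}" using w by simp_all
    then show "UNIV \<noteq> {0::'g}" by metis
    fix c v assume "v \<noteq> 0" "\<Omega> v = c *\<^sub>C v"
    then show thesis by (rule that)
  qed simp
  define K where "K = {v. \<Omega> v = c *\<^sub>C v}"
  have subK: "cvs.subspace K"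
    by (auto simp: K_def cvs.subspace_def clinear_simps[OF lin] cvs.scale_right_distrib mult.commute)
  have "graded_subspace (gpar g) K"
    unfolding graded_subspace_def
  proof (intro conjI ballI subK)
    fix u assume u: "u \<in> K"
    obtain x y where xy: "x \<in> gpar g 0" "y \<in> gpar g 1" "u = x + y" by (rule par_decompose)
    let ?x = "\<Omega> x - c *\<^sub>C x" and ?y = "\<Omega> y - c *\<^sub>C y"
    have sum0: "?x + ?y = 0" using u xy(3) by (simp add: K_def clinear_simps[OF lin] cvs.scale_right_distrib algebra_simps)
    have x0: "?x \<in> gpar g 0" and y1: "?y \<in> gpar g 1"
      using xy par by (auto intro!: cvs.subspace_diff cvs.subspace_scale par_subspace)
    have "?x = - ?y" by (rule eq_neg_iff_add_eq_0[THEN iffD2, OF sum0])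
    then have "?x \<in> gpar g 1" using cvs.subspace_neg[OF par_subspace y1] by simp
    then have "?x = 0" using par_inter x0 by blast
    then have "x \<in> K" "y \<in> K" using sum0 by (simp_all add: K_def)
    then show "\<exists>a\<in>K \<inter> gpar g 0. \<exists>b\<in>K \<inter> gpar g 1. u = a + b" using xy by blast
  qed
  moreover have "brk g x y \<in> K" if "y \<in> K" for x y
  proof -
    obtain u w where "u \<in> gpar g 0" "w \<in> gpar g 1" "x = u + w" by (rule par_decompose)
    then show ?thesis using that comm[of u 0 y] comm[of w 1 y]
      by (simp add: K_def brk_simps clinear_simps[OF lin] cvs.scale_right_distrib)
  qed
  ultimately have "K = {0} \<or> K = UNIV" by (rule simple)
  moreover have "v \<in> K" using v by (simp add: K_def)
  ultimately have "K = UNIV" using v(1) by auto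
  then have "\<forall>v. \<Omega> v = c *\<^sub>C v" by (auto simp: K_def)
  then show ?thesis unfolding \<Omega>_def by blast
qed

lemma dual_coxeter_eigenvalue:
  assumes h: "homogeneous_dual_bases n a b p"
  shows "(\<Sum>i<n. brk g (a i) (brk g (b i) v)) = (2 * dual_coxeter g UNIV) *\<^sub>C v"
proof -
  have d: "dual_bases g UNIV n a b" using h by (simp add: homogeneous_dual_bases_def)
  obtain c where c: "\<And>v. (\<Sum>i<n. brk g (a i) (brk g (b i) v)) = c *\<^sub>C v" using casimir_scalar[OF h] by blast
  have cas: "casimir g UNIV (\<lambda>x y. brk g x (brk g y v)) = c *\<^sub>C v" for v
    using casimir_eq[OF d bilinear_brk_brk] c by simp
  obtain w :: 'g where w: "w \<noteq> 0" by (rule nonzero_vector)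
  have "dual_coxeter g UNIV = c / 2"
    unfolding dual_coxeter_def
  proof (rule the_equality)
    show "\<forall>v\<in>UNIV. casimir g UNIV (\<lambda>x y. brk g x (brk g y v)) = (2 * (c / 2)) *\<^sub>C v" using cas by simp
    fix e assume "\<forall>v\<in>UNIV. casimir g UNIV (\<lambda>x y. brk g x (brk g y v)) = (2 * e) *\<^sub>C v"
    then have "casimir g UNIV (\<lambda>x y. brk g x (brk g y w)) = (2 * e) *\<^sub>C w" by blast
    then have "c *\<^sub>C w = (2 * e) *\<^sub>C w" unfolding cas .
    then have "c = 2 * e" using w cvs.scale_right_imp_eq by blast
    then show "e = c / 2" by simp
  qed
  then have "2 * dual_coxeter g UNIV = 2 * (c / 2)" by (rule arg_cong)
  also have "\<dots> = c" by simp
  finally show ?thesis using c[of v] by (rule ssubst)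
qed

text \<open>Supersymmetry of the tensor turns the double bracket into the Casimir operator.\<close>

lemma casimir_double_bracket:
  assumes h: "homogeneous_dual_bases n a b p" and x: "x \<in> gpar g 0"
  shows "(\<Sum>i<n. brk g (brk g x (a i)) (b i)) = (2 * dual_coxeter g UNIV) *\<^sub>C x"
proof -
  have "(\<Sum>i<n. brk g (brk g x (a i)) (b i)) = (\<Sum>i<n. koszul (p i) (p i) *\<^sub>C brk g (b i) (brk g (a i) x))"
  proof (rule sum.cong[OF refl])
    fix i assume "i \<in> {..<n}"
    then have i: "b i \<in> gpar g (p i)" "a i \<in> gpar g (p i)" using h by (auto simp: homogeneous_dual_bases_def)
    have ax: "brk g (a i) x \<in> gpar g (p i)" using brk_par[OF i(2) x] by (cases "p i") simp_all
    have "brk g x (a i) = - brk g (a i) x" using brk_even[OF x, of "a i"] by simp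
    then show "brk g (brk g x (a i)) (b i) = koszul (p i) (p i) *\<^sub>C brk g (b i) (brk g (a i) x)"
      using brk_antisym[OF ax i(1)] by (simp add: brk_simps)
  qed
  also have "\<dots> = (\<Sum>i<n. brk g (a i) (brk g (b i) x))"
    by (rule casimir_swap[OF h bilinear_brk_brk, symmetric])
  also have "\<dots> = (2 * dual_coxeter g UNIV) *\<^sub>C x" by (rule dual_coxeter_eigenvalue[OF h])
  finally show ?thesis .
qed

end

section \<open>Commutation relations of the Sugawara vector\<close>

lemma Sum_any_mem_subspace:
  assumes "cvs.subspace W" "\<And>j. f j \<in> W" shows "Sum_any f \<in> W"
  unfolding Sum_any.expand_set by (rule cvs.subspace_sum[OF assms(1)]) (rule assms(2))

locale vertex_module =
  fixes V :: "'v::complex_vector vertex_alg" and M :: "('v, 'w::complex_vector) vmodule"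
  assumes weak: "weak_module V M"
begin

lemma act_linear: "clinear (mact M a n)" "clinear (\<lambda>a. mact M a n w)"
  using weak unfolding weak_module_def by blast+

lemmas act_simps = clinear_simps[OF act_linear(1)] clinear_simps[OF act_linear(2)]

lemma act_vacuum: "mact M (vacuum V) n w = (if n = -1 then w else 0)"
  using weak unfolding weak_module_def by (elim conjE) (erule allE)+

lemma borcherds_identity:
  assumes "a \<in> vpar V p" "b \<in> vpar V q"
  shows "Sum_any (\<lambda>j::nat. (of_int m gchoose j) *\<^sub>C mact M (vprod V a (n + int j) b) (m + l - int j) c) =
     Sum_any (\<lambda>j::nat. ((-1) ^ j * (of_int n gchoose j)) *\<^sub>C
       (mact M a (m + n - int j) (mact M b (l + int j) c)
        - (koszul p q * (-1) powi n) *\<^sub>C mact M b (n + l - int j) (mact M a (m + int j) c)))"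
proof -
  have "borcherds V (mact M)" using weak unfolding weak_module_def by (elim conjE)
  then show ?thesis unfolding borcherds_def using assms by (elim allE ballE) auto
qed

text \<open>The Borcherds identity for \<open>n = 0\<close>.\<close>

lemma commutator_formula:
  assumes a: "a \<in> vpar V 0" and b: "b \<in> vpar V q" and trunc: "\<And>j. j \<ge> N \<Longrightarrow> vprod V a (int j) b = 0"
  shows "mact M a m (mact M b l c) = mact M b l (mact M a m c) +
    (\<Sum>j<N. (of_int m gchoose j) *\<^sub>C mact M (vprod V a (int j) b) (m + l - int j) c)"
proof -
  let ?L = "\<lambda>j::nat. (of_int m gchoose j) *\<^sub>C mact M (vprod V a (0 + int j) b) (m + l - int j) c"
  let ?R = "\<lambda>j::nat. ((-1) ^ j * (of_int 0 gchoose j)) *\<^sub>C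
       (mact M a (m + 0 - int j) (mact M b (l + int j) c)
        - (koszul 0 q * (-1) powi 0) *\<^sub>C mact M b (0 + l - int j) (mact M a (m + int j) c))"
  have "{j. ?L j \<noteq> 0} \<subseteq> {..<N}"
  proof
    fix j assume j: "j \<in> {j. ?L j \<noteq> 0}"
    show "j \<in> {..<N}"
    proof (rule ccontr)
      assume "j \<notin> {..<N}"
      then have "vprod V a (0 + int j) b = 0" using trunc[of j] by simp
      then show False using j by (simp add: act_simps)
    qed
  qed
  then have L: "Sum_any ?L = (\<Sum>j<N. ?L j)" by (intro Sum_any.expand_superset) auto
  have "?R j = 0" if "j \<noteq> 0" for j using that by (cases j) (simp_all add: gbinomial_0)
  then have "{j. ?R j \<noteq> 0} \<subseteq> {0}" by blast
  then have "Sum_any ?R = (\<Sum>j\<in>{0}. ?R j)" by (intro Sum_any.expand_superset) auto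
  also have "\<dots> = mact M a m (mact M b l c) - mact M b l (mact M a m c)"
    by (simp add: koszul_def scaleC_one)
  finally show ?thesis using borcherds_identity[OF a b, of m 0 l c] L by (simp add: eq_diff_eq add.commute)
qed

text \<open>The Borcherds identity for \<open>m = 0\<close> expresses the modes of a product through products of
  modes.\<close>

lemma act_product_mem:
  assumes W: "cvs.subspace W" and a: "a \<in> vpar V 0" and b: "b \<in> vpar V 0"
    and aW: "\<And>n w. w \<in> W \<Longrightarrow> mact M a n w \<in> W" and bW: "\<And>n w. w \<in> W \<Longrightarrow> mact M b n w \<in> W" and c: "c \<in> W"
  shows "mact M (vprod V a n b) l c \<in> W"
proof -
  let ?L = "\<lambda>j::nat. (of_int 0 gchoose j) *\<^sub>C mact M (vprod V a (n + int j) b) (0 + l - int j) c"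
  have "?L j = 0" if "j \<noteq> 0" for j using that by (cases j) (simp_all add: gbinomial_0)
  then have "{j. ?L j \<noteq> 0} \<subseteq> {0}" by blast
  then have "Sum_any ?L = (\<Sum>j\<in>{0}. ?L j)" by (intro Sum_any.expand_superset) auto
  then have "mact M (vprod V a n b) l c = Sum_any ?L" by (simp add: scaleC_one)
  also have "\<dots> \<in> W"
    unfolding borcherds_identity[OF a b, of 0 n l c]
    by (intro Sum_any_mem_subspace[OF W] cvs.subspace_scale[OF W] cvs.subspace_diff[OF W] aW bW c)
  finally show ?thesis .
qed

end

locale affine_vertex = basic_superalgebra g
  for g :: "'g::complex_vector super_lie" +
  fixes k :: complex and V :: "'v::complex_vector vertex_alg" and \<iota> :: "'g \<Rightarrow> 'v"
  assumes affine: "affine_vertex_algebra g UNIV k V \<iota>" and level: "k \<noteq> - dual_coxeter g UNIV"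
begin

lemma vertex: "vertex_superalgebra V"
  using affine unfolding affine_vertex_algebra_def by (elim conjE)

lemma iota_linear: "clinear \<iota>"
proof (rule clinearI)
  have "\<forall>x\<in>UNIV. \<forall>y\<in>UNIV. \<iota> (x + y) = \<iota> x + \<iota> y"
    using affine unfolding affine_vertex_algebra_def by (elim conjE)
  then show "\<iota> (x + y) = \<iota> x + \<iota> y" for x y by simp
  have "\<forall>c. \<forall>x\<in>UNIV. \<iota> (c *\<^sub>C x) = c *\<^sub>C \<iota> x"
    using affine unfolding affine_vertex_algebra_def by (elim conjE)
  then show "\<iota> (c *\<^sub>C x) = c *\<^sub>C \<iota> x" for c x by simp
qed

lemmas iota_simps = clinear_simps[OF iota_linear]

lemma iota_par: "x \<in> gpar g p \<Longrightarrow> \<iota> x \<in> vpar V p"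
proof -
  have "\<forall>p. \<forall>x\<in>UNIV \<inter> gpar g p. \<iota> x \<in> vpar V p"
    using affine unfolding affine_vertex_algebra_def by (elim conjE)
  then show "x \<in> gpar g p \<Longrightarrow> \<iota> x \<in> vpar V p" by simp
qed

lemma affine_relations:
  "vprod V (\<iota> x) 0 (\<iota> y) = \<iota> (brk g x y)"
  "vprod V (\<iota> x) 1 (\<iota> y) = (k * form g x y) *\<^sub>C vacuum V"
  "n \<ge> 2 \<Longrightarrow> vprod V (\<iota> x) n (\<iota> y) = 0"
proof -
  have "\<forall>x\<in>UNIV. \<forall>y\<in>UNIV. vprod V (\<iota> x) 0 (\<iota> y) = \<iota> (brk g x y) \<and>
        vprod V (\<iota> x) 1 (\<iota> y) = (k * form g x y) *\<^sub>C vacuum V \<and>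
        (\<forall>n\<ge>2. vprod V (\<iota> x) n (\<iota> y) = 0)"
    using affine unfolding affine_vertex_algebra_def by (elim conjE)
  then show "vprod V (\<iota> x) 0 (\<iota> y) = \<iota> (brk g x y)"
    "vprod V (\<iota> x) 1 (\<iota> y) = (k * form g x y) *\<^sub>C vacuum V"
    "n \<ge> 2 \<Longrightarrow> vprod V (\<iota> x) n (\<iota> y) = 0" by auto
qed

sublocale adj: vertex_module V "\<lparr>mpar = vpar V, mact = vprod V\<rparr>"
  using vertex by unfold_locales (simp add: vertex_superalgebra_def)

lemma prod_simps: "clinear (vprod V a n)" "clinear (\<lambda>a. vprod V a n w)"
  using adj.act_linear by simp_all

lemmas vprod_simps = clinear_simps[OF prod_simps(1)] clinear_simps[OF prod_simps(2)]

lemma vac_prod: "vprod V (vacuum V) n w = (if n = -1 then w else 0)"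
  using adj.act_vacuum by simp

lemma prod_vac: "vprod V a (-1) (vacuum V) = a"
  using vertex unfolding vertex_superalgebra_def by blast

lemma vpar_subspace: "cvs.subspace (vpar V p)"
  using adj.weak by (simp add: weak_module_def superspace_def)

lemma vprod_par: "a \<in> vpar V p \<Longrightarrow> w \<in> vpar V q \<Longrightarrow> vprod V a n w \<in> vpar V (p + q)"
proof -
  have "\<forall>p q. \<forall>a\<in>vpar V p. \<forall>w\<in>mpar \<lparr>mpar = vpar V, mact = vprod V\<rparr> q. \<forall>n.
      mact \<lparr>mpar = vpar V, mact = vprod V\<rparr> a n w \<in> mpar \<lparr>mpar = vpar V, mact = vprod V\<rparr> (p + q)"
    using adj.weak unfolding weak_module_def by (elim conjE)
  then show "a \<in> vpar V p \<Longrightarrow> w \<in> vpar V q \<Longrightarrow> vprod V a n w \<in> vpar V (p + q)" by simp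
qed

lemma bilinear_normal_product: "bilinear_map (\<lambda>x y. vprod V (\<iota> x) (-1) (\<iota> y))"
  unfolding bilinear_map_def by (auto intro!: clinearI simp: iota_simps vprod_simps)

lemma iota_on_normal_product:
  assumes x: "x \<in> gpar g 0" and b: "a \<in> gpar g p"
  shows "vprod V (\<iota> x) 0 (vprod V (\<iota> a) (-1) (\<iota> b)) =
      vprod V (\<iota> a) (-1) (\<iota> (brk g x b)) + vprod V (\<iota> (brk g x a)) (-1) (\<iota> b)"
    and "vprod V (\<iota> x) 1 (vprod V (\<iota> a) (-1) (\<iota> b)) =
      (k * form g x b) *\<^sub>C \<iota> a + (\<iota> (brk g (brk g x a) b) + (k * form g x a) *\<^sub>C \<iota> b)"
    and "vprod V (\<iota> x) 2 (vprod V (\<iota> a) (-1) (\<iota> b)) = (k * form g x (brk g a b)) *\<^sub>C vacuum V"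
    and "m \<ge> 3 \<Longrightarrow> vprod V (\<iota> x) m (vprod V (\<iota> a) (-1) (\<iota> b)) = 0"
proof -
  have trunc: "vprod V (\<iota> x) (int j) (\<iota> a) = 0" if "j \<ge> 2" for j
    using affine_relations(3)[of "int j" x a] that by simp
  have main: "vprod V (\<iota> x) m (vprod V (\<iota> a) (-1) (\<iota> b)) = vprod V (\<iota> a) (-1) (vprod V (\<iota> x) m (\<iota> b)) +
     (vprod V (\<iota> (brk g x a)) (m - 1) (\<iota> b) + of_int m *\<^sub>C (k * form g x a) *\<^sub>C (if m - 2 = - 1 then \<iota> b else 0))" for m
  proof -
    have "vprod V (\<iota> x) m (vprod V (\<iota> a) (-1) (\<iota> b)) = vprod V (\<iota> a) (-1) (vprod V (\<iota> x) m (\<iota> b)) +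
      (\<Sum>j<2. (of_int m gchoose j) *\<^sub>C vprod V (vprod V (\<iota> x) (int j) (\<iota> a)) (m + (- 1) - int j) (\<iota> b))"
      using adj.commutator_formula[OF iota_par[OF x] iota_par[OF b] trunc, where m = m and l = "-1" and c = "\<iota> b"] by simp
    also have "(\<Sum>j<2. (of_int m gchoose j) *\<^sub>C vprod V (vprod V (\<iota> x) (int j) (\<iota> a)) (m + (- 1) - int j) (\<iota> b))
      = vprod V (\<iota> (brk g x a)) (m - 1) (\<iota> b) + of_int m *\<^sub>C vprod V ((k * form g x a) *\<^sub>C vacuum V) (m - 2) (\<iota> b)"
      by (simp add: numeral_2_eq_2 affine_relations(1,2) scaleC_one)
    finally show ?thesis by (simp add: vprod_simps vac_prod)
  qed
  show "vprod V (\<iota> x) 0 (vprod V (\<iota> a) (-1) (\<iota> b)) =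
      vprod V (\<iota> a) (-1) (\<iota> (brk g x b)) + vprod V (\<iota> (brk g x a)) (-1) (\<iota> b)"
    unfolding main by (simp add: affine_relations)
  show "vprod V (\<iota> x) 1 (vprod V (\<iota> a) (-1) (\<iota> b)) =
      (k * form g x b) *\<^sub>C \<iota> a + (\<iota> (brk g (brk g x a) b) + (k * form g x a) *\<^sub>C \<iota> b)"
    unfolding main by (simp add: affine_relations vprod_simps prod_vac scaleC_one)
  have "form g (brk g x a) b = form g x (brk g a b)" by (rule form_invariant)
  then show "vprod V (\<iota> x) 2 (vprod V (\<iota> a) (-1) (\<iota> b)) = (k * form g x (brk g a b)) *\<^sub>C vacuum V"
    unfolding main by (simp add: affine_relations vprod_simps)
  show "vprod V (\<iota> x) m (vprod V (\<iota> a) (-1) (\<iota> b)) = 0" if "m \<ge> 3"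
    unfolding main using that by (simp add: affine_relations vprod_simps)
qed

definition \<omega> :: 'v where "\<omega> = sugawara g k V \<iota>"

lemma sugawara_sum:
  assumes h: "homogeneous_dual_bases n a b p"
  shows "\<omega> = (1 / (2 * (k + dual_coxeter g UNIV))) *\<^sub>C (\<Sum>i<n. vprod V (\<iota> (a i)) (-1) (\<iota> (b i)))"
  using casimir_eq[OF _ bilinear_normal_product] h
  by (simp add: \<omega>_def sugawara_def quadratic_vector_def homogeneous_dual_bases_def)

lemma sugawara_even: "\<omega> \<in> vpar V 0"
proof -
  obtain n a b p where h: "homogeneous_dual_bases n a b p" using homogeneous_dual_bases_exist by blast
  have "vprod V (\<iota> (a i)) (-1) (\<iota> (b i)) \<in> vpar V 0" if "i < n" for i
  proof -
    have "vprod V (\<iota> (a i)) (-1) (\<iota> (b i)) \<in> vpar V (p i + p i)"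
      using h that by (intro vprod_par iota_par) (auto simp: homogeneous_dual_bases_def)
    then show ?thesis by (cases "p i") simp_all
  qed
  then show ?thesis unfolding sugawara_sum[OF h]
    by (intro cvs.subspace_scale[OF vpar_subspace] cvs.subspace_sum[OF vpar_subspace]) auto
qed

text \<open>By the invariance of the Casimir element an even current is primary of weight \<open>1\<close>; its double
  brackets with the dual bases give the shift of the level by the dual Coxeter number.\<close>

lemma iota_on_sugawara:
  assumes x: "x \<in> gpar g 0"
  shows "vprod V (\<iota> x) 0 \<omega> = 0" "vprod V (\<iota> x) 1 \<omega> = \<iota> x" "m \<ge> 2 \<Longrightarrow> vprod V (\<iota> x) m \<omega> = 0"
proof -
  obtain n a b p where h: "homogeneous_dual_bases n a b p" using homogeneous_dual_bases_exist by blast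
  have d: "dual_bases g UNIV n a b" and a: "\<And>i. i < n \<Longrightarrow> a i \<in> gpar g (p i)"
    using h by (auto simp: homogeneous_dual_bases_def)
  let ?c = "1 / (2 * (k + dual_coxeter g UNIV))"
  have prod: "vprod V (\<iota> x) m \<omega> = ?c *\<^sub>C (\<Sum>i<n. vprod V (\<iota> x) m (vprod V (\<iota> (a i)) (-1) (\<iota> (b i))))" for m
    unfolding sugawara_sum[OF h] by (simp add: vprod_simps)
  show "vprod V (\<iota> x) 0 \<omega> = 0"
  proof -
    have "(\<Sum>i<n. vprod V (\<iota> x) 0 (vprod V (\<iota> (a i)) (-1) (\<iota> (b i)))) =
        (\<Sum>i<n. vprod V (\<iota> (brk g x (a i))) (-1) (\<iota> (b i)) + vprod V (\<iota> (a i)) (-1) (\<iota> (brk g x (b i))))"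
    proof (rule sum.cong[OF refl])
      fix i assume "i \<in> {..<n}"
      then have "a i \<in> gpar g (p i)" using a by simp
      then show "vprod V (\<iota> x) 0 (vprod V (\<iota> (a i)) (-1) (\<iota> (b i))) =
          vprod V (\<iota> (brk g x (a i))) (-1) (\<iota> (b i)) + vprod V (\<iota> (a i)) (-1) (\<iota> (brk g x (b i)))"
        by (subst iota_on_normal_product(1)[OF x]) (simp_all only: add.commute)
    qed
    also have "\<dots> = 0" by (rule casimir_even_invariant[OF d bilinear_normal_product x])
    finally show ?thesis unfolding prod by simp
  qed
  show "vprod V (\<iota> x) 1 \<omega> = \<iota> x"
  proof -
    have "(\<Sum>i<n. vprod V (\<iota> x) 1 (vprod V (\<iota> (a i)) (-1) (\<iota> (b i)))) =
        (\<Sum>i<n. (k * form g x (b i)) *\<^sub>C \<iota> (a i) + (\<iota> (brk g (brk g x (a i)) (b i)) + (k * form g x (a i)) *\<^sub>C \<iota> (b i)))"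
      by (rule sum.cong) (simp_all add: iota_on_normal_product(2)[OF x a])
    also have "\<dots> = \<iota> (k *\<^sub>C (\<Sum>i<n. form g (b i) x *\<^sub>C a i) + ((\<Sum>i<n. brk g (brk g x (a i)) (b i))
        + k *\<^sub>C (\<Sum>i<n. form g x (a i) *\<^sub>C b i)))"
      by (simp add: iota_simps sum.distrib cvs.scale_sum_right form_even_sym[OF x])
    also have "\<dots> = \<iota> (k *\<^sub>C x + ((2 * dual_coxeter g UNIV) *\<^sub>C x + k *\<^sub>C x))"
      by (simp only: dual_bases_expand[OF d, symmetric] dual_bases_expand'[OF d, symmetric] casimir_double_bracket[OF h x])
    also have "k *\<^sub>C x + ((2 * dual_coxeter g UNIV) *\<^sub>C x + k *\<^sub>C x) = (k + (2 * dual_coxeter g UNIV + k)) *\<^sub>C x"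
      by (simp only: cvs.scale_left_distrib)
    also have "k + (2 * dual_coxeter g UNIV + k) = 2 * (k + dual_coxeter g UNIV)" by simp
    finally have "vprod V (\<iota> x) 1 \<omega> = ?c *\<^sub>C (2 * (k + dual_coxeter g UNIV)) *\<^sub>C \<iota> x"
      unfolding prod by (simp add: iota_simps)
    moreover have "k + dual_coxeter g UNIV \<noteq> 0" using level by (simp add: eq_neg_iff_add_eq_0)
    then have "2 * (k + dual_coxeter g UNIV) \<noteq> 0" by (simp only: mult_eq_0_iff) simp
    then have "?c * (2 * (k + dual_coxeter g UNIV)) = 1" unfolding times_divide_eq_left mult_1 by (rule divide_self)
    ultimately show ?thesis by (simp only: cvs.scale_scale scaleC_one)
  qed
  show "vprod V (\<iota> x) m \<omega> = 0" if "m \<ge> 2"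
  proof (cases "m = 2")
    case True
    have "(\<Sum>i<n. vprod V (\<iota> x) 2 (vprod V (\<iota> (a i)) (-1) (\<iota> (b i)))) =
        (\<Sum>i<n. (k * form g x (brk g (a i) (b i))) *\<^sub>C vacuum V)"
      by (rule sum.cong) (simp_all add: iota_on_normal_product(3)[OF x a])
    also have "\<dots> = (k * form g x (\<Sum>i<n. brk g (a i) (b i))) *\<^sub>C vacuum V"
      by (simp add: form_sum_right cvs.scale_sum_left sum_distrib_left)
    finally show ?thesis unfolding True prod casimir_bracket_zero[OF h] by (simp add: form_simps)
  next
    case False
    then have "m \<ge> 3" using that by simp
    then show ?thesis unfolding prod using iota_on_normal_product(4)[OF x a] by simp
  qed
qed

end

locale affine_module = affine_vertex g k V \<iota> + vertex_module V M
  for g :: "'g::complex_vector super_lie" and k :: complex and V :: "'v::complex_vector vertex_alg"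
    and \<iota> :: "'g \<Rightarrow> 'v" and M :: "('v, 'w::complex_vector) vmodule"
begin

abbreviation L :: "'w \<Rightarrow> 'w" where "L \<equiv> L0 g k V \<iota> M"

lemma L_linear: "clinear L"
  unfolding L0_def by (rule act_linear)

lemma L_current:
  assumes x: "x \<in> gpar g 0"
  shows "L (mact M (\<iota> x) m w) = mact M (\<iota> x) m (L w) - of_int m *\<^sub>C mact M (\<iota> x) m w"
proof -
  have "mact M (\<iota> x) m (mact M \<omega> 1 w) = mact M \<omega> 1 (mact M (\<iota> x) m w) +
      (\<Sum>j<2. (of_int m gchoose j) *\<^sub>C mact M (vprod V (\<iota> x) (int j) \<omega>) (m + 1 - int j) w)"
    by (rule commutator_formula[OF iota_par[OF x] sugawara_even])
       (use iota_on_sugawara(3)[OF x] in simp)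
  also have "(\<Sum>j<2. (of_int m gchoose j) *\<^sub>C mact M (vprod V (\<iota> x) (int j) \<omega>) (m + 1 - int j) w)
      = of_int m *\<^sub>C mact M (\<iota> x) m w"
    using iota_on_sugawara(1,2)[OF x] by (simp add: numeral_2_eq_2 act_simps)
  finally show ?thesis by (simp add: L0_def \<omega>_def)
qed

lemma current_commutator:
  assumes x: "x \<in> gpar g 0" and y: "y \<in> gpar g 0"
  shows "mact M (\<iota> x) 0 (mact M (\<iota> y) n w) = mact M (\<iota> y) n (mact M (\<iota> x) 0 w) + mact M (\<iota> (brk g x y)) n w"
proof -
  have "mact M (\<iota> x) 0 (mact M (\<iota> y) n w) = mact M (\<iota> y) n (mact M (\<iota> x) 0 w) +
      (\<Sum>j<2. (of_int 0 gchoose j) *\<^sub>C mact M (vprod V (\<iota> x) (int j) (\<iota> y)) (0 + n - int j) w)"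
    by (rule commutator_formula[OF iota_par[OF x] iota_par[OF y]])
       (use affine_relations(3) in simp)
  then show ?thesis by (simp add: numeral_2_eq_2 affine_relations(1) scaleC_one gbinomial_0)
qed

lemma zero_mode_linear: "clinear (\<lambda>x. mact M (\<iota> x) n w)"
  by (intro clinearI) (simp_all add: iota_simps act_simps)

end

section \<open>Semisimplicity of the Cartan subalgebra on modules\<close>

lemma span_UNIV_mono:
  assumes "cvs.span A = UNIV" "A \<subseteq> B" shows "cvs.span B = UNIV"
  using cvs.span_mono[OF assms(2)] unfolding assms(1) by (rule top.extremum_uniqueI)

locale basic_with_cartan = basic_superalgebra g for g :: "'g::complex_vector super_lie" +
  fixes h :: "'g set"
  assumes cartan: "cartan_subalgebra g (gpar g 0) h"
begin

lemma cartan_nilpotent: "\<exists>c. \<forall>H\<in>h. \<forall>y\<in>h. (brk g H ^^ c) y = 0"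
proof -
  obtain c where c: "lower_central_series g h c = {0}"
    using cartan by (auto simp: cartan_subalgebra_def nilpotent_lie_def)
  have "(brk g H ^^ n) y \<in> lower_central_series g h n" if "H \<in> h" "y \<in> h" for H y n
  proof (induction n)
    case (Suc n)
    then show ?case using that(1) by (auto intro!: cvs.span_base)
  qed (simp add: that)
  then show ?thesis using c by blast
qed

lemma even_lie: "fd_lie g (gpar g 0)"
proof (rule fd_lie.intro)
  show "brk g x y \<in> gpar g 0" if "x \<in> gpar g 0" "y \<in> gpar g 0" for x y
    using brk_par[OF that] by simp
  show "brk g x y = - brk g y x" if "x \<in> gpar g 0" "y \<in> gpar g 0" for x y
    by (rule brk_even[OF that(2)])
  show "brk g x (brk g y z) = brk g (brk g x y) z + brk g y (brk g x z)"
    if "x \<in> gpar g 0" "y \<in> gpar g 0" "z \<in> gpar g 0" for x y z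
    using brk_jacobi[OF that(1,2)] by (simp add: koszul_simps scaleC_one)
qed (rule fdim_g par_subspace brk_linear)+

lemma even_cartan: "cartan_pair g (gpar g 0) h"
proof (rule cartan_pair.intro[OF even_lie cartan_pair_axioms.intro])
  show "cvs.subspace h" "h \<subseteq> gpar g 0" using cartan by (simp_all add: cartan_subalgebra_def)
  show "brk g x y \<in> h" if "x \<in> h" "y \<in> h" for x y using cartan that by (simp add: cartan_subalgebra_def)
  show "x \<in> h" if "x \<in> gpar g 0" "\<And>y. y \<in> h \<Longrightarrow> brk g x y \<in> h" for x
    using cartan that unfolding cartan_subalgebra_def by blast
qed (rule cartan_nilpotent)

sublocale C: reductive_cartan g "gpar g 0" h
proof (rule reductive_cartan.intro[OF even_cartan reductive_cartan_axioms.intro])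
  show "form g x y = form g y x" if "x \<in> gpar g 0" for x y by (rule form_even_sym[OF that])
  show "x = 0" if "x \<in> gpar g 0" "\<And>y. y \<in> gpar g 0 \<Longrightarrow> form g x y = 0" for x
    by (rule form_nondegenerate_par[OF that])
qed (rule reductive_even form_linear form_invariant)+

lemma semisimple_center: "semisimple_lie g (gpar g 0) \<Longrightarrow> lie_center g (gpar g 0) = {0}"
proof -
  assume ss: "semisimple_lie g (gpar g 0)"
  have "solvable_lie g (lie_center g (gpar g 0))"
    by (rule C.solvable_if_central_brackets[OF C.center_subspace C.center_L])
       (use C.center_br C.center_L cvs.subspace_0[OF C.center_subspace] in auto)
  moreover have "lie_ideal g (gpar g 0) (lie_center g (gpar g 0))"
    unfolding lie_ideal_def
    using C.center_subspace C.center_L C.center_br cvs.subspace_0[OF C.center_subspace] by auto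
  ultimately show ?thesis using ss by (simp add: semisimple_lie_def)
qed

end

locale cartan_module = affine_module g k V \<iota> M + basic_with_cartan g h
  for g :: "'g::complex_vector super_lie" and k :: complex and V :: "'v::complex_vector vertex_alg"
    and \<iota> :: "'g \<Rightarrow> 'v" and M :: "('v, 'w::complex_vector) vmodule" and h :: "'g set"
begin

abbreviation z :: "'g \<Rightarrow> 'w \<Rightarrow> 'w" where "z x \<equiv> mact M (\<iota> x) 0"

lemma z_linear: "clinear (z x)" "clinear (\<lambda>x. z x w)"
  by (rule act_linear, rule zero_mode_linear)

lemma h_even: "H \<in> h \<Longrightarrow> H \<in> gpar g 0"
  by (rule C.hL')

lemma z_commute: "H \<in> h \<Longrightarrow> K \<in> h \<Longrightarrow> z H (z K w) = z K (z H w)"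
  using current_commutator[OF h_even h_even, of H K 0 w] C.h_abelian[of H K]
  by (simp add: clinear_simps[OF z_linear(2)])

lemma L_z: "x \<in> gpar g 0 \<Longrightarrow> L (z x w) = z x (L w)"
  using L_current[of x 0 w] by simp

definition eigen :: "'w set" where
  "eigen = {w. (\<forall>H\<in>h. \<exists>c. z H w = c *\<^sub>C w) \<and> (\<exists>c. L w = c *\<^sub>C w)}"

lemma eigen_affine_cartan:
  assumes "w \<in> eigen" "T \<in> affine_cartan_act g k V \<iota> M ` (h \<times> UNIV \<times> UNIV)" shows "\<exists>c. T w = c *\<^sub>C w"
proof -
  obtain H a b where T: "H \<in> h" "T = affine_cartan_act g k V \<iota> M (H, a, b)" using assms(2) by auto
  have "\<exists>c. z H w = c *\<^sub>C w" "\<exists>d. L w = d *\<^sub>C w" using assms(1) T(1) by (simp_all add: eigen_def)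
  then obtain c d where "z H w = c *\<^sub>C w" "L w = d *\<^sub>C w" by (elim exE)
  then have "T w = (c + a * k - b * d) *\<^sub>C w"
    by (simp add: T(2) affine_cartan_act_def cvs.scale_left_distrib cvs.scale_left_diff_distrib)
  then show ?thesis by blast
qed

lemma span_eigen_acts_semisimply:
  "cvs.span eigen = UNIV \<Longrightarrow> acts_semisimply (affine_cartan_act g k V \<iota> M ` (h \<times> UNIV \<times> UNIV))"
  unfolding acts_semisimply_def
proof -
  assume UN: "cvs.span eigen = UNIV"
  have "eigen \<subseteq> {w. \<forall>T\<in>affine_cartan_act g k V \<iota> M ` (h \<times> UNIV \<times> UNIV). \<exists>c. T w = c *\<^sub>C w}"
    using eigen_affine_cartan by blast
  then show "cvs.span {w. \<forall>T\<in>affine_cartan_act g k V \<iota> M ` (h \<times> UNIV \<times> UNIV). \<exists>c. T w = c *\<^sub>C w} = UNIV"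
    by (rule span_UNIV_mono[OF UN])
qed

lemma acts_semisimply_L:
  assumes "acts_semisimply (affine_cartan_act g k V \<iota> M ` (h \<times> UNIV \<times> UNIV))" shows "acts_semisimply {L}"
proof -
  have "{w. \<forall>T\<in>affine_cartan_act g k V \<iota> M ` (h \<times> UNIV \<times> UNIV). \<exists>c. T w = c *\<^sub>C w} \<subseteq> {w. \<forall>T\<in>{L}. \<exists>c. T w = c *\<^sub>C w}"
  proof clarify
    fix w assume w: "\<forall>T\<in>affine_cartan_act g k V \<iota> M ` (h \<times> UNIV \<times> UNIV). \<exists>c. T w = c *\<^sub>C w"
    have "affine_cartan_act g k V \<iota> M (0, 0, 1) \<in> affine_cartan_act g k V \<iota> M ` (h \<times> UNIV \<times> UNIV)"
      using cvs.subspace_0[OF C.subh] by (intro imageI) simp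
    then obtain c where "affine_cartan_act g k V \<iota> M (0, 0, 1) w = c *\<^sub>C w" using w by blast
    then have "- L w = c *\<^sub>C w"
      by (simp add: affine_cartan_act_def clinear_simps[OF z_linear(2)] scaleC_one)
    then have "L w = (- c) *\<^sub>C w" by (metis cvs.scale_minus_left minus_minus)
    then show "\<exists>c. L w = c *\<^sub>C w" by blast
  qed
  then show ?thesis using assms unfolding acts_semisimply_def by (rule span_UNIV_mono[rotated])
qed

text \<open>A coroot spans with its root vectors a copy of sl2 acting on finite-dimensional subspaces of
  \<open>M\<close>.\<close>

lemma coroot_diagonalizable:
  assumes lf: "locally_finite \<iota> M" and ss: "semisimple_lie g (gpar g 0)"
    and \<beta>: "\<beta> \<in> C.weights" "\<beta> \<noteq> (\<lambda>_. 0)" and ct: "C.coroot_triple \<beta> e f"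
  shows "cvs.span {w. \<exists>c. z (brk g e f) w = c *\<^sub>C w} = UNIV"
proof -
  define t where "t = brk g e f"
  define c where "c = \<beta> t"
  have c0: "c \<noteq> 0" unfolding c_def t_def by (rule C.coroot_nonzero[OF semisimple_center[OF ss] \<beta> ct])
  have \<beta>e: "\<beta> \<in> C.ext" using \<beta> C.weights_ext by blast
  have ew: "e \<in> C.wt \<beta>" and fw: "f \<in> C.wt (\<lambda>H. - \<beta> H)" and th: "t \<in> h"
    using ct by (auto simp: C.coroot_triple_def t_def)
  have e: "e \<in> gpar g 0" and f: "f \<in> gpar g 0" using ew fw C.wt_L by blast+
  have t: "t \<in> gpar g 0" by (rule h_even[OF th])
  have te: "brk g t e = c *\<^sub>C e" unfolding c_def by (rule C.h_acts_semisimply[OF \<beta>e ew th])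
  have tf: "brk g t f = (- c) *\<^sub>C f"
    unfolding c_def by (rule C.h_acts_semisimply[OF _ fw th]) (use \<beta>e in \<open>simp add: C.ext_def\<close>)
  let ?t = "\<lambda>w. (2 / c) *\<^sub>C z t w" and ?f = "\<lambda>w. (2 / c) *\<^sub>C z f w"
  note zs = clinear_simps[OF z_linear(1)] clinear_simps[OF z_linear(2)]
  have "w \<in> cvs.span {w. \<exists>c. z t w = c *\<^sub>C w}" for w
  proof -
    obtain E where E: "finite E" "w \<in> cvs.span E" "\<And>x u. u \<in> cvs.span E \<Longrightarrow> z x u \<in> cvs.span E"
      using lf unfolding locally_finite_def by metis
    interpret S: sl2_rep "z e" ?f ?t "cvs.span E"
    proof
      show "fdim (cvs.span E)" unfolding fdim_def using E(1) by blast
      fix v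
      have "z t (z e v) = z e (z t v) + c *\<^sub>C z e v"
        using current_commutator[OF t e, of 0 v] by (simp add: te zs)
      then show "?t (z e v) = z e (?t v) + 2 *\<^sub>C z e v"
        using c0 by (simp add: zs cvs.scale_right_distrib)
      have "z t (z f v) = z f (z t v) - c *\<^sub>C z f v"
        using current_commutator[OF t f, of 0 v] by (simp add: tf zs)
      then show "?t (?f v) = ?f (?t v) - 2 *\<^sub>C ?f v"
        using c0 by (simp add: zs cvs.scale_right_diff_distrib mult.commute)
      have "z e (z f v) = z f (z e v) + z t v"
        using current_commutator[OF e f, of 0 v] by (simp add: t_def)
      then show "z e (?f v) = ?f (z e v) + ?t v"
        by (simp add: zs cvs.scale_right_distrib)
    qed (auto simp: zs cvs.scale_right_distrib mult.commute intro!: E(3) cvs.span_scale)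
    have sub: "{v\<in>cvs.span E. \<exists>a. ?t v = a *\<^sub>C v} \<subseteq> {w. \<exists>a. z t w = a *\<^sub>C w}"
    proof clarify
      fix v a assume "(2 / c) *\<^sub>C z t v = a *\<^sub>C v"
      then have "(c / 2) *\<^sub>C (2 / c) *\<^sub>C z t v = (c / 2) *\<^sub>C a *\<^sub>C v" by simp
      then have "z t v = (c / 2 * a) *\<^sub>C v" using c0 by (simp add: scaleC_one)
      then show "\<exists>a. z t v = a *\<^sub>C v" by blast
    qed
    have "w \<in> cvs.span {v\<in>cvs.span E. \<exists>a. ?t v = a *\<^sub>C v}" using S.diagonalizable E(2) by blast
    then show ?thesis using cvs.span_mono[OF sub] by blast
  qed
  then show ?thesis unfolding t_def by blast
qed

text \<open>The coroots and \<open>L\<close> form a finite commuting family of diagonalisable operators.\<close>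

lemma semisimple_case:
  assumes lf: "locally_finite \<iota> M" and ss: "semisimple_lie g (gpar g 0)" and L: "acts_semisimply {L}"
  shows "cvs.span eigen = UNIV"
proof -
  have "\<forall>\<beta>\<in>C.weights - {\<lambda>_. 0}. \<exists>ef. C.coroot_triple \<beta> (fst ef) (snd ef)"
    using C.coroot_triple_exists by (metis DiffD1 fst_conv snd_conv)
  then obtain ef where "\<forall>\<beta>\<in>C.weights - {\<lambda>_. 0}. C.coroot_triple \<beta> (fst (ef \<beta>)) (snd (ef \<beta>))"
    unfolding bchoice_iff by blast
  then have ct: "C.coroot_triple \<beta> (fst (ef \<beta>)) (snd (ef \<beta>))" if "\<beta> \<in> C.weights - {\<lambda>_. 0}" for \<beta>
    using that by blast
  define t where "t \<beta> = brk g (fst (ef \<beta>)) (snd (ef \<beta>))" for \<beta>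
  define \<T> where "\<T> = insert L ((\<lambda>\<beta>. z (t \<beta>)) ` (C.weights - {\<lambda>_. 0}))"
  have th: "t \<beta> \<in> h" if "\<beta> \<in> C.weights - {\<lambda>_. 0}" for \<beta>
    using ct[OF that] by (simp add: C.coroot_triple_def t_def)
  have comm: "S (T v) = T (S v)" if S: "S \<in> \<T>" and T: "T \<in> \<T>" for S T v
  proof -
    have S': "S = L \<or> (\<exists>H\<in>h. S = z H)" and T': "T = L \<or> (\<exists>H\<in>h. T = z H)"
      using S T th unfolding \<T>_def by blast+
    have Lz: "L (z H v) = z H (L v)" if "H \<in> h" for H by (rule L_z[OF h_even[OF that]])
    show ?thesis using S' T'
    proof (elim disjE bexE)
      fix H K assume "H \<in> h" "S = z H" "K \<in> h" "T = z K"
      then show ?thesis using z_commute by simp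
    qed (simp_all add: Lz)
  qed
  have "cvs.span {v. \<forall>T\<in>\<T>. \<exists>c. T v = c *\<^sub>C v} = UNIV"
  proof (rule commuting_diagonalizable)
    show "finite \<T>" using C.finite_weights by (simp add: \<T>_def)
    show "clinear T" if "T \<in> \<T>" for T using that L_linear z_linear(1) by (auto simp: \<T>_def)
    show "cvs.span {v. \<exists>c. T v = c *\<^sub>C v} = UNIV" if T: "T \<in> \<T>" for T
    proof (cases "T = L")
      case True
      then show ?thesis using L by (simp add: acts_semisimply_def)
    next
      case False
      then obtain \<beta> where \<beta>: "\<beta> \<in> C.weights - {\<lambda>_. 0}" "T = z (t \<beta>)" using T by (auto simp: \<T>_def)
      then show ?thesis unfolding \<beta>(2) t_def
        using ct[OF \<beta>(1)] by (intro coroot_diagonalizable[OF lf ss]) auto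
    qed
  qed (rule comm)
  moreover have "{v. \<forall>T\<in>\<T>. \<exists>c. T v = c *\<^sub>C v} \<subseteq> eigen"
  proof
    fix v assume v: "v \<in> {v. \<forall>T\<in>\<T>. \<exists>c. T v = c *\<^sub>C v}"
    have "\<exists>c. z H v = c *\<^sub>C v" if "H \<in> h" for H
    proof -
      have "H \<in> cvs.span (t ` (C.weights - {\<lambda>_. 0}))"
        using C.coroots_span[OF semisimple_center[OF ss] ct] that unfolding t_def by blast
      then show ?thesis
      proof (induction rule: cvs.span_induct_alt)
        case base
        show ?case by (rule exI[of _ 0]) (simp add: clinear_simps[OF z_linear(2)])
      next
        case (step a x y)
        then obtain \<beta> where "\<beta> \<in> C.weights - {\<lambda>_. 0}" "x = t \<beta>" by blast
        then have "\<exists>c. z x v = c *\<^sub>C v" "\<exists>d. z y v = d *\<^sub>C v" using v step by (simp_all add: \<T>_def)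
        then obtain c d where "z x v = c *\<^sub>C v" "z y v = d *\<^sub>C v" by (elim exE)
        then have "z (a *\<^sub>C x + y) v = (a * c + d) *\<^sub>C v"
          by (simp add: clinear_simps[OF z_linear(2)] cvs.scale_left_distrib)
        then show ?case by blast
      qed
    qed
    moreover have "\<exists>c. L v = c *\<^sub>C v" using v by (simp add: \<T>_def)
    ultimately show "v \<in> eigen" by (simp add: eigen_def)
  qed
  ultimately show ?thesis by (rule span_UNIV_mono)
qed

text \<open>Even currents move common eigenvectors to sums of common eigenvectors, because \<open>h\<close> acts
  semisimply on the even part.\<close>

lemma span_eigen_currents:
  assumes N: "\<And>x n w. x \<in> gpar g 0 \<Longrightarrow> w \<in> N \<Longrightarrow> mact M (\<iota> x) n w \<in> N"
    and x: "x \<in> gpar g 0" and w: "w \<in> cvs.span (eigen \<inter> N)"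
  shows "mact M (\<iota> x) n w \<in> cvs.span (eigen \<inter> N)"
proof (rule clinear_span_into[OF act_linear(1) _ cvs.subspace_span w])
  fix u assume u: "u \<in> eigen \<inter> N"
  have zl: "clinear (\<lambda>x. mact M (\<iota> x) n u)" by (rule zero_mode_linear)
  show "mact M (\<iota> x) n u \<in> cvs.span (eigen \<inter> N)"
    using x
  proof (induction rule: C.L_induct)
    case (wt \<gamma> y)
    have y: "y \<in> gpar g 0" using wt(2) C.wt_L by blast
    have \<gamma>: "\<gamma> \<in> C.ext" using wt(1) C.weights_ext by blast
    have "mact M (\<iota> y) n u \<in> eigen"
      unfolding eigen_def
    proof (intro CollectI conjI ballI)
      fix H assume H: "H \<in> h"
      then obtain c where c: "z H u = c *\<^sub>C u" using u by (auto simp: eigen_def)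
      have "z H (mact M (\<iota> y) n u) = mact M (\<iota> y) n (c *\<^sub>C u) + mact M (\<iota> (\<gamma> H *\<^sub>C y)) n u"
        using current_commutator[OF h_even[OF H] y, of n u] C.h_acts_semisimply[OF \<gamma> wt(2) H] c by simp
      also have "\<dots> = (c + \<gamma> H) *\<^sub>C mact M (\<iota> y) n u"
        by (simp add: clinear_simps[OF act_linear(1)] clinear_simps[OF zl] cvs.scale_left_distrib)
      finally show "\<exists>c. z H (mact M (\<iota> y) n u) = c *\<^sub>C mact M (\<iota> y) n u" by blast
    next
      obtain c where c: "L u = c *\<^sub>C u" using u by (auto simp: eigen_def)
      have "L (mact M (\<iota> y) n u) = (c - of_int n) *\<^sub>C mact M (\<iota> y) n u"
        unfolding L_current[OF y] c by (simp add: clinear_simps[OF act_linear(1)] cvs.scale_left_diff_distrib)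
      then show "\<exists>c. L (mact M (\<iota> y) n u) = c *\<^sub>C mact M (\<iota> y) n u" by blast
    qed
    moreover have "mact M (\<iota> y) n u \<in> N" using N[OF y] u by blast
    ultimately show ?case by (intro cvs.span_base) simp
  next
    case zero
    then show ?case by (simp add: clinear_simps[OF zl] cvs.span_zero)
  next
    case (comb c y v)
    then show ?case by (simp add: clinear_simps[OF zl] cvs.span_add cvs.span_scale)
  qed
qed

text \<open>A nonzero vector of \<open>N\<close> is killed by a product of operators \<open>L - \<mu>\<close>; the last nonzero partial
  product applied to it is an eigenvector.\<close>

lemma L_eigenvector_in:
  assumes N: "cvs.subspace N" "\<And>w. w \<in> N \<Longrightarrow> L w \<in> N" "N \<noteq> {0}"
    and gen: "cvs.span (\<Union>\<mu>. generalized_eigenspace L \<mu>) = UNIV"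
  obtains u \<mu> where "u \<in> N" "u \<noteq> 0" "L u = \<mu> *\<^sub>C u"
proof -
  define A where "A \<mu> = (\<lambda>u. L u - \<mu> *\<^sub>C u)" for \<mu>
  have linA: "clinear (A \<mu>)" for \<mu> unfolding A_def by (rule clinear_shift[OF L_linear])
  have commA: "A \<mu> (A \<nu> u) = A \<nu> (A \<mu> u)" for \<mu> \<nu> u
    by (simp add: A_def clinear_simps[OF L_linear] cvs.scale_right_diff_distrib mult.commute algebra_simps)
  have foldr_lin: "clinear (foldr A ms)" for ms
    by (induction ms) (auto intro!: clinearI simp: clinear_simps[OF linA] clinear_simps)
  have foldr_comm: "foldr A ms (A \<mu> u) = A \<mu> (foldr A ms u)" for ms \<mu> u
    by (induction ms) (simp_all add: commA)
  have foldr_comm': "foldr A ms (foldr A ns u) = foldr A ns (foldr A ms u)" for ms ns u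
    by (induction ms) (simp_all add: foldr_comm)
  have foldr_pow: "foldr A (replicate n \<mu>) = A \<mu> ^^ n" for n \<mu>
    by (induction n) simp_all
  have kill: "\<exists>ms. foldr A ms v = 0" for v
  proof -
    have "v \<in> cvs.span (\<Union>\<mu>. generalized_eigenspace L \<mu>)" using gen by simp
    then show ?thesis
    proof (induction rule: cvs.span_induct_alt)
      case base
      show ?case by (rule exI[of _ "[]"]) simp
    next
      case (step c x y)
      then obtain \<mu> n where "(A \<mu> ^^ n) x = 0" by (auto simp: generalized_eigenspace_def A_def)
      then have x: "foldr A (replicate n \<mu>) x = 0" by (simp add: foldr_pow)
      obtain ms where y: "foldr A ms y = 0" using step.IH by blast
      note fl = clinear_simps[OF foldr_lin]
      have "foldr A ms (foldr A (replicate n \<mu>) (c *\<^sub>C x + y)) = 0"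
        by (simp only: fl x foldr_comm'[of ms "replicate n \<mu>" y] y) simp
      then have "foldr A (ms @ replicate n \<mu>) (c *\<^sub>C x + y) = 0" by simp
      then show ?case by blast
    qed
  qed
  obtain v where v: "v \<in> N" "v \<noteq> 0" using N(1,3) cvs.subspace_0 by blast
  obtain ms where ms: "foldr A ms v = 0" using kill by blast
  have AN: "A \<mu> u \<in> N" if "u \<in> N" for \<mu> u
    unfolding A_def using N(1,2) that by (intro cvs.subspace_diff cvs.subspace_scale) auto
  have "\<exists>u\<in>N. \<exists>\<mu>. u \<noteq> 0 \<and> A \<mu> u = 0"
    using ms v
  proof (induction ms arbitrary: v)
    case (Cons \<mu> ms)
    show ?case
    proof (cases "foldr A ms v = 0")
      case True
      then show ?thesis using Cons.IH Cons.prems by blast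
    next
      case False
      have "foldr A ms v \<in> N" using Cons.prems(2) by (induction ms) (simp_all add: AN)
      then show ?thesis using False Cons.prems(1) by auto
    qed
  qed simp
  then obtain u \<mu> where "u \<in> N" "u \<noteq> 0" "A \<mu> u = 0" by blast
  then show ?thesis using that by (auto simp: A_def)
qed

text \<open>Local finiteness makes the eigenspace of \<open>L\<close> contain a nonzero finite-dimensional subspace
  stable under \<open>h\<close>.\<close>

lemma eigen_in_stable:
  assumes lf: "locally_finite \<iota> M" and gen: "cvs.span (\<Union>\<mu>. generalized_eigenspace L \<mu>) = UNIV"
    and N: "cvs.subspace N" "\<And>w. w \<in> N \<Longrightarrow> L w \<in> N" "N \<noteq> {0}"
    and cur: "\<And>x n w. x \<in> gpar g 0 \<Longrightarrow> w \<in> N \<Longrightarrow> mact M (\<iota> x) n w \<in> N"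
  shows "\<exists>v\<in>eigen \<inter> N. v \<noteq> 0"
proof -
  obtain u \<mu> where u: "u \<in> N" "u \<noteq> 0" "L u = \<mu> *\<^sub>C u" by (rule L_eigenvector_in[OF N gen])
  obtain E where E: "finite E" "u \<in> cvs.span E" "\<And>x u. u \<in> cvs.span E \<Longrightarrow> z x u \<in> cvs.span E"
    using lf unfolding locally_finite_def by metis
  define W where "W = {w \<in> cvs.span E \<inter> N. L w - \<mu> *\<^sub>C w = 0}"
  have subW: "cvs.subspace W" unfolding W_def
    by (intro clinear_kernel_subspace clinear_shift L_linear cvs.subspace_inter cvs.subspace_span N)
  have fdW: "fdim W" unfolding fdim_def W_def using E(1) by blast
  have ne: "W \<noteq> {0}" using u E(2) by (auto simp: W_def)
  have stab: "z H w \<in> W" if "H \<in> h" "w \<in> W" for H w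
    using that E(3) cur[OF h_even] L_z[OF h_even] by (simp add: W_def clinear_simps[OF z_linear(1)])
  obtain v where v: "v \<in> W" "v \<noteq> 0" "\<forall>T\<in>z ` h. \<exists>c. T v = c *\<^sub>C v"
  proof (rule common_eigenvector[OF fdW subW ne, of "z ` h"])
    show "clinear T" if "T \<in> z ` h" for T using that z_linear(1) by blast
    show "T x \<in> W" if "T \<in> z ` h" "x \<in> W" for T x using that stab by blast
    show "S (T x) = T (S x)" if "S \<in> z ` h" "T \<in> z ` h" for S T x using that z_commute by blast
    fix v assume "v \<in> W" "v \<noteq> 0" "\<forall>T\<in>z ` h. \<exists>c. T v = c *\<^sub>C v"
    then show thesis by (rule that)
  qed
  have "\<exists>c. L v = c *\<^sub>C v" using v(1) by (auto simp: W_def)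
  then have "v \<in> eigen" using v(3) by (simp add: eigen_def)
  then show ?thesis using v by (auto simp: W_def)
qed

text \<open>The vertex algebra \<open>U\<close> is generated by even vectors, hence purely even, and a subspace of \<open>M\<close>
  stable under the even currents is a \<open>U\<close>-submodule. For a simple submodule \<open>N\<close> this applies to the
  span of its common eigenvectors, which exist because conformality makes \<open>L\<close> the mode of a vector
  of \<open>U\<close>, so that \<open>L\<close> preserves \<open>N\<close>.\<close>

lemma conformal_case:
  fixes U :: "'u::complex_vector vertex_alg"
  assumes lf: "locally_finite \<iota> M" and gen: "cvs.span (\<Union>\<mu>. generalized_eigenspace L \<mu>) = UNIV"
    and conf: "conformal_even_embedding g k U \<iota>\<^sub>0 V \<iota> f" and ss: "semisimple_over f M"
  shows "cvs.span eigen = UNIV"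
proof -
  have U: "affine_vertex_algebra g (gpar g 0) k U \<iota>\<^sub>0"
    using conf by (simp add: conformal_even_embedding_def simple_affine_vertex_algebra_def)
  have emb: "vertex_embedding U V f" and f\<iota>: "\<And>x. x \<in> gpar g 0 \<Longrightarrow> f (\<iota>\<^sub>0 x) = \<iota> x"
    and f\<omega>: "f (even_sugawara g k U \<iota>\<^sub>0) = sugawara g k V \<iota>"
    using conf by (simp_all add: conformal_even_embedding_def)
  have linf: "clinear f" and fpar: "\<And>u p. u \<in> vpar U p \<Longrightarrow> f u \<in> vpar V p"
    and fvac: "f (vacuum U) = vacuum V" and fprod: "\<And>a n b. f (vprod U a n b) = vprod V (f a) n (f b)"
    using emb unfolding vertex_embedding_def by blast+
  have "\<forall>W. vertex_subalgebra U W \<and> \<iota>\<^sub>0 ` gpar g 0 \<subseteq> W \<longrightarrow> W = UNIV"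
    using U unfolding affine_vertex_algebra_def by (elim conjE)
  then have gener: "W = UNIV" if "vertex_subalgebra U W" "\<iota>\<^sub>0 ` gpar g 0 \<subseteq> W" for W
    using that by simp
  have "vertex_superalgebra U" using U unfolding affine_vertex_algebra_def by (elim conjE)
  then have Umod: "weak_module U \<lparr>mpar = vpar U, mact = vprod U\<rparr>" and Uvac: "vacuum U \<in> vpar U 0"
    by (simp_all add: vertex_superalgebra_def)
  have Uiota: "\<forall>p. \<forall>x\<in>gpar g 0 \<inter> gpar g p. \<iota>\<^sub>0 x \<in> vpar U p"
    using U unfolding affine_vertex_algebra_def by (elim conjE)
  have "vpar U 0 = UNIV"
  proof (rule gener)
    have "\<forall>p q. \<forall>a\<in>vpar U p. \<forall>w\<in>vpar U q. \<forall>n. vprod U a n w \<in> vpar U (p + q)"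
      using Umod unfolding weak_module_def vmodule.simps by (elim conjE)
    then have "vprod U a n b \<in> vpar U (0 + 0)" if "a \<in> vpar U 0" "b \<in> vpar U 0" for a n b using that by blast
    moreover have "cvs.subspace (vpar U 0)" using Umod by (simp add: weak_module_def superspace_def)
    ultimately show "vertex_subalgebra U (vpar U 0)" using Uvac by (simp add: vertex_subalgebra_def)
    show "\<iota>\<^sub>0 ` gpar g 0 \<subseteq> vpar U 0" using Uiota by blast
  qed
  then have feven: "f u \<in> vpar V 0" for u using fpar by auto
  have sub: "submodule (\<lambda>u. mact M (f u)) W"
    if W: "cvs.subspace W" "\<And>x n w. x \<in> gpar g 0 \<Longrightarrow> w \<in> W \<Longrightarrow> mact M (\<iota> x) n w \<in> W" for W
  proof -
    define X where "X = {u. \<forall>n. \<forall>w\<in>W. mact M (f u) n w \<in> W}"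
    have "X = UNIV"
    proof (rule gener)
      show "vertex_subalgebra U X"
        unfolding vertex_subalgebra_def
      proof (intro conjI allI ballI)
        show "cvs.subspace X" using W(1)
          by (auto simp: X_def cvs.subspace_def clinear_simps[OF linf] clinear_simps[OF act_linear(2)])
        show "vacuum U \<in> X" by (simp add: X_def fvac act_vacuum cvs.subspace_0[OF W(1)])
        show "vprod U a n b \<in> X" if "a \<in> X" "b \<in> X" for n a b
          using that act_product_mem[OF W(1) feven feven] by (simp add: X_def fprod)
      qed
      show "\<iota>\<^sub>0 ` gpar g 0 \<subseteq> X" using W(2) by (auto simp: X_def f\<iota>)
    qed
    then show ?thesis using W(1) by (auto simp: submodule_def X_def)
  qed
  obtain \<S> where S: "\<forall>N\<in>\<S>. simple_submodule (\<lambda>u. mact M (f u)) N" "cvs.span (\<Union>\<S>) = UNIV"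
    using ss unfolding semisimple_over_def semisimple_module_def by (elim exE conjE)
  have "N \<subseteq> cvs.span eigen" if "N \<in> \<S>" for N
  proof -
    have simp: "simple_submodule (\<lambda>u. mact M (f u)) N" using S that by blast
    have subN: "cvs.subspace N" and actN: "\<And>u n w. w \<in> N \<Longrightarrow> mact M (f u) n w \<in> N" and ne: "N \<noteq> {0}"
      using simp by (auto simp: simple_submodule_def submodule_def)
    have cur: "mact M (\<iota> x) n w \<in> N" if "x \<in> gpar g 0" "w \<in> N" for x n w
      using actN[OF that(2), of "\<iota>\<^sub>0 x" n] f\<iota>[OF that(1)] by simp
    have LN: "L w \<in> N" if "w \<in> N" for w
      using actN[OF that, of "even_sugawara g k U \<iota>\<^sub>0" 1] f\<omega> by (simp add: L0_def)
    let ?N' = "cvs.span (eigen \<inter> N)"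
    have "submodule (\<lambda>u. mact M (f u)) ?N'"
      by (rule sub) (auto intro!: span_eigen_currents cur)
    moreover have "?N' \<subseteq> N" by (rule cvs.span_minimal[OF _ subN]) simp
    moreover obtain v where "v \<in> eigen \<inter> N" "v \<noteq> 0"
      using eigen_in_stable[OF lf gen subN LN ne cur] by blast
    then have "?N' \<noteq> {0}" using cvs.span_base by blast
    ultimately have "?N' = N" using simp unfolding simple_submodule_def by blast
    moreover have "?N' \<subseteq> cvs.span eigen" by (rule cvs.span_mono) simp
    ultimately show ?thesis by simp
  qed
  then have "\<Union>\<S> \<subseteq> cvs.span eigen" by blast
  then have "cvs.span (\<Union>\<S>) \<subseteq> cvs.span eigen" by (rule cvs.span_minimal) simp
  then show ?thesis unfolding S(2) by (rule top.extremum_uniqueI)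
qed

end

theorem proposition5p1:
  fixes g :: "'g::complex_vector super_lie" and h :: "'g set" and \<theta> :: "'g \<Rightarrow> complex"
    and k :: complex and V :: "'v::complex_vector vertex_alg" and \<iota> :: "'g \<Rightarrow> 'v"
  assumes basic: "basic_lie_superalgebra g"
    and cartan: "cartan_subalgebra g (gpar g 0) h"
    and theta: "highest_even_root g h \<theta>"
    and normalized: "dual_form g h \<theta> \<theta> = 2"
    and level: "k \<noteq> - dual_coxeter g UNIV"
    and V: "simple_affine_vertex_algebra g UNIV k V \<iota>"
  shows "(semisimple_lie g (gpar g 0) \<longrightarrow>
            KL_fin g h k V \<iota> = (KL_ss g k V \<iota> :: ('v, 'w::complex_vector) vmodule set)) \<and>
         ((\<exists>(U :: 'u::complex_vector vertex_alg) \<iota>\<^sub>0 f.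
              conformal_even_embedding g k U \<iota>\<^sub>0 V \<iota> f \<and>
              (\<forall>W \<in> (KL g k V \<iota> :: ('v, 'w) vmodule set). semisimple_over f W)) \<longrightarrow>
            KL_fin g h k V \<iota> = (KL g k V \<iota> :: ('v, 'w) vmodule set))"
proof -
  have affine: "affine_vertex_algebra g UNIV k V \<iota>"
    using V by (simp add: simple_affine_vertex_algebra_def)
  have loc: "cartan_module g k V \<iota> M h" if "M \<in> KL g k V \<iota>" for M :: "('v, 'w) vmodule"
  proof -
    have "weak_module V M" using that by (simp add: KL_def)
    then show ?thesis
      by (intro cartan_module.intro affine_module.intro affine_vertex.intro basic_with_cartan.intro
          basic_superalgebra.intro affine_vertex_axioms.intro basic_with_cartan_axioms.intro
          vertex_module.intro basic cartan affine level)
  qed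
  have fin: "M \<in> KL_fin g h k V \<iota>" if M: "M \<in> KL g k V \<iota>" and sp: "cvs.span (cartan_module.eigen g k V \<iota> M h) = UNIV"
    for M :: "('v, 'w) vmodule"
  proof -
    interpret cartan_module g k V \<iota> M h by (rule loc[OF M])
    show ?thesis using M span_eigen_acts_semisimply[OF sp] by (simp add: KL_fin_def)
  qed
  show ?thesis
  proof (intro conjI impI)
    assume ss: "semisimple_lie g (gpar g 0)"
    show "KL_fin g h k V \<iota> = (KL_ss g k V \<iota> :: ('v, 'w) vmodule set)"
    proof (intro set_eqI iffI)
      fix M :: "('v, 'w) vmodule" assume M: "M \<in> KL_fin g h k V \<iota>"
      then have KL: "M \<in> KL g k V \<iota>" by (simp add: KL_fin_def)
      interpret cartan_module g k V \<iota> M h by (rule loc[OF KL])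
      show "M \<in> KL_ss g k V \<iota>" using M acts_semisimply_L by (simp add: KL_fin_def KL_ss_def)
    next
      fix M :: "('v, 'w) vmodule" assume M: "M \<in> KL_ss g k V \<iota>"
      then have KL: "M \<in> KL g k V \<iota>" by (simp add: KL_ss_def)
      interpret cartan_module g k V \<iota> M h by (rule loc[OF KL])
      have "locally_finite \<iota> M" using KL by (simp add: KL_def)
      then show "M \<in> KL_fin g h k V \<iota>"
        using M by (intro fin[OF KL] semisimple_case ss) (simp_all add: KL_ss_def)
    qed
  next
    assume "\<exists>(U :: 'u vertex_alg) \<iota>\<^sub>0 f. conformal_even_embedding g k U \<iota>\<^sub>0 V \<iota> f \<and>
              (\<forall>W \<in> (KL g k V \<iota> :: ('v, 'w) vmodule set). semisimple_over f W)"
    then obtain U :: "'u vertex_alg" and \<iota>\<^sub>0 f where U: "conformal_even_embedding g k U \<iota>\<^sub>0 V \<iota> f"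
      and ss: "\<And>W. W \<in> (KL g k V \<iota> :: ('v, 'w) vmodule set) \<Longrightarrow> semisimple_over f W" by blast
    show "KL_fin g h k V \<iota> = (KL g k V \<iota> :: ('v, 'w) vmodule set)"
    proof (intro set_eqI iffI)
      fix M :: "('v, 'w) vmodule" assume KL: "M \<in> KL g k V \<iota>"
      interpret cartan_module g k V \<iota> M h by (rule loc[OF KL])
      have "locally_finite \<iota> M" "cvs.span (\<Union>\<mu>. generalized_eigenspace L \<mu>) = UNIV" using KL by (simp_all add: KL_def)
      then show "M \<in> KL_fin g h k V \<iota>" by (intro fin[OF KL] conformal_case[OF _ _ U ss[OF KL]])
    qed (simp add: KL_fin_def)
  qed
qed

end
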